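(* For every odd integer $r\geq 3$ and every integer $s\geq 3$ there exists $\varepsilon=\varepsilon(s)>0$, depending only on $s$, such that for every positive integer $t$, $$\mathrm{ex}\big(n,K^{(r)}_{s,t}\big)=O_{r,s,t}\Big(n^{\,r-\frac{1}{s-1}-\varepsilon}\Big),$$ i.e. there is a constant $C=C(r,s,t)$ such that every $n$-vertex $r$-uniform hypergraph containing no copy of $K^{(r)}_{s,t}$ has at most $C\,n^{r-\frac{1}{s-1}-\varepsilon}$ edges.
   Context: For positive integers $r,s,t$, $K^{(r)}_{s,t}$ denotes the $r$-uniform hypergraph with vertex set $\left(\bigcup_{i\in[t]}X_i\right)\cup Y$ and edge set $\{X_i\cup\{y\}: i\in[t],\,y\in Y\}$, where $X_1,\dots,X_t$ are pairwise disjoint sets of size $r-1$ and $Y$ is a set of size $s$ disjoint from each $X_i$. For an $r$-uniform hypergraph $H$, $\mathrm{ex}(n,H)$ is the maximum number of edges in an $n$-vertex $r$-uniform hypergraph containing no copy of $H$ as a subgraph. *)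

theory Defs
  imports Complex_Main
begin

type_synonym 'a hypergraph = "'a set \<times> 'a set set"

abbreviation verts :: "'a hypergraph \<Rightarrow> 'a set" where
  "verts G \<equiv> fst G"

abbreviation edges :: "'a hypergraph \<Rightarrow> 'a set set" where
  "edges G \<equiv> snd G"

definition uniform_hypergraph :: "nat \<Rightarrow> 'a hypergraph \<Rightarrow> bool" where
  "uniform_hypergraph r G \<longleftrightarrow>
     finite (verts G) \<and> (\<forall>e\<in>edges G. e \<subseteq> verts G \<and> card e = r)"

text \<open>Copies are as subgraphs, not necessarily induced.\<close>

definition contains_copy :: "'a hypergraph \<Rightarrow> 'b hypergraph \<Rightarrow> bool" where
  "contains_copy G H \<longleftrightarrow>
     (\<exists>f. inj_on f (verts H) \<and> f ` verts H \<subseteq> verts G \<and> (\<forall>e\<in>edges H. f ` e \<in> edges G))"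

text \<open>Vertices are taken from \<^typ>\<open>nat\<close>; by \<open>card_edges_le_extremal_number\<close> below, the
  resulting bound applies to finite hypergraphs over any vertex type, and by
  \<open>extremal_number_attained\<close> the maximum is over a nonempty set whenever \<open>H\<close> has an edge.\<close>

definition extremal_number :: "nat \<Rightarrow> nat \<Rightarrow> 'b hypergraph \<Rightarrow> nat" where
  "extremal_number r n H =
     Max {card (edges G) | G :: nat hypergraph.
            uniform_hypergraph r G \<and> card (verts G) = n \<and> \<not> contains_copy G H}"

text \<open>The vertices \<open>Inl (i, j)\<close> with \<open>j < r - 1\<close> form \<open>X\<^sub>i\<close>, and the vertices \<open>Inr y\<close> form \<open>Y\<close>.\<close>

definition K_part :: "nat \<Rightarrow> nat \<Rightarrow> (nat \<times> nat + nat) set" where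
  "K_part r i = {Inl (i, j) | j. j < r - 1}"

definition K_hyp :: "nat \<Rightarrow> nat \<Rightarrow> nat \<Rightarrow> (nat \<times> nat + nat) hypergraph" where
  "K_hyp r s t =
     ((\<Union>i<t. K_part r i) \<union> Inr ` {..<s},
      {K_part r i \<union> {Inr y} | i y. i < t \<and> y < s})"

lemma card_edges_le_two_power:
  assumes "uniform_hypergraph r G"
  shows "card (edges G) \<le> 2 ^ card (verts G)"
proof -
  have "finite (verts G)" "edges G \<subseteq> Pow (verts G)"
    using assms by (auto simp: uniform_hypergraph_def)
  then show ?thesis
    by (metis card_Pow card_mono finite_Pow_iff)
qed

lemma finite_extremal_candidates:
  "finite {card (edges G) | G :: nat hypergraph.
            uniform_hypergraph r G \<and> card (verts G) = n \<and> \<not> contains_copy G H}"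
  by (rule finite_subset[of _ "{..2 ^ n}"]) (auto dest: card_edges_le_two_power)

lemma extremal_number_attained:
  assumes "edges H \<noteq> {}"
  obtains G :: "nat hypergraph" where "uniform_hypergraph r G" "card (verts G) = n"
    "\<not> contains_copy G H" "card (edges G) = extremal_number r n H"
proof -
  let ?S = "{card (edges G) | G :: nat hypergraph.
            uniform_hypergraph r G \<and> card (verts G) = n \<and> \<not> contains_copy G H}"
  have "uniform_hypergraph r ({..<n}, {}) \<and> card (verts ({..<n}, {} :: nat set set)) = n
      \<and> \<not> contains_copy ({..<n}, {}) H"
    using assms by (auto simp: uniform_hypergraph_def contains_copy_def)
  then have "?S \<noteq> {}" by blast
  then have "extremal_number r n H \<in> ?S"
    unfolding extremal_number_def using finite_extremal_candidates by (rule Max_in[rotated])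
  then show ?thesis using that by auto
qed

lemma card_edges_le_extremal_number:
  fixes G :: "'a hypergraph"
  assumes G: "uniform_hypergraph r G" "card (verts G) = n" "\<not> contains_copy G H"
  shows "card (edges G) \<le> extremal_number r n H"
proof -
  have fin: "finite (verts G)" and sub: "edges G \<subseteq> Pow (verts G)"
    using G(1) by (auto simp: uniform_hypergraph_def)
  obtain h :: "'a \<Rightarrow> nat" where h: "inj_on h (verts G)"
    using finite_imp_inj_to_nat_seg[OF fin] by blast
  let ?G = "(h ` verts G, (`) h ` edges G)"
  have inj: "inj_on ((`) h) (edges G)"
    using inj_on_subset[OF inj_on_image_Pow[OF h] sub] .
  have "uniform_hypergraph r ?G"
    using G(1) h unfolding uniform_hypergraph_def
    by (auto simp: card_image inj_on_subset)
  moreover have "card (verts ?G) = n" using G(2) h by (simp add: card_image)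
  moreover have "\<not> contains_copy ?G H"
  proof
    assume "contains_copy ?G H"
    then obtain f where f: "inj_on f (verts H)" "f ` verts H \<subseteq> h ` verts G"
      "\<And>e. e \<in> edges H \<Longrightarrow> f ` e \<in> (`) h ` edges G"
      by (auto simp: contains_copy_def)
    let ?k = "inv_into (verts G) h"
    have "inj_on (?k \<circ> f) (verts H)"
      using f(1,2) by (intro comp_inj_on) (auto intro: inj_on_subset[OF inj_on_inv_into])
    moreover have "(?k \<circ> f) ` verts H \<subseteq> verts G"
      using f(2) by (auto simp: image_subset_iff intro: inv_into_into)
    moreover have "(?k \<circ> f) ` e \<in> edges G" if e: "e \<in> edges H" for e
    proof -
      obtain d where d: "d \<in> edges G" "f ` e = h ` d" using f(3)[OF e] by auto
      have "(?k \<circ> f) ` e = ?k ` (h ` d)" using d(2) by (metis image_comp)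
      also have "\<dots> = d" using d(1) sub h by (intro inv_into_image_cancel) auto
      finally show ?thesis using d(1) by simp
    qed
    ultimately show False using G(3) unfolding contains_copy_def by blast
  qed
  ultimately have "card (edges ?G) \<le> extremal_number r n H"
    unfolding extremal_number_def
    by (intro Max_ge finite_extremal_candidates) blast
  then show ?thesis using inj by (simp add: card_image)
qed

lemma uniform_hypergraph_K_hyp:
  assumes "r \<ge> 1"
  shows "uniform_hypergraph r (K_hyp r s t)"
proof -
  have K: "K_part r i = (\<lambda>j. Inl (i, j)) ` {..<r - 1}" for i
    by (auto simp: K_part_def)
  have "finite (K_part r i)" "card (K_part r i) = r - 1" "Inr y \<notin> K_part r i" for i y
    by (auto simp: K card_image inj_on_def)
  then show ?thesis
    using assms by (auto simp: uniform_hypergraph_def K_hyp_def)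
qed

end

theory Submission
  imports Defs "HOL-Library.Disjoint_Sets" "HOL-Library.Z2"
begin

text \<open>Encode the edges as a set \<open>G\<close> of \<open>r\<close>-tuples over a vertex set of size \<open>N\<close> and write
  \<open>N\<^bsup>r - 1\<^esup> D\<close> for the claimed bound on \<open>|G|\<close>. If \<open>G\<close> has no copy of the forbidden hypergraph, the
  common link of any \<open>s\<close>-list \<open>Y\<close> placed in coordinate \<open>i\<close> has a cover \<open>S i Y\<close> of bounded size.
  Counting the pairs \<open>(Y, v)\<close> with \<open>v \<in> S i Y\<close> against the extensions of each edge shows that all
  codegrees and pair degrees of \<open>G\<close> are essentially as in a regular system, up to factors \<open>Q\<^bsup>O(1)\<^esup>\<close>
  with \<open>Q = N\<^bsup>\<epsilon>\<^esup>\<close>.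

  By pigeonhole there is a fixed-point-free map \<open>\<pi>\<close> on the coordinates such that, for typical
  edges and every \<open>i\<close>, the link of an \<open>s\<close>-list in coordinate \<open>i\<close> is concentrated on a vertex in
  coordinate \<open>\<pi> i\<close>. Since \<open>r\<close> is odd, \<open>\<pi>\<close> is not an involution, so there are distinct \<open>i\<close>,
  \<open>j = \<pi> i\<close>, \<open>k = \<pi> j\<close>. A random choice of centres yields a dense subsystem in which every
  neighbourhood in coordinate \<open>i\<close> lies in one class of a partition into sets of size about \<open>D\<close>
  that depends only on the \<open>j\<close>-th entry, and similarly for \<open>j\<close> and \<open>k\<close>. The two structures
  together force typical \<open>s\<close>-lists in coordinate \<open>i\<close> to have links larger than average by a factor
  \<open>D\<close>, hence there are few such lists, contradicting the count of pairs \<open>(Y, v)\<close>. Only boundedly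
  many steps lose a power of \<open>Q\<close>; the losses depending on \<open>r\<close> and \<open>t\<close> are constants, which is why
  \<open>\<epsilon>\<close> depends on \<open>s\<close> only.\<close>

section \<open>Counting\<close>

lemma card_UN_le_mult:
  fixes m :: real
  assumes "finite I" "\<And>i. i \<in> I \<Longrightarrow> real (card (A i)) \<le> m"
  shows "real (card (\<Union>i\<in>I. A i)) \<le> real (card I) * m"
proof -
  have "real (card (\<Union>i\<in>I. A i)) \<le> real (\<Sum>i\<in>I. card (A i))"
    by (intro of_nat_mono card_UN_le assms(1))
  also have "\<dots> = (\<Sum>i\<in>I. real (card (A i)))" by simp
  also have "\<dots> \<le> real (card I) * m" using assms(2) by (rule sum_bounded_above)
  finally show ?thesis .
qed

lemma card_le_fibres:
  fixes m :: real
  assumes "finite B" "f ` A \<subseteq> B" "\<And>b. b \<in> B \<Longrightarrow> real (card {a \<in> A. f a = b}) \<le> m"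
  shows "real (card A) \<le> real (card B) * m"
proof -
  have "A = (\<Union>b\<in>B. {a \<in> A. f a = b})" using assms(2) by blast
  then show ?thesis
    using card_UN_le_mult[of B "\<lambda>b. {a \<in> A. f a = b}" m] assms(1,3) by simp
qed

lemma card_ge_fibres:
  fixes m :: real
  assumes "finite A" "finite B" "\<And>b. b \<in> B \<Longrightarrow> m \<le> real (card {a \<in> A. f a = b})"
  shows "real (card B) * m \<le> real (card A)"
proof -
  have "real (card B) * m \<le> (\<Sum>b\<in>B. real (card {a \<in> A. f a = b}))"
    using assms(3) by (rule sum_bounded_below)
  also have "\<dots> = real (card (\<Union>b\<in>B. {a \<in> A. f a = b}))"
    using assms(1,2) by (subst card_UN_disjoint) auto
  also have "\<dots> \<le> real (card A)" using assms(1) by (intro of_nat_mono card_mono) auto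
  finally show ?thesis .
qed

lemma card_Sigma_le:
  fixes m :: real
  assumes "finite A" "\<And>a. a \<in> A \<Longrightarrow> real (card (B a)) \<le> m"
  shows "real (card (Sigma A B)) \<le> real (card A) * m"
proof -
  have "Sigma A B = (\<Union>a\<in>A. Pair a ` B a)" by auto
  moreover have "real (card (Pair a ` B a)) \<le> m" if "a \<in> A" for a
    using assms(2)[OF that] by (simp add: card_image inj_on_def)
  ultimately show ?thesis using card_UN_le_mult[OF assms(1), of "\<lambda>a. Pair a ` B a"] by simp
qed

lemma card_Sigma_ge:
  fixes m :: real
  assumes "finite A" "\<And>a. a \<in> A \<Longrightarrow> finite (B a)" "\<And>a. a \<in> A \<Longrightarrow> m \<le> real (card (B a))"
  shows "real (card A) * m \<le> real (card (Sigma A B))"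
proof -
  have "real (card (Sigma A B)) = (\<Sum>a\<in>A. real (card (B a)))" using assms(1,2) by simp
  then show ?thesis using sum_bounded_below[OF assms(3)] by simp
qed

lemma pigeonhole_cover:
  assumes "finite J" "J \<noteq> {}" "\<And>a. a \<in> A \<Longrightarrow> \<exists>j\<in>J. P a j"
  obtains j where "j \<in> J" "real (card A) \<le> real (card J) * real (card {a \<in> A. P a j})"
proof -
  obtain j where j: "j \<in> J" "Max ((\<lambda>j. card {a \<in> A. P a j}) ` J) = card {a \<in> A. P a j}"
    using assms(1,2) by (rule obtains_MAX)
  have "A = (\<Union>j\<in>J. {a \<in> A. P a j})" using assms(3) by blast
  moreover have "card {a \<in> A. P a j'} \<le> card {a \<in> A. P a j}" if "j' \<in> J" for j'
    unfolding j(2)[symmetric] using assms(1) that by simp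
  ultimately have "real (card A) \<le> real (card J) * real (card {a \<in> A. P a j})"
    using card_UN_le_mult[OF assms(1), of "\<lambda>j. {a \<in> A. P a j}"] by simp
  with j(1) show ?thesis by (rule that)
qed

lemma double_counting_average:
  fixes q :: real
  assumes "finite A" "A \<noteq> {}" "finite B"
    and "\<And>b. b \<in> B \<Longrightarrow> q * real (card A) \<le> real (card {a \<in> A. R a b})"
  obtains a where "a \<in> A" "q * real (card B) \<le> real (card {b \<in> B. R a b})"
proof -
  obtain a where a: "a \<in> A" "Max ((\<lambda>a. card {b \<in> B. R a b}) ` A) = card {b \<in> B. R a b}"
    using assms(1,2) by (rule obtains_MAX)
  have "q * real (card B) * real (card A) = real (card B) * (q * real (card A))" by simp
  also have "\<dots> \<le> (\<Sum>b\<in>B. real (card {a \<in> A. R a b}))"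
    using assms(4) by (rule sum_bounded_below)
  also have "\<dots> = real (\<Sum>a\<in>A. card {b \<in> B. R a b})"
    using sum_multicount_gen[OF assms(1,3), of R "\<lambda>b. card {a \<in> A. R a b}"] by simp
  also have "\<dots> \<le> real (card A * card {b \<in> B. R a b})"
    unfolding a(2)[symmetric] using assms(1)
    by (intro of_nat_mono order_trans[OF sum_bounded_above[of A _ "Max ((\<lambda>a. card {b \<in> B. R a b}) ` A)"]]) auto
  finally have "q * real (card B) \<le> real (card {b \<in> B. R a b})"
    using assms(1,2) by (simp add: card_gt_0_iff mult.commute)
  with a(1) show ?thesis by (rule that)
qed

lemma card_majority_le:
  fixes p :: real
  assumes "finite A" "finite P" "\<And>a. a \<in> A \<Longrightarrow> finite (B a)" "\<And>a. a \<in> A \<Longrightarrow> p \<le> real (card (B a))"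
  shows "real (card {a \<in> A. card (B a) < 2 * card {b \<in> B a. (a, b) \<in> P}}) * p \<le> 2 * real (card P)"
proof -
  let ?M = "{a \<in> A. card (B a) < 2 * card {b \<in> B a. (a, b) \<in> P}}"
  have "real (card ?M) * (p / 2) \<le> real (card (SIGMA a:?M. {b \<in> B a. (a, b) \<in> P}))"
  proof (rule card_Sigma_ge)
    show "p / 2 \<le> real (card {b \<in> B a. (a, b) \<in> P})" if "a \<in> ?M" for a
      using that assms(4)[of a] by simp
  qed (use assms in auto)
  also have "\<dots> \<le> real (card P)" using assms(2) by (intro of_nat_mono card_mono) auto
  finally show ?thesis by simp
qed

lemma even_card_fixpoint_free_involution:
  assumes "\<And>x. x \<in> A \<Longrightarrow> f x \<in> A" "\<And>x. x \<in> A \<Longrightarrow> f (f x) = x" "\<And>x. x \<in> A \<Longrightarrow> f x \<noteq> x"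
  shows "even (card A)"
proof -
  have "(\<Sum>x\<in>A. 1 :: bit) = 0" by (rule sum_involution_eq_0[OF _ assms]) simp
  then have "even (of_nat (card A) :: bit)" by simp
  then show ?thesis by (simp only: even_of_nat)
qed

definition distinct_lists :: "nat \<Rightarrow> 'a set \<Rightarrow> 'a list set" where
  "distinct_lists k A = {Y. length Y = k \<and> distinct Y \<and> set Y \<subseteq> A}"

lemma distinct_lists_mono: "A \<subseteq> B \<Longrightarrow> distinct_lists k A \<subseteq> distinct_lists k B"
  by (auto simp: distinct_lists_def)

lemma finite_distinct_lists: "finite A \<Longrightarrow> finite (distinct_lists k A)"
  unfolding distinct_lists_def
  by (rule finite_subset[OF _ finite_lists_length_eq[of A k]]) auto

lemma card_distinct_lists_le:
  fixes m :: real
  assumes "finite A" "real (card A) \<le> m"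
  shows "real (card (distinct_lists k A)) \<le> m ^ k"
proof -
  have "card (distinct_lists k A) \<le> card {Y. set Y \<subseteq> A \<and> length Y = k}"
    unfolding distinct_lists_def by (intro card_mono finite_lists_length_eq assms) auto
  also have "\<dots> = card A ^ k" by (rule card_lists_length_eq) fact
  finally have "real (card (distinct_lists k A)) \<le> real (card A) ^ k"
    by (metis of_nat_le_iff of_nat_power)
  also have "\<dots> \<le> m ^ k" using assms(2) by (intro power_mono) auto
  finally show ?thesis .
qed

lemma card_distinct_lists_ge:
  fixes d :: real
  assumes "finite A" "d \<le> real (card A)" "real k \<le> d / 2" "k \<ge> 1"
  shows "(d / 2) ^ k \<le> real (card (distinct_lists k A))"
proof -
  have k: "k \<le> card A" using assms by linarith
  have "(d / 2) ^ k = (\<Prod>m\<in>{card A - k + 1..card A}. d / 2)" using k by simp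
  also have "\<dots> \<le> (\<Prod>m\<in>{card A - k + 1..card A}. real m)"
  proof (rule prod_mono)
    fix m assume "m \<in> {card A - k + 1..card A}"
    then have "real (card A) + 1 \<le> real m + real k" using k by auto
    then show "0 \<le> d / 2 \<and> d / 2 \<le> real m" using assms by linarith
  qed
  also have "\<dots> = real (card (distinct_lists k A))"
    using card_lists_distinct_length_eq[OF assms(1) k] by (simp add: distinct_lists_def)
  finally show ?thesis .
qed

subsection \<open>Random subsets\<close>

lemma card_PiE_vanishing_on:
  assumes "finite V" "B \<subseteq> V" "M > 0"
  shows "card {f \<in> PiE V (\<lambda>_. {..<M}). \<forall>v\<in>B. f v = (0::nat)} * M ^ card B = M ^ card V"
proof -
  have "{f \<in> PiE V (\<lambda>_. {..<M}). \<forall>v\<in>B. f v = 0} = PiE V (\<lambda>v. if v \<in> B then {0} else {..<M})"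
    using assms(2,3) by (auto simp: PiE_iff subset_iff extensional_def split: if_splits)
  moreover have "card (PiE V (\<lambda>v. if v \<in> B then {0} else {..<M})) = M ^ card (V - B)"
  proof -
    have "card (PiE V (\<lambda>v. if v \<in> B then {0} else {..<M})) = (\<Prod>v\<in>V. if v \<in> B then 1 else M)"
      using assms(1) by (simp add: card_PiE if_distrib cong: if_cong)
    also have "\<dots> = (\<Prod>v\<in>V - B. M)"
      using assms(1,2) by (intro prod.mono_neutral_cong_right) auto
    finally show ?thesis by simp
  qed
  moreover have "card V = card (V - B) + card B"
    using assms(1,2) by (metis card_Diff_subset card_mono finite_subset le_add_diff_inverse2)
  ultimately show ?thesis by (simp add: power_add)
qed

text \<open>Bonferroni: if the zero set of a random \<open>f\<close> contains \<open>b\<close>, it meets \<open>U\<close> only in \<open>b\<close> with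
  probability at least \<open>1 - |U| / M\<close>, by a union bound using pairwise independence only.\<close>

lemma card_isolating_functions_ge:
  assumes "finite V" "U \<subseteq> V" "b \<in> U" "2 * card U \<le> M"
  shows "M ^ card V \<le> 2 * M * card {f \<in> PiE V (\<lambda>_. {..<M}). {v \<in> U. f v = (0::nat)} = {b}}"
proof -
  let ?vanishing = "\<lambda>B. {f \<in> PiE V (\<lambda>_. {..<M}). \<forall>v\<in>B. f v = (0::nat)}"
  let ?isolating = "{f \<in> PiE V (\<lambda>_. {..<M}). {v \<in> U. f v = (0::nat)} = {b}}"
  have finite_U: "finite U" using assms(1,2) finite_subset by blast
  have M: "M > 0" using assms(3,4) finite_U card_gt_0_iff[of U] by fastforce
  have finite_functions: "finite (PiE V (\<lambda>_. {..<M}))" using assms(1) by (intro finite_PiE) auto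
  have card_vanishing_at: "card (?vanishing {b}) * M = M ^ card V"
    using card_PiE_vanishing_on[of V "{b}" M] assms M by auto
  have card_vanishing_pair: "card (?vanishing {b, u}) * M\<^sup>2 = M ^ card V" if "u \<in> U - {b}" for u
  proof -
    have "card {b, u} = 2" "{b, u} \<subseteq> V" using that assms by auto
    then show ?thesis using card_PiE_vanishing_on[of V "{b, u}" M] assms(1) M by simp
  qed
  have "?vanishing {b} \<subseteq> ?isolating \<union> (\<Union>u\<in>U - {b}. ?vanishing {b, u})" using assms by auto
  then have "card (?vanishing {b}) \<le> card (?isolating \<union> (\<Union>u\<in>U - {b}. ?vanishing {b, u}))"
    using finite_functions finite_U by (intro card_mono) auto
  also have "\<dots> \<le> card ?isolating + (\<Sum>u\<in>U - {b}. card (?vanishing {b, u}))"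
    using finite_U card_UN_le[of "U - {b}"] by (intro order_trans[OF card_Un_le] add_mono) auto
  finally have "card (?vanishing {b}) * M\<^sup>2
      \<le> (card ?isolating + (\<Sum>u\<in>U - {b}. card (?vanishing {b, u}))) * M\<^sup>2"
    by (rule mult_right_mono) simp
  also have "\<dots> = card ?isolating * M\<^sup>2 + (\<Sum>u\<in>U - {b}. card (?vanishing {b, u}) * M\<^sup>2)"
    by (simp only: add_mult_distrib sum_distrib_right)
  also have "(\<Sum>u\<in>U - {b}. card (?vanishing {b, u}) * M\<^sup>2) = card (U - {b}) * M ^ card V"
    by (simp only: sum.cong[OF refl card_vanishing_pair] sum_constant of_nat_id)
  finally have "2 * (M * M ^ card V) \<le> 2 * (card ?isolating * M\<^sup>2) + 2 * card (U - {b}) * M ^ card V"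
    unfolding card_vanishing_at[symmetric] by (simp only: power2_eq_square mult_ac)
  also have "2 * card (U - {b}) * M ^ card V \<le> M * M ^ card V"
    using assms(4) card_Diff1_le[of U b] by (intro mult_right_mono) auto
  finally have "M * M ^ card V \<le> M * (2 * M * card ?isolating)"
    by (simp add: power2_eq_square mult_ac)
  then show ?thesis using M by simp
qed

lemma isolating_set_exists:
  fixes U W :: "'e \<Rightarrow> 'a set" and m :: real
  assumes "finite V" "finite A" "M > 0"
    and U: "\<And>e. e \<in> A \<Longrightarrow> U e \<subseteq> V" "\<And>e. e \<in> A \<Longrightarrow> 2 * card (U e) \<le> M"
    and W: "\<And>e. e \<in> A \<Longrightarrow> W e \<subseteq> U e" "\<And>e. e \<in> A \<Longrightarrow> m \<le> real (card (W e))"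
  shows "\<exists>P\<subseteq>V. m / (2 * real M) * real (card A) \<le> real (card {e \<in> A. \<exists>b\<in>W e. P \<inter> U e = {b}})"
proof -
  let ?functions = "PiE V (\<lambda>_. {..<M})"
  let ?isolates = "\<lambda>f e. \<exists>b\<in>W e. {v \<in> U e. f v = (0::nat)} = {b}"
  have finite_functions: "finite ?functions" using assms(1) by (intro finite_PiE) auto
  have functions_ne: "?functions \<noteq> {}" using assms(3) by (auto simp: PiE_eq_empty_iff)
  have isolating: "m / (2 * real M) * real (card ?functions) \<le> real (card {f \<in> ?functions. ?isolates f e})"
    if e: "e \<in> A" for e
  proof -
    let ?q = "real (M ^ card V) / (2 * real M)"
    have finite_W: "finite (W e)" using U(1)[OF e] W(1)[OF e] assms(1) by (meson finite_subset)
    have "m / (2 * real M) * real (card ?functions) = m * ?q" using assms(1) by (simp add: card_PiE)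
    also have "\<dots> \<le> real (card (W e)) * ?q" using W(2)[OF e] by (intro mult_right_mono) auto
    also have "\<dots> = real (card ((\<lambda>b. {b}) ` W e)) * ?q" by (simp add: card_image)
    also have "\<dots> \<le> real (card {f \<in> ?functions. ?isolates f e})"
    proof (rule card_ge_fibres[where f = "\<lambda>f. {v \<in> U e. f v = (0::nat)}"])
      fix B assume "B \<in> (\<lambda>b. {b}) ` W e"
      then obtain b where b: "b \<in> W e" "B = {b}" by blast
      then have "M ^ card V \<le> 2 * M * card {f \<in> ?functions. {v \<in> U e. f v = (0::nat)} = {b}}"
        using card_isolating_functions_ge[OF assms(1) U(1)[OF e] _ U(2)[OF e]] W(1)[OF e] by blast
      also have "{f \<in> ?functions. {v \<in> U e. f v = (0::nat)} = {b}}
          = {f \<in> {f \<in> ?functions. ?isolates f e}. {v \<in> U e. f v = (0::nat)} = B}"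
        using b by auto
      finally have "real (M ^ card V) \<le> 2 * real M *
          real (card {f \<in> {f \<in> ?functions. ?isolates f e}. {v \<in> U e. f v = (0::nat)} = B})"
        unfolding of_nat_le_iff[where 'a = real, symmetric]
        by (simp only: of_nat_mult of_nat_numeral)
      then show "?q \<le> real (card {f \<in> {f \<in> ?functions. ?isolates f e}. {v \<in> U e. f v = (0::nat)} = B})"
        using assms(3) by (simp add: pos_divide_le_eq mult.commute)
    qed (use finite_functions finite_W in auto)
    finally show ?thesis .
  qed
  obtain f where f: "f \<in> ?functions"
    "m / (2 * real M) * real (card A) \<le> real (card {e \<in> A. ?isolates f e})"
    by (rule double_counting_average[OF finite_functions functions_ne assms(2) isolating])
  have "{v \<in> V. f v = 0} \<inter> U e = {v \<in> U e. f v = 0}" if "e \<in> A" for e using U(1)[OF that] by blast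
  then have "{e \<in> A. ?isolates f e} = {e \<in> A. \<exists>b\<in>W e. {v \<in> V. f v = 0} \<inter> U e = {b}}" by auto
  with f(2) show ?thesis by (intro exI[of _ "{v \<in> V. f v = 0}"]) auto
qed

section \<open>Systems of tuples\<close>

definition nbrs :: "(nat \<Rightarrow> 'a) set \<Rightarrow> nat \<Rightarrow> (nat \<Rightarrow> 'a) \<Rightarrow> 'a set" where
  "nbrs F i x = {y. x(i := y) \<in> F}"

definition line :: "(nat \<Rightarrow> 'a) set \<Rightarrow> nat \<Rightarrow> (nat \<Rightarrow> 'a) \<Rightarrow> (nat \<Rightarrow> 'a) set" where
  "line F i x = {x' \<in> F. x'(i := undefined) = x(i := undefined)}"

definition shadow :: "nat \<Rightarrow> (nat \<Rightarrow> 'a) set \<Rightarrow> (nat \<Rightarrow> 'a) set" where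
  "shadow i F = (\<lambda>x. x(i := undefined)) ` F"

definition pair_shadow :: "nat \<Rightarrow> nat \<Rightarrow> (nat \<Rightarrow> 'a) set \<Rightarrow> ('a \<times> 'a) set" where
  "pair_shadow i j F = (\<lambda>x. (x i, x j)) ` F"

definition pair_fibre :: "(nat \<Rightarrow> 'a) set \<Rightarrow> nat \<Rightarrow> nat \<Rightarrow> 'a \<Rightarrow> 'a \<Rightarrow> (nat \<Rightarrow> 'a) set" where
  "pair_fibre F i j a b = {x \<in> F. x i = a \<and> x j = b}"

definition common_link :: "(nat \<Rightarrow> 'a) set \<Rightarrow> nat \<Rightarrow> 'a list \<Rightarrow> (nat \<Rightarrow> 'a) set" where
  "common_link F i Y = {w \<in> shadow i F. \<forall>y\<in>set Y. w(i := y) \<in> F}"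

definition link_at :: "(nat \<Rightarrow> 'a) set \<Rightarrow> nat \<Rightarrow> 'a list \<Rightarrow> nat \<Rightarrow> 'a \<Rightarrow> (nat \<Rightarrow> 'a) set" where
  "link_at F i Y j v = {w \<in> common_link F i Y. w j = v}"

definition shadow_ratio :: "nat \<Rightarrow> (nat \<Rightarrow> 'a) set \<Rightarrow> real" where
  "shadow_ratio i F = real (card (shadow i F)) / (real (card F))\<^sup>2"

lemma nbrs_upd [simp]: "nbrs F i (x(i := y)) = nbrs F i x"
  by (simp add: nbrs_def)

lemma nbrs_mono: "F \<subseteq> F' \<Longrightarrow> nbrs F i x \<subseteq> nbrs F' i x"
  by (auto simp: nbrs_def)

lemma self_in_nbrs: "x \<in> F \<Longrightarrow> x i \<in> nbrs F i x"
  by (simp add: nbrs_def)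

lemma shadow_mono: "F \<subseteq> F' \<Longrightarrow> shadow i F \<subseteq> shadow i F'"
  by (auto simp: shadow_def)

lemma link_at_mono: "F \<subseteq> F' \<Longrightarrow> set Y' \<subseteq> set Y \<Longrightarrow> link_at F i Y j v \<subseteq> link_at F' i Y' j v"
  by (auto simp: link_at_def common_link_def shadow_def)

lemma tuple_eqI: "x(i := undefined) = y(i := undefined) \<Longrightarrow> x i = y i \<Longrightarrow> x = y"
  by (metis fun_upd_triv fun_upd_upd)

lemma card_line: "card (line F i x) = card (nbrs F i x)"
proof -
  have "line F i x = (\<lambda>y. x(i := y)) ` nbrs F i x"
  proof (intro set_eqI iffI)
    fix x' assume x': "x' \<in> line F i x"
    have "x(i := x' i) = x'" by (rule tuple_eqI[of _ i]) (use x' in \<open>simp_all add: line_def\<close>)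
    with x' have "x(i := x' i) \<in> F" "x(i := x' i) = x'" by (simp_all add: line_def)
    then show "x' \<in> (\<lambda>y. x(i := y)) ` nbrs F i x"
      unfolding nbrs_def by (metis imageI mem_Collect_eq)
  qed (auto simp: line_def nbrs_def)
  moreover have "inj_on (\<lambda>y. x(i := y)) (nbrs F i x)" by (metis fun_upd_eqD inj_onI)
  ultimately show ?thesis by (simp add: card_image)
qed

locale tuple_space =
  fixes V :: "'a set" and r :: nat
  assumes finite_V: "finite V"
begin

abbreviation tuples :: "(nat \<Rightarrow> 'a) set" where
  "tuples \<equiv> PiE {..<r} (\<lambda>_. V)"

abbreviation N :: real where
  "N \<equiv> real (card V)"

lemma finite_system: "F \<subseteq> tuples \<Longrightarrow> finite F"
  using finite_V by (intro finite_subset[of F tuples] finite_PiE) auto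

lemma finite_shadow: "F \<subseteq> tuples \<Longrightarrow> finite (shadow i F)"
  unfolding shadow_def using finite_system by blast

lemma finite_pair_shadow: "F \<subseteq> tuples \<Longrightarrow> finite (pair_shadow i j F)"
  unfolding pair_shadow_def using finite_system by blast

lemma finite_common_link: "F \<subseteq> tuples \<Longrightarrow> finite (common_link F i Y)"
  unfolding common_link_def using finite_shadow by simp

lemma finite_link_at: "F \<subseteq> tuples \<Longrightarrow> finite (link_at F i Y j v)"
  unfolding link_at_def using finite_common_link by simp

lemma tuple_entry_in_V: "F \<subseteq> tuples \<Longrightarrow> x \<in> F \<Longrightarrow> i < r \<Longrightarrow> x i \<in> V"
  by (auto simp: PiE_iff)

lemma nbrs_subset_V: "nbrs F i x \<subseteq> V" if "F \<subseteq> tuples" "i < r"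
  using tuple_entry_in_V[OF that(1) _ that(2)] by (fastforce simp: nbrs_def)

lemma finite_nbrs: "F \<subseteq> tuples \<Longrightarrow> i < r \<Longrightarrow> finite (nbrs F i x)"
  using nbrs_subset_V finite_V finite_subset by metis

lemma card_partial_tuples:
  assumes "J \<subseteq> {..<r}"
  shows "real (card (PiE ({..<r} - J) (\<lambda>_. V))) = N ^ (r - card J)"
proof -
  have "card ({..<r} - J) = r - card J"
    using assms by (simp add: card_Diff_subset finite_subset)
  then show ?thesis by (simp add: card_PiE)
qed

lemma shadow_subset: "F \<subseteq> tuples \<Longrightarrow> shadow i F \<subseteq> PiE ({..<r} - {i}) (\<lambda>_. V)"
  by (auto simp: shadow_def PiE_iff extensional_def subset_iff split: if_splits)

lemma card_shadow_le:
  assumes "F \<subseteq> tuples" "i < r"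
  shows "real (card (shadow i F)) \<le> N ^ (r - 1)"
proof -
  have "card (shadow i F) \<le> card (PiE ({..<r} - {i}) (\<lambda>_. V))"
    using shadow_subset[OF assms(1)] finite_V by (intro card_mono finite_PiE) auto
  then show ?thesis using card_partial_tuples[of "{i}"] assms(2) by simp
qed

lemma card_le_shadow:
  assumes "F \<subseteq> tuples" "\<And>x. x \<in> F \<Longrightarrow> real (card (nbrs F i x)) \<le> m"
  shows "real (card F) \<le> real (card (shadow i F)) * m"
proof (rule card_le_fibres[of _ "\<lambda>x. x(i := undefined)"])
  fix w assume "w \<in> shadow i F"
  then obtain x where "x \<in> F" "w = x(i := undefined)" by (auto simp: shadow_def)
  then show "real (card {x \<in> F. x(i := undefined) = w}) \<le> m"
    using assms(2) card_line[of F i x] by (simp add: line_def)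
qed (use finite_shadow[OF assms(1)] in \<open>auto simp: shadow_def\<close>)

lemma card_ge_shadow:
  assumes "F' \<subseteq> tuples" "F \<subseteq> F'" "\<And>x. x \<in> F \<Longrightarrow> m \<le> real (card (nbrs F' i x))"
  shows "real (card (shadow i F)) * m \<le> real (card F')"
proof (rule card_ge_fibres[of _ _ _ "\<lambda>x. x(i := undefined)"])
  fix w assume "w \<in> shadow i F"
  then obtain x where "x \<in> F" "w = x(i := undefined)" by (auto simp: shadow_def)
  then show "m \<le> real (card {x \<in> F'. x(i := undefined) = w})"
    using assms(3) card_line[of F' i x] by (simp add: line_def)
qed (use finite_shadow finite_system assms in blast)+

lemma card_le_pair_shadow:
  assumes "F \<subseteq> tuples" "\<And>a b. real (card (pair_fibre F i j a b)) \<le> m"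
  shows "real (card F) \<le> real (card (pair_shadow i j F)) * m"
proof (rule card_le_fibres[of _ "\<lambda>x. (x i, x j)"])
  fix p
  show "real (card {x \<in> F. (x i, x j) = p}) \<le> m"
    using assms(2)[of "fst p" "snd p"] by (simp add: pair_fibre_def prod_eq_iff)
qed (use finite_pair_shadow[OF assms(1)] in \<open>auto simp: pair_shadow_def\<close>)

lemma card_ge_pair_shadow:
  assumes "F' \<subseteq> tuples" "F \<subseteq> F'" "\<And>x. x \<in> F \<Longrightarrow> m \<le> real (card (pair_fibre F' i j (x i) (x j)))"
  shows "real (card (pair_shadow i j F)) * m \<le> real (card F')"
proof (rule card_ge_fibres[of _ _ _ "\<lambda>x. (x i, x j)"])
  fix p assume "p \<in> pair_shadow i j F"
  then obtain x where x: "x \<in> F" "p = (x i, x j)" by (auto simp: pair_shadow_def)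
  then show "m \<le> real (card {x \<in> F'. (x i, x j) = p})"
    using assms(3)[OF x(1)] by (simp add: pair_fibre_def)
qed (use finite_pair_shadow finite_system assms in blast)+

lemma card_shadow_le_pair_shadow:
  assumes F: "F \<subseteq> tuples" and coords: "i < r" "j < r" "k < r" "i \<noteq> j" "i \<noteq> k" "j \<noteq> k"
  shows "real (card (shadow k F)) \<le> real (card (pair_shadow i j F)) * N ^ (r - 3)"
proof -
  let ?I = "{..<r} - {i, j, k}"
  let ?f = "\<lambda>w. ((w i, w j), restrict w ?I)"
  let ?B = "pair_shadow i j F \<times> PiE ?I (\<lambda>_. V)"
  have "inj_on ?f (shadow k F)"
  proof (intro inj_onI ext)
    fix w w' l assume w: "w \<in> shadow k F" "w' \<in> shadow k F" and eq: "?f w = ?f w'"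
    then have e: "w \<in> PiE ({..<r} - {k}) (\<lambda>_. V)" "w' \<in> PiE ({..<r} - {k}) (\<lambda>_. V)"
      using shadow_subset[OF F] by auto
    have entries: "restrict w ?I l = restrict w' ?I l" "w i = w' i" "w j = w' j" using eq by auto
    consider "l \<in> {i, j}" | "l \<in> ?I" | "l \<notin> {..<r} - {k}" by blast
    then show "w l = w' l"
      using entries PiE_arb[OF e(1)] PiE_arb[OF e(2)] by cases auto
  qed
  moreover have "?f ` shadow k F \<subseteq> ?B"
  proof (rule image_subsetI)
    fix w assume "w \<in> shadow k F"
    then obtain x where x: "x \<in> F" "w = x(k := undefined)" by (auto simp: shadow_def)
    have "(w i, w j) \<in> pair_shadow i j F" using x coords by (auto simp: pair_shadow_def)
    moreover have "restrict w ?I \<in> PiE ?I (\<lambda>_. V)"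
      using x tuple_entry_in_V[OF F x(1)] by (intro restrict_PiE_iff[THEN iffD2]) auto
    ultimately show "?f w \<in> ?B" by simp
  qed
  moreover have "finite ?B"
    using finite_pair_shadow[OF F] finite_V by (intro finite_cartesian_product finite_PiE) auto
  ultimately have "card (shadow k F) \<le> card ?B" by (rule card_inj_on_le)
  then have "real (card (shadow k F)) \<le> real (card ?B)" by simp
  also have "\<dots> = real (card (pair_shadow i j F)) * N ^ (r - 3)"
    using card_partial_tuples[of "{i, j, k}"] coords
    by (simp add: card_cartesian_product numeral_3_eq_3)
  finally show ?thesis .
qed

lemma card_heavy_lines_ge:
  fixes d :: real
  assumes F: "F \<subseteq> tuples" and i: "i < r" and d: "d \<ge> 0"
  shows "real (card F) - real (card (shadow i F)) * d \<le> real (card {x \<in> F. d \<le> real (card (nbrs F i x))})"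
    (is "_ \<le> real (card ?heavy)")
proof -
  have "real (card (F - ?heavy)) \<le> real (card (shadow i (F - ?heavy))) * d"
  proof (rule card_le_shadow)
    fix x assume "x \<in> F - ?heavy"
    moreover have "card (nbrs (F - ?heavy) i x) \<le> card (nbrs F i x)"
      using finite_nbrs[OF F i] by (intro card_mono nbrs_mono) auto
    ultimately show "real (card (nbrs (F - ?heavy) i x)) \<le> d" by auto
  qed (use F in auto)
  also have "\<dots> \<le> real (card (shadow i F)) * d"
    using finite_shadow[OF F] d by (intro mult_right_mono of_nat_mono card_mono shadow_mono) auto
  finally have "real (card (F - ?heavy)) \<le> real (card (shadow i F)) * d" .
  moreover have "card F - card ?heavy \<le> card (F - ?heavy)"
    using finite_system[OF F] by (intro diff_card_le_card_Diff) simp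
  ultimately show ?thesis by linarith
qed

lemma minimal_shadow_ratio:
  assumes "F \<subseteq> tuples" "F \<noteq> {}" "i < r"
  obtains F' i' where "F' \<subseteq> F" "F' \<noteq> {}" "i' < r"
    "\<And>H k. H \<subseteq> F \<Longrightarrow> H \<noteq> {} \<Longrightarrow> k < r \<Longrightarrow> shadow_ratio i' F' \<le> shadow_ratio k H"
proof -
  let ?X = "(Pow F - {{}}) \<times> {..<r}"
  let ?ratio = "\<lambda>(H, k). shadow_ratio k H"
  have X: "finite ?X" "?X \<noteq> {}" using finite_system assms by auto
  obtain p where p: "p \<in> ?X" "Min (?ratio ` ?X) = ?ratio p" using X by (rule obtains_MIN)
  have "?ratio p \<le> ?ratio (H, k)" if "H \<subseteq> F" "H \<noteq> {}" "k < r" for H k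
    unfolding p(2)[symmetric] using X(1) that by (intro Min_le) auto
  then show ?thesis
    using p(1) by (intro that[of "fst p" "snd p"]) (simp_all add: case_prod_beta mem_Times_iff)
qed

lemma sum_card_shadow_Diff_line:
  assumes "F \<subseteq> tuples" "x \<in> F" "i < r"
  shows "(\<Sum>l<r. card (shadow l (F - line F i x))) < (\<Sum>l<r. card (shadow l F))"
proof (rule sum_strict_mono_ex1)
  show "\<forall>l\<in>{..<r}. card (shadow l (F - line F i x)) \<le> card (shadow l F)"
    using finite_shadow[OF assms(1)] by (intro ballI card_mono shadow_mono) auto
  have "x(i := undefined) \<in> shadow i F" "x(i := undefined) \<notin> shadow i (F - line F i x)"
    using assms(2) by (auto simp: shadow_def line_def)
  then have "shadow i (F - line F i x) \<subset> shadow i F"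
    using shadow_mono[of "F - line F i x" F i] by blast
  then show "\<exists>l\<in>{..<r}. card (shadow l (F - line F i x)) < card (shadow l F)"
    using finite_shadow[OF assms(1)] assms(3) by (intro bexI[of _ i] psubset_card_mono) auto
qed simp

text \<open>A subset maximising \<open>|F| - \<tau> \<Sum>\<^sub>i |shadow i F|\<close> has all codegrees at least \<open>\<tau>\<close>, because
  deleting a line of fewer than \<open>\<tau>\<close> tuples would increase this quantity.\<close>

lemma min_codegree_subset:
  fixes \<tau> :: real
  assumes F: "F \<subseteq> tuples" and \<tau>: "\<tau> \<ge> 0"
  obtains F' where "F' \<subseteq> F" "\<And>x i. x \<in> F' \<Longrightarrow> i < r \<Longrightarrow> \<tau> \<le> real (card (nbrs F' i x))"
    "real (card F) - \<tau> * real r * N ^ (r - 1) \<le> real (card F')"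
proof -
  let ?weight = "\<lambda>F'. real (card F') - \<tau> * real (\<Sum>i<r. card (shadow i F'))"
  have finite_Pow: "finite (Pow F)" using finite_system[OF F] by simp
  moreover have "Pow F \<noteq> {}" by blast
  ultimately obtain F' where F': "F' \<in> Pow F" "Max (?weight ` Pow F) = ?weight F'"
    by (rule obtains_MAX)
  have max: "?weight F'' \<le> ?weight F'" if "F'' \<subseteq> F" for F''
    unfolding F'(2)[symmetric] using that finite_Pow by (intro Max_ge) auto
  have F'_tuples: "F' \<subseteq> tuples" using F' F by blast
  have "\<tau> \<le> real (card (nbrs F' i x))" if x: "x \<in> F'" "i < r" for x i
  proof -
    let ?S = "\<lambda>F. \<Sum>l<r. card (shadow l F)"
    have "real (card F') - real (card (line F' i x)) \<le> real (card (F' - line F' i x))"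
    proof -
      have "finite (line F' i x)" using finite_system[OF F'_tuples] by (simp add: line_def)
      from diff_card_le_card_Diff[OF this, of F'] show ?thesis by linarith
    qed
    moreover have "\<tau> * real (?S (F' - line F' i x)) + \<tau> \<le> \<tau> * real (?S F')"
    proof -
      have "real (?S (F' - line F' i x)) + 1 \<le> real (?S F')"
        using sum_card_shadow_Diff_line[OF F'_tuples x] by linarith
      from mult_left_mono[OF this \<tau>] show ?thesis by (simp only: distrib_left mult_1_right)
    qed
    moreover have "?weight (F' - line F' i x) \<le> ?weight F'" using F' by (intro max) auto
    ultimately show ?thesis unfolding card_line by linarith
  qed
  moreover have "real (card F) - \<tau> * real r * N ^ (r - 1) \<le> real (card F')"
  proof -
    have "real (\<Sum>i<r. card (shadow i F)) \<le> real r * N ^ (r - 1)"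
      using sum_bounded_above[of "{..<r}" "\<lambda>i. real (card (shadow i F))"] card_shadow_le[OF F]
      by simp
    from mult_left_mono[OF this \<tau>]
    have "\<tau> * real (\<Sum>i<r. card (shadow i F)) \<le> \<tau> * real r * N ^ (r - 1)" by (simp only: mult.assoc)
    moreover have "0 \<le> \<tau> * real (\<Sum>i<r. card (shadow i F'))"
      using \<tau> by (intro mult_nonneg_nonneg of_nat_0_le_iff)
    ultimately show ?thesis using max[OF subset_refl] by linarith
  qed
  ultimately show ?thesis using F'(1) that by blast
qed

lemma card_rich_lists_le:
  fixes m c :: real
  assumes F: "F \<subseteq> tuples" and i: "i < r" and codeg: "\<And>x. real (card (nbrs F i x)) \<le> c"
  shows "real (card {Y \<in> distinct_lists k V. m \<le> real (card (common_link F i Y))}) * m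
    \<le> real (card (shadow i F)) * c ^ k" (is "real (card ?rich) * m \<le> _")
proof -
  let ?P = "SIGMA w:shadow i F. distinct_lists k (nbrs F i w)"
  have finite_P: "finite ?P"
    using finite_shadow[OF F] finite_nbrs[OF F i]
    by (intro finite_SigmaI finite_distinct_lists) auto
  have "real (card ?rich) * m \<le> real (card ?P)"
  proof (rule card_ge_fibres[OF finite_P, of _ _ snd])
    show "finite ?rich" using finite_distinct_lists[OF finite_V] by simp
    fix Y assume Y: "Y \<in> ?rich"
    have "card (common_link F i Y) = card ((\<lambda>w. (w, Y)) ` common_link F i Y)"
      by (simp add: card_image inj_on_def)
    also have "\<dots> \<le> card {p \<in> ?P. snd p = Y}"
      using finite_P Y by (intro card_mono) (auto simp: common_link_def nbrs_def distinct_lists_def)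
    finally show "m \<le> real (card {p \<in> ?P. snd p = Y})" using Y by simp
  qed
  also have "\<dots> \<le> real (card (shadow i F)) * c ^ k"
    using finite_shadow[OF F] finite_nbrs[OF F i] codeg
    by (intro card_Sigma_le card_distinct_lists_le) auto
  finally show ?thesis .
qed

subsection \<open>Clusters\<close>

definition close_values :: "(nat \<Rightarrow> 'a) set \<Rightarrow> real \<Rightarrow> nat \<Rightarrow> nat \<Rightarrow> 'a \<Rightarrow> 'a \<Rightarrow> 'a set" where
  "close_values F L i j c a = {b \<in> V. L \<le> real (card (link_at F i [a, b] j c))}"

lemma close_values_sym: "b \<in> close_values F L i j c a \<Longrightarrow> a \<in> V \<Longrightarrow> a \<in> close_values F L i j c b"
  by (simp add: close_values_def link_at_def common_link_def conj_commute)

lemma close_values_mono: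
  assumes "F \<subseteq> F'" "F' \<subseteq> tuples"
  shows "close_values F L i j c a \<subseteq> close_values F' L i j c a"
proof
  fix b assume "b \<in> close_values F L i j c a"
  moreover have "card (link_at F i [a, b] j c) \<le> card (link_at F' i [a, b] j c)"
    using assms finite_link_at by (intro card_mono link_at_mono) auto
  ultimately show "b \<in> close_values F' L i j c a" by (simp add: close_values_def)
qed

lemma card_close_values_le:
  assumes F: "F \<subseteq> tuples" and i: "i < r" "i \<noteq> j" and "m\<^sub>1 \<ge> 0"
    and codeg: "\<And>x. real (card (nbrs F i x)) \<le> m\<^sub>1"
    and pairdeg: "real (card (pair_fibre F i j a c)) \<le> m\<^sub>2"
  shows "real (card (close_values F L i j c a)) * L \<le> m\<^sub>2 * m\<^sub>1"
proof -
  let ?W = "{w \<in> shadow i F. w j = c \<and> w(i := a) \<in> F}"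
  let ?P = "SIGMA w:?W. nbrs F i w"
  have finite_W: "finite ?W" using finite_shadow[OF F] by simp
  have finite_P: "finite ?P" using finite_W finite_nbrs[OF F i(1)] by auto
  have "inj_on (\<lambda>w. w(i := a)) ?W"
  proof (rule inj_onI)
    fix w w' assume w: "w \<in> ?W" "w' \<in> ?W" and eq: "w(i := a) = w'(i := a)"
    have "w i = w' i" using w by (auto simp: shadow_def)
    moreover have "w(i := undefined) = w'(i := undefined)" using eq by (metis fun_upd_upd)
    ultimately show "w = w'" by (rule tuple_eqI[rotated])
  qed
  moreover have "(\<lambda>w. w(i := a)) ` ?W \<subseteq> pair_fibre F i j a c" using i by (auto simp: pair_fibre_def)
  moreover have "finite (pair_fibre F i j a c)"
    using finite_system[OF F] by (simp add: pair_fibre_def)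
  ultimately have "card ?W \<le> card (pair_fibre F i j a c)" by (rule card_inj_on_le)
  then have card_W: "real (card ?W) \<le> m\<^sub>2" using pairdeg by linarith
  have "real (card (close_values F L i j c a)) * L \<le> real (card ?P)"
  proof (rule card_ge_fibres[OF finite_P, of _ _ snd])
    show "finite (close_values F L i j c a)" using finite_V by (simp add: close_values_def)
    fix b assume b: "b \<in> close_values F L i j c a"
    have "card (link_at F i [a, b] j c) = card ((\<lambda>w. (w, b)) ` link_at F i [a, b] j c)"
      by (simp add: card_image inj_on_def)
    also have "\<dots> \<le> card {p \<in> ?P. snd p = b}"
      using finite_P by (intro card_mono) (auto simp: nbrs_def link_at_def common_link_def)
    finally show "L \<le> real (card {p \<in> ?P. snd p = b})" using b by (simp add: close_values_def)
  qed
  also have "\<dots> \<le> real (card ?W) * m\<^sub>1" using finite_W codeg by (rule card_Sigma_le)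
  also have "\<dots> \<le> m\<^sub>2 * m\<^sub>1" using card_W \<open>m\<^sub>1 \<ge> 0\<close> by (rule mult_right_mono)
  finally show ?thesis .
qed

text \<open>\<open>\<phi> c a\<close> names the cluster of the value \<open>a\<close> of coordinate \<open>i\<close> when coordinate \<open>j\<close> has the
  value \<open>c\<close>; as \<open>\<psi>\<close> does not see coordinate \<open>i\<close>, the tuples on a line in direction \<open>i\<close> share one
  cluster.\<close>

definition clustered ::
  "nat \<Rightarrow> nat \<Rightarrow> real \<Rightarrow> (nat \<Rightarrow> 'a) set \<Rightarrow> ('a \<Rightarrow> 'a \<Rightarrow> 'a option) \<Rightarrow> ((nat \<Rightarrow> 'a) \<Rightarrow> 'a) \<Rightarrow> bool" where
  "clustered i j m F \<phi> \<psi> \<longleftrightarrow>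
     (\<forall>x\<in>F. \<phi> (x j) (x i) = Some (\<psi> (x(i := undefined)))) \<and>
     (\<forall>c l. real (card {a \<in> V. \<phi> c a = Some l}) \<le> m)"

lemma clustered_mono: "clustered i j m F \<phi> \<psi> \<Longrightarrow> F' \<subseteq> F \<Longrightarrow> m \<le> m' \<Longrightarrow> clustered i j m' F' \<phi> \<psi>"
  unfolding clustered_def by (meson order_trans subsetD)

lemma clusteredD: "clustered i j m F \<phi> \<psi> \<Longrightarrow> x \<in> F \<Longrightarrow> \<phi> (x j) (x i) = Some (\<psi> (x(i := undefined)))"
  by (simp add: clustered_def)

lemma card_cluster_le: "clustered i j m F \<phi> \<psi> \<Longrightarrow> real (card {a \<in> V. \<phi> c a = Some l}) \<le> m"
  by (simp add: clustered_def)

lemma clustered_by_centres: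
  assumes small: "\<And>a c. real (card (close_values F L i j c a)) \<le> m"
  shows "\<exists>\<phi> \<psi>. clustered i j m {x \<in> F. \<exists>b\<in>nbrs F i x \<inter> close_values F L i j (x j) (x i).
    P \<inter> (nbrs F i x \<union> close_values F L i j (x j) (x i)) = {b}} \<phi> \<psi>"
proof -
  let ?C = "close_values F L i j"
  define \<phi> where "\<phi> c a = (if \<exists>b. P \<inter> ?C c a = {b} then Some (THE b. P \<inter> ?C c a = {b}) else None)"
    for c a
  define \<psi> where "\<psi> w = (THE b. P \<inter> nbrs F i w = {b})" for w
  have "\<phi> (x j) (x i) = Some (\<psi> (x(i := undefined)))"
    if "b \<in> nbrs F i x \<inter> ?C (x j) (x i)" "P \<inter> (nbrs F i x \<union> ?C (x j) (x i)) = {b}" for x b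
  proof -
    have "P \<inter> ?C (x j) (x i) = {b}" "P \<inter> nbrs F i x = {b}" using that by auto
    then show ?thesis by (simp add: \<phi>_def \<psi>_def)
  qed
  moreover have "real (card {a \<in> V. \<phi> c a = Some l}) \<le> m" for c l
  proof -
    have "a \<in> ?C c l" if a: "a \<in> V" "\<phi> c a = Some l" for a
    proof -
      obtain b where b: "P \<inter> ?C c a = {b}" using a unfolding \<phi>_def by (auto split: if_splits)
      then have "b = l" using a unfolding \<phi>_def by auto
      then show ?thesis using b a close_values_sym by blast
    qed
    then have "card {a \<in> V. \<phi> c a = Some l} \<le> card (?C c l)"
      using finite_V by (intro card_mono) (auto simp: close_values_def)
    then show ?thesis using small[of c l] by linarith
  qed
  ultimately show ?thesis unfolding clustered_def by blast
qed

lemma clustered_subset: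
  fixes m \<delta> :: real
  assumes F: "F \<subseteq> G" "G \<subseteq> tuples" and i: "i < r" and m: "m \<ge> 1" and \<delta>: "\<delta> \<ge> 0"
    and small: "\<And>a c. real (card (close_values G L i j c a)) \<le> m"
    and codeg: "\<And>x. real (card (nbrs G i x)) \<le> m"
    and many: "\<And>x. x \<in> F \<Longrightarrow> \<delta> \<le> real (card (nbrs G i x \<inter> close_values G L i j (x j) (x i)))"
  obtains F' \<phi> \<psi> where "F' \<subseteq> F" "clustered i j m F' \<phi> \<psi>" "\<delta> / (10 * m) * real (card F) \<le> real (card F')"
proof -
  define M where "M = nat \<lceil>4 * m\<rceil>"
  let ?C = "\<lambda>x. close_values G L i j (x j) (x i)"
  let ?isolates = "\<lambda>P x. \<exists>b\<in>nbrs G i x \<inter> ?C x. P \<inter> (nbrs G i x \<union> ?C x) = {b}"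
  have M: "4 * m \<le> real M" "real M \<le> 5 * m" unfolding M_def using m by linarith+
  have card_U: "2 * card (nbrs G i x \<union> ?C x) \<le> M" for x
    using card_Un_le[of "nbrs G i x" "?C x"] codeg[of x] small[of "x j" "x i"] M(1) by linarith
  have "\<exists>P\<subseteq>V. \<delta> / (2 * real M) * real (card F) \<le> real (card {x \<in> F. ?isolates P x})"
  proof (rule isolating_set_exists[OF finite_V])
    show "finite F" using F by (intro finite_system) auto
    show "nbrs G i x \<union> ?C x \<subseteq> V" for x
      using nbrs_subset_V[OF F(2) i] by (simp add: close_values_def)
    show "M > 0" using M(1) m by (intro gr0I) simp
  qed (use card_U many in auto)
  then obtain P where P: "\<delta> / (2 * real M) * real (card F) \<le> real (card {x \<in> F. ?isolates P x})"
    by blast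
  obtain \<phi> \<psi> where "clustered i j m {x \<in> G. ?isolates P x} \<phi> \<psi>"
    using clustered_by_centres[OF small] by blast
  then have "clustered i j m {x \<in> F. ?isolates P x} \<phi> \<psi>"
    using F(1) by (elim clustered_mono) auto
  moreover have "\<delta> / (10 * m) * real (card F) \<le> \<delta> / (2 * real M) * real (card F)"
    using M m \<delta> by (intro mult_right_mono divide_left_mono) auto
  ultimately show ?thesis using P by (intro that[of "{x \<in> F. ?isolates P x}"]) auto
qed

definition label_class :: "nat \<Rightarrow> ((nat \<Rightarrow> 'a) \<Rightarrow> 'a) \<Rightarrow> (nat \<Rightarrow> 'a) \<Rightarrow> 'a set" where
  "label_class i \<psi> w = {a \<in> V. \<psi> (w(i := a)) = \<psi> w}"

lemma finite_label_class: "finite (label_class i \<psi> w)"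
  using finite_V by (simp add: label_class_def)

lemma inj_on_label_class_pairs:
  assumes "i \<noteq> j"
  shows "inj_on (\<lambda>(x, a). (x(i := a, j := undefined), x j, x i)) A"
proof (rule inj_onI, clarify)
  fix x a x' a'
  assume eq: "x(i := a, j := undefined) = x'(i := a', j := undefined)" "x j = x' j" "x i = x' i"
  have "x l = x' l" for l
    using fun_cong[OF eq(1), of l] eq(2,3) by (cases "l = i"; cases "l = j") auto
  moreover have "a = a'" using fun_cong[OF eq(1), of i] assms by simp
  ultimately show "x = x' \<and> a = a'" by blast
qed

lemma card_label_class_pairs_le:
  assumes F: "F \<subseteq> tuples" and coords: "i < r" "j < r" "i \<noteq> j" "i \<noteq> k" "j \<noteq> k"
    and clusters: "clustered j k m F \<phi> \<psi>" and codeg: "\<And>x. real (card (nbrs F i x)) \<le> c" and "c \<ge> 0"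
  shows "real (card (SIGMA x:F. label_class i \<psi> (x(j := undefined)))) \<le> N ^ (r - 1) * (m * c)"
    (is "real (card ?A) \<le> _")
proof -
  let ?T = "PiE ({..<r} - {j}) (\<lambda>_. V)"
  let ?C = "\<lambda>w. SIGMA b:{b \<in> V. \<phi> (w k) b = Some (\<psi> w)}. nbrs F i (w(j := b))"
  let ?f = "\<lambda>(x, a). (x(i := a, j := undefined), x j, x i)"
  have finite_T: "finite ?T" using finite_V by (intro finite_PiE) auto
  have "?f ` ?A \<subseteq> (SIGMA w:?T. ?C w)"
  proof (rule image_subsetI)
    fix p assume "p \<in> ?A"
    then obtain x a where p: "p = (x, a)" and x: "x \<in> F"
      and a: "a \<in> label_class i \<psi> (x(j := undefined))"
      by (cases p) auto
    let ?w = "x(i := a, j := undefined)"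
    have "x \<in> tuples" "a \<in> V" using F x a by (auto simp: label_class_def)
    then have "?w \<in> ?T" using coords by (auto simp: PiE_iff extensional_def)
    moreover have "\<phi> (?w k) (x j) = Some (\<psi> ?w)"
      using clusteredD[OF clusters x] a coords by (simp add: label_class_def fun_upd_twist)
    moreover have "x j \<in> V" by (rule tuple_entry_in_V[OF F x coords(2)])
    moreover have "?w(j := x j, i := x i) = x" using coords by auto
    then have "x i \<in> nbrs F i (?w(j := x j))" using x by (simp add: nbrs_def)
    ultimately show "?f p \<in> (SIGMA w:?T. ?C w)" by (simp add: p)
  qed
  moreover have "finite (SIGMA w:?T. ?C w)"
    using finite_T finite_V finite_nbrs[OF F coords(1)] by (intro finite_SigmaI) auto
  ultimately have "real (card ?A) \<le> real (card (SIGMA w:?T. ?C w))"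
    using coords(3) by (intro of_nat_mono card_inj_on_le[OF inj_on_label_class_pairs])
  also have "real (card (SIGMA w:?T. ?C w)) \<le> real (card ?T) * (m * c)"
  proof (rule card_Sigma_le[OF finite_T])
    fix w
    have "real (card (?C w)) \<le> real (card {b \<in> V. \<phi> (w k) b = Some (\<psi> w)}) * c"
      using finite_V codeg by (intro card_Sigma_le) auto
    also have "\<dots> \<le> m * c" using card_cluster_le[OF clusters] \<open>c \<ge> 0\<close> by (rule mult_right_mono)
    finally show "real (card (?C w)) \<le> m * c" .
  qed
  also have "real (card ?T) = N ^ (r - 1)" using card_partial_tuples[of "{j}"] coords by simp
  finally show ?thesis .
qed

end

section \<open>Covered systems\<close>

text \<open>The absence of the forbidden configuration means that the common link of \<open>s\<close> vertices placed
  in coordinate \<open>i\<close> is covered by boundedly many vertices.\<close>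

locale covered_system = tuple_space V r for V :: "'a set" and r :: nat +
  fixes s T :: nat and S :: "nat \<Rightarrow> 'a list \<Rightarrow> 'a set" and G :: "(nat \<Rightarrow> 'a) set"
  assumes r_ge_3: "r \<ge> 3" and s_ge_3: "s \<ge> 3" and T_ge_1: "T \<ge> 1" and G_tuples: "G \<subseteq> tuples"
    and finite_S: "i < r \<Longrightarrow> Y \<in> distinct_lists s V \<Longrightarrow> finite (S i Y)"
    and card_S: "i < r \<Longrightarrow> Y \<in> distinct_lists s V \<Longrightarrow> card (S i Y) \<le> T"
    and S_cover: "i < r \<Longrightarrow> Y \<in> distinct_lists s V \<Longrightarrow> w \<in> common_link G i Y \<Longrightarrow> \<exists>j<r. j \<noteq> i \<and> w j \<in> S i Y"
begin

lemma covered_subsystem: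
  assumes "F \<subseteq> G"
  shows "covered_system V r s T S F"
proof unfold_locales
  show "\<exists>j<r. j \<noteq> i \<and> w j \<in> S i Y"
    if "i < r" "Y \<in> distinct_lists s V" "w \<in> common_link F i Y" for i Y w
  proof -
    have "w \<in> common_link G i Y"
      using that(3) assms shadow_mono[OF assms] by (auto simp: common_link_def)
    with that(1,2) show ?thesis by (rule S_cover)
  qed
qed (use r_ge_3 s_ge_3 T_ge_1 G_tuples finite_S card_S assms in auto)

lemma subset_tuples: "F \<subseteq> G \<Longrightarrow> F \<subseteq> tuples"
  using G_tuples by blast

lemma real_r_ge: "3 \<le> real r" and real_s_ge: "3 \<le> real s" and real_T_ge: "1 \<le> real T"
  using r_ge_3 s_ge_3 T_ge_1 by linarith+

lemma third_coordinate:
  obtains k where "k < r" "k \<noteq> i" "k \<noteq> j"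
proof -
  have "card {i, j} < card {..<r}" using r_ge_3 by (simp add: card_insert_if)
  then have "\<not> {..<r} \<subseteq> {i, j}" using card_mono[of "{i, j}" "{..<r}"] by auto
  then show ?thesis using that by auto
qed

definition ext_lists :: "(nat \<Rightarrow> 'a) set \<Rightarrow> nat \<Rightarrow> (nat \<Rightarrow> 'a) \<Rightarrow> 'a list set" where
  "ext_lists F i x = distinct_lists (s - 1) (nbrs F i x - {x i})"

lemma finite_ext_lists: "F \<subseteq> tuples \<Longrightarrow> i < r \<Longrightarrow> finite (ext_lists F i x)"
  unfolding ext_lists_def using finite_nbrs by (intro finite_distinct_lists) auto

lemma Cons_ext_lists_nbrs:
  assumes "x \<in> F" "Y \<in> ext_lists F i x"
  shows "x i # Y \<in> distinct_lists s (nbrs F i x)"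
  using assms s_ge_3 self_in_nbrs[OF assms(1)] by (auto simp: ext_lists_def distinct_lists_def)

lemma Cons_ext_lists:
  assumes "F \<subseteq> tuples" "i < r" "x \<in> F" "Y \<in> ext_lists F i x"
  shows "x i # Y \<in> distinct_lists s V"
  using Cons_ext_lists_nbrs[OF assms(3,4)] distinct_lists_mono[OF nbrs_subset_V[OF assms(1,2)]]
  by blast

lemma in_common_link:
  assumes "x \<in> F" "Y \<in> ext_lists F i x"
  shows "x(i := undefined) \<in> common_link F i (x i # Y)"
  using assms Cons_ext_lists_nbrs[OF assms]
  by (auto simp: common_link_def shadow_def distinct_lists_def nbrs_def)

lemma in_link_at:
  assumes "x \<in> F" "Y \<in> ext_lists F i x" "j \<noteq> i"
  shows "x(i := undefined) \<in> link_at F i (x i # Y) j (x j)"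
  using in_common_link[OF assms(1,2)] assms(3) by (simp add: link_at_def)

lemma ext_lists_covered:
  assumes F: "F \<subseteq> G" and i: "i < r" and x: "x \<in> F" "Y \<in> ext_lists F i x"
  shows "\<exists>j<r. j \<noteq> i \<and> x j \<in> S i (x i # Y)"
proof -
  interpret F: covered_system V r s T S F by (rule covered_subsystem[OF F])
  show ?thesis
    using F.S_cover[OF i Cons_ext_lists[OF F.G_tuples i x] in_common_link[OF x]] by auto
qed

lemma card_ext_lists_ge:
  fixes d :: real
  assumes "F \<subseteq> tuples" "i < r" "x \<in> F" "4 * real s \<le> d" "d \<le> real (card (nbrs F i x))"
  shows "(d / 4) ^ (s - 1) \<le> real (card (ext_lists F i x))"
proof -
  have fin: "finite (nbrs F i x)" using finite_nbrs assms by blast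
  have "d / 2 \<le> real (card (nbrs F i x - {x i}))"
    using assms s_ge_3 fin self_in_nbrs[OF assms(3), of i] by (simp add: card_Diff_singleton)
  then have "(d / 2 / 2) ^ (s - 1) \<le> real (card (ext_lists F i x))"
    unfolding ext_lists_def
  proof (rule card_distinct_lists_ge[rotated])
    show "real (s - 1) \<le> d / 2 / 2" using assms(4) s_ge_3 by linarith
  qed (use fin s_ge_3 in auto)
  then show ?thesis by simp
qed

lemma card_covered_pair_shadow_le:
  fixes p :: real
  assumes F: "F \<subseteq> H" "H \<subseteq> tuples" and i: "i < r" and A: "A \<subseteq> distinct_lists s V"
    and many: "\<And>x. x \<in> F \<Longrightarrow> p \<le> real (card {Y \<in> ext_lists H i x. x i # Y \<in> A \<and> x j \<in> S i (x i # Y)})"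
  shows "real (card (pair_shadow i j F)) * p \<le> real T * real (card A)"
proof -
  let ?B = "SIGMA Y:A. S i Y"
  have finite_A: "finite A" using A finite_distinct_lists[OF finite_V] finite_subset by blast
  have finite_B: "finite ?B" using finite_A finite_S[OF i] A by (intro finite_SigmaI) auto
  have "real (card (pair_shadow i j F)) * p \<le> real (card ?B)"
  proof (rule card_ge_fibres[of _ _ _ "\<lambda>q. (hd (fst q), snd q)"])
    fix q assume "q \<in> pair_shadow i j F"
    then obtain x where x: "x \<in> F" "q = (x i, x j)" by (auto simp: pair_shadow_def)
    let ?L = "{Y \<in> ext_lists H i x. x i # Y \<in> A \<and> x j \<in> S i (x i # Y)}"
    have "card ?L = card ((\<lambda>Y. (x i # Y, x j)) ` ?L)" by (simp add: card_image inj_on_def)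
    also have "\<dots> \<le> card {b \<in> ?B. (hd (fst b), snd b) = q}"
      using finite_B x(2) by (intro card_mono) auto
    finally show "p \<le> real (card {b \<in> ?B. (hd (fst b), snd b) = q})" using many[OF x(1)] by linarith
  qed (use finite_B finite_pair_shadow F in auto)
  also have "\<dots> \<le> real (card A) * real T"
    using finite_A A card_S[OF i] by (intro card_Sigma_le) auto
  finally show ?thesis by (simp add: mult.commute)
qed

lemma small_pair_shadow_exists:
  fixes p :: real
  assumes F: "F \<subseteq> H" "H \<subseteq> G" and i: "i < r" and A: "A \<subseteq> distinct_lists s V" and p: "p > 0"
    and many: "\<And>x. x \<in> F \<Longrightarrow> p \<le> real (card {Y \<in> ext_lists H i x. x i # Y \<in> A})"
    and "F \<noteq> {}"
  obtains j F' where "j < r" "j \<noteq> i" "F' \<subseteq> F" "real (card F) \<le> real r * real (card F')"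
    "real (card (pair_shadow i j F')) * p \<le> real r * real T * real (card A)"
proof -
  let ?L = "\<lambda>x. {Y \<in> ext_lists H i x. x i # Y \<in> A}"
  let ?C = "\<lambda>x j. {Y \<in> ?L x. j \<noteq> i \<and> x j \<in> S i (x i # Y)}"
  have H_tuples: "H \<subseteq> tuples" and F_tuples: "F \<subseteq> tuples" using F subset_tuples by blast+
  have range_ne: "{..<r} \<noteq> {}" using r_ge_3 by (auto simp: lessThan_empty_iff)
  have "\<exists>j\<in>{..<r}. p / real r \<le> real (card (?C x j))" if x: "x \<in> F" for x
  proof -
    have "\<exists>j\<in>{..<r}. j \<noteq> i \<and> x j \<in> S i (x i # Y)" if "Y \<in> ?L x" for Y
      using ext_lists_covered[OF F(2) i, of x Y] F(1) x that by auto
    then obtain j where j: "j \<in> {..<r}" "real (card (?L x)) \<le> real (card {..<r}) * real (card (?C x j))"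
      by (rule pigeonhole_cover[OF finite_lessThan range_ne])
    then have "p \<le> real r * real (card (?C x j))" using many[OF x] by simp
    with j(1) show ?thesis
      using real_r_ge by (intro bexI[of _ j]) (simp_all add: pos_divide_le_eq mult.commute)
  qed
  then obtain j where j: "j \<in> {..<r}"
    "real (card F) \<le> real (card {..<r}) * real (card {x \<in> F. p / real r \<le> real (card (?C x j))})"
    by (rule pigeonhole_cover[OF finite_lessThan range_ne])
  define F' where "F' = {x \<in> F. p / real r \<le> real (card (?C x j))}"
  have F'_subset: "F' \<subseteq> F" by (simp add: F'_def)
  have card_F': "real (card F) \<le> real r * real (card F')" using j(2) by (simp add: F'_def)
  have "j \<noteq> i"
  proof
    assume "j = i"
    then have "F' = {}" using p real_r_ge by (auto simp: F'_def divide_le_0_iff)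
    then show False using card_F' finite_system[OF F_tuples] \<open>F \<noteq> {}\<close> by simp
  qed
  moreover have "real (card (pair_shadow i j F')) * (p / real r) \<le> real T * real (card A)"
  proof (rule card_covered_pair_shadow_le[OF _ H_tuples i A])
    fix x assume "x \<in> F'"
    moreover have "?C x j = {Y \<in> ext_lists H i x. x i # Y \<in> A \<and> x j \<in> S i (x i # Y)}"
      using \<open>j \<noteq> i\<close> by auto
    ultimately show "p / real r \<le> real (card {Y \<in> ext_lists H i x. x i # Y \<in> A \<and> x j \<in> S i (x i # Y)})"
      by (simp add: F'_def)
  qed (use F'_subset F in blast)
  then have "real (card (pair_shadow i j F')) * p \<le> real r * real T * real (card A)"
    using real_r_ge by (simp add: field_simps)
  ultimately show ?thesis using j(1) F'_subset card_F' by (intro that[of j F']) auto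
qed

subsection \<open>Concentration of links\<close>

definition heavily_covered :: "real \<Rightarrow> (nat \<Rightarrow> 'a) set \<Rightarrow> nat \<Rightarrow> nat \<Rightarrow> (nat \<Rightarrow> 'a) \<Rightarrow> 'a list \<Rightarrow> bool" where
  "heavily_covered L F i j x Y \<longleftrightarrow>
     j \<noteq> i \<and> x j \<in> S i (x i # Y) \<and> L \<le> real (card (link_at F i (x i # Y) j (x j)))"

definition light_pairs :: "real \<Rightarrow> (nat \<Rightarrow> 'a) set \<Rightarrow> nat \<Rightarrow> ((nat \<Rightarrow> 'a) \<times> 'a list) set" where
  "light_pairs L F i = {(x, Y) \<in> SIGMA x:F. ext_lists F i x. \<forall>j<r. \<not> heavily_covered L F i j x Y}"

lemma finite_light_pairs: "F \<subseteq> tuples \<Longrightarrow> i < r \<Longrightarrow> finite (light_pairs L F i)"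
  by (rule finite_subset[of _ "SIGMA x:F. ext_lists F i x"])
    (auto simp: light_pairs_def intro: finite_system finite_ext_lists)

lemma inj_on_ext_pairs: "inj_on (\<lambda>(x, Y). (x i # Y, x(i := undefined))) A"
  by (auto simp: inj_on_def intro: tuple_eqI)

lemma card_light_cover_le:
  assumes i: "i < r" and Y: "Y \<in> distinct_lists s V" and L: "L \<ge> 0"
  shows "real (card (\<Union>(j, v)\<in>{(j, v) \<in> {..<r} \<times> S i Y. real (card (link_at F i Y j v)) < L}. link_at F i Y j v))
    \<le> real r * real T * L" (is "real (card (\<Union>(j, v)\<in>?light. _)) \<le> _")
proof -
  have finite_cover: "finite ({..<r} \<times> S i Y)" using finite_S[OF i Y] by simp
  then have "finite ?light" by (rule rev_finite_subset) auto
  then have "real (card (\<Union>(j, v)\<in>?light. link_at F i Y j v)) \<le> real (card ?light) * L"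
    by (rule card_UN_le_mult) auto
  also have "\<dots> \<le> real (r * T) * L"
  proof (intro mult_right_mono of_nat_mono L)
    have "card ?light \<le> card ({..<r} \<times> S i Y)" using finite_cover by (intro card_mono) auto
    also have "\<dots> \<le> r * T" using card_S[OF i Y] by (simp add: card_cartesian_product)
    finally show "card ?light \<le> r * T" .
  qed
  finally show ?thesis by simp
qed

lemma card_light_pairs_le:
  assumes F: "F \<subseteq> G" and i: "i < r" and L: "L \<ge> 0"
  shows "real (card (light_pairs L F i)) \<le> N ^ s * (real r * real T * L)"
proof -
  let ?light = "\<lambda>Y. {(j, v) \<in> {..<r} \<times> S i Y. real (card (link_at F i Y j v)) < L}"
  let ?B = "SIGMA Y:distinct_lists s V. \<Union>(j, v)\<in>?light Y. link_at F i Y j v"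
  let ?f = "\<lambda>(x, Y). (x i # Y, x(i := undefined))"
  have F_tuples: "F \<subseteq> tuples" by (rule subset_tuples[OF F])
  have "?f ` light_pairs L F i \<subseteq> ?B"
  proof (rule image_subsetI)
    fix q assume "q \<in> light_pairs L F i"
    then obtain x Y where q: "q = (x, Y)" and x: "x \<in> F" "Y \<in> ext_lists F i x"
      and light: "\<And>j. j < r \<Longrightarrow> \<not> heavily_covered L F i j x Y"
      by (auto simp: light_pairs_def)
    obtain j where j: "j < r" "j \<noteq> i" "x j \<in> S i (x i # Y)"
      using ext_lists_covered[OF F i x] by blast
    then have "(j, x j) \<in> ?light (x i # Y)" using light[of j] by (auto simp: heavily_covered_def)
    then show "?f q \<in> ?B"
      using in_link_at[OF x j(2)] Cons_ext_lists[OF F_tuples i x] by (auto simp: q)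
  qed
  moreover have "finite ?B"
  proof (intro finite_SigmaI finite_distinct_lists finite_V)
    fix Y assume "Y \<in> distinct_lists s V"
    then have "finite (?light Y)"
      by (intro finite_subset[OF _ finite_SigmaI[OF finite_lessThan finite_S[OF i]]]) auto
    then show "finite (\<Union>(j, v)\<in>?light Y. link_at F i Y j v)"
      using finite_link_at[OF F_tuples] by auto
  qed
  ultimately have "real (card (light_pairs L F i)) \<le> real (card ?B)"
    by (intro of_nat_mono card_inj_on_le[OF inj_on_ext_pairs])
  also have "\<dots> \<le> real (card (distinct_lists s V)) * (real r * real T * L)"
    by (rule card_Sigma_le[OF finite_distinct_lists[OF finite_V] card_light_cover_le[OF i _ L]])
  also have "\<dots> \<le> N ^ s * (real r * real T * L)"
    using card_distinct_lists_le[OF finite_V order_refl] L by (intro mult_right_mono) auto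
  finally show ?thesis .
qed

lemma card_heavily_covered_lists_le:
  assumes F: "F \<subseteq> tuples" and i: "i < r"
  shows "real (card {Y \<in> ext_lists F i x. heavily_covered L F i j x Y})
    \<le> real (card (nbrs F i x \<inter> close_values F L i j (x j) (x i))) ^ (s - 1)"
proof -
  let ?B = "nbrs F i x \<inter> close_values F L i j (x j) (x i)"
  have finite_B: "finite ?B" using finite_nbrs[OF F i] by simp
  have "{Y \<in> ext_lists F i x. heavily_covered L F i j x Y} \<subseteq> distinct_lists (s - 1) ?B"
  proof
    fix Y assume "Y \<in> {Y \<in> ext_lists F i x. heavily_covered L F i j x Y}"
    then have Y: "Y \<in> distinct_lists (s - 1) (nbrs F i x)"
      and heavy: "L \<le> real (card (link_at F i (x i # Y) j (x j)))"
      by (auto simp: heavily_covered_def ext_lists_def distinct_lists_def)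
    have "b \<in> close_values F L i j (x j) (x i)" if b: "b \<in> set Y" for b
    proof -
      have "card (link_at F i (x i # Y) j (x j)) \<le> card (link_at F i [x i, b] j (x j))"
        using finite_link_at[OF F] b by (intro card_mono link_at_mono) auto
      moreover have "b \<in> V" using Y b nbrs_subset_V[OF F i] by (auto simp: distinct_lists_def)
      ultimately show ?thesis using heavy by (simp add: close_values_def)
    qed
    then show "Y \<in> distinct_lists (s - 1) ?B" using Y by (auto simp: distinct_lists_def)
  qed
  then have "card {Y \<in> ext_lists F i x. heavily_covered L F i j x Y} \<le> card (distinct_lists (s - 1) ?B)"
    by (rule card_mono[OF finite_distinct_lists[OF finite_B]])
  then show ?thesis using card_distinct_lists_le[OF finite_B order_refl, of "s - 1"] by linarith
qed

lemma many_close_values: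
  fixes \<tau> :: real
  assumes F: "F \<subseteq> tuples" and i: "i < r" and x: "x \<in> F"
    and ext: "(\<tau> / 4) ^ (s - 1) \<le> real (card (ext_lists F i x))"
    and light: "2 * card {Y \<in> ext_lists F i x. (x, Y) \<in> light_pairs L F i} \<le> card (ext_lists F i x)"
    and \<tau>: "\<tau> > 0"
  shows "\<exists>j<r. j \<noteq> i \<and> \<tau> / (8 * real r) \<le> real (card (nbrs F i x \<inter> close_values F L i j (x j) (x i)))"
proof -
  let ?L = "{Y \<in> ext_lists F i x. (x, Y) \<in> light_pairs L F i}"
  let ?A = "ext_lists F i x - ?L"
  have fin: "finite (ext_lists F i x)" by (rule finite_ext_lists[OF F i])
  have "{..<r} \<noteq> {}" using r_ge_3 by (auto simp: lessThan_empty_iff)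
  moreover have "\<exists>j\<in>{..<r}. heavily_covered L F i j x Y" if "Y \<in> ?A" for Y
    using that x by (auto simp: light_pairs_def)
  ultimately obtain j where j: "j \<in> {..<r}"
    "real (card ?A) \<le> real (card {..<r}) * real (card {Y \<in> ?A. heavily_covered L F i j x Y})"
    by (rule pigeonhole_cover[OF finite_lessThan])
  let ?Z = "{Y \<in> ?A. heavily_covered L F i j x Y}"
  let ?B = "nbrs F i x \<inter> close_values F L i j (x j) (x i)"
  have "(\<tau> / 4) ^ (s - 1) \<le> 2 * real (card ?A)"
    using ext light diff_card_le_card_Diff[of ?L "ext_lists F i x"] fin by simp
  also have "\<dots> \<le> 2 * real r * real (card ?Z)" using j(2) by simp
  finally have low: "(\<tau> / 4) ^ (s - 1) \<le> 2 * real r * real (card ?Z)" .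
  have "(\<tau> / 4) ^ (s - 1) > 0" using \<tau> by simp
  with low have "?Z \<noteq> {}" by (metis card.empty mult_zero_right not_less of_nat_0)
  then have "j \<noteq> i" by (auto simp: heavily_covered_def)
  moreover have "\<tau> / 4 \<le> 2 * real r * real (card ?B)"
  proof (rule power_le_imp_le_base)
    have "Suc (s - 2) = s - 1" using s_ge_3 by simp
    have "real (card ?Z)
        \<le> real (card {Y \<in> ext_lists F i x. heavily_covered L F i j x Y})"
      using fin by (intro of_nat_mono card_mono) auto
    also have "\<dots> \<le> real (card ?B) ^ (s - 1)" by (rule card_heavily_covered_lists_le[OF F i])
    finally have "2 * real r * real (card ?Z)
        \<le> 2 * real r * real (card ?B) ^ (s - 1)"
      by (rule mult_left_mono) simp
    with low have "(\<tau> / 4) ^ (s - 1) \<le> 2 * real r * real (card ?B) ^ (s - 1)" by (rule order_trans)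
    also have "\<dots> \<le> (2 * real r) ^ (s - 1) * real (card ?B) ^ (s - 1)"
      using real_r_ge s_ge_3 by (intro mult_right_mono self_le_power) auto
    finally show "(\<tau> / 4) ^ Suc (s - 2) \<le> (2 * real r * real (card ?B)) ^ Suc (s - 2)"
      using \<open>Suc (s - 2) = s - 1\<close> by (simp only: power_mult_distrib)
  qed simp
  ultimately show ?thesis
    using j(1) real_r_ge by (intro exI[of _ j]) (simp add: field_simps)
qed

lemma concentrated_links:
  fixes \<tau> :: real
  assumes F: "F \<subseteq> G" and i: "i < r" and L: "L \<ge> 0" and \<tau>: "4 * real s \<le> \<tau>"
    and codeg: "\<And>x. x \<in> F \<Longrightarrow> \<tau> \<le> real (card (nbrs F i x))"
  obtains B where "B \<subseteq> F" "real (card B) * (\<tau> / 4) ^ (s - 1) \<le> 2 * (N ^ s * (real r * real T * L))"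
    "\<And>x. x \<in> F - B \<Longrightarrow>
      \<exists>j<r. j \<noteq> i \<and> \<tau> / (8 * real r) \<le> real (card (nbrs F i x \<inter> close_values F L i j (x j) (x i)))"
proof -
  have F_tuples: "F \<subseteq> tuples" by (rule subset_tuples[OF F])
  have ext: "(\<tau> / 4) ^ (s - 1) \<le> real (card (ext_lists F i x))" if "x \<in> F" for x
    using card_ext_lists_ge[OF F_tuples i that \<tau> codeg[OF that]] .
  let ?B = "{x \<in> F. card (ext_lists F i x) < 2 * card {Y \<in> ext_lists F i x. (x, Y) \<in> light_pairs L F i}}"
  have "real (card ?B) * (\<tau> / 4) ^ (s - 1) \<le> 2 * real (card (light_pairs L F i))"
    using ext finite_system[OF F_tuples] finite_light_pairs[OF F_tuples i] finite_ext_lists[OF F_tuples i]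
    by (intro card_majority_le) auto
  also have "\<dots> \<le> 2 * (N ^ s * (real r * real T * L))" using card_light_pairs_le[OF F i L] by simp
  finally show ?thesis
    using many_close_values[OF F_tuples i _ ext] \<tau> real_s_ge by (intro that[of ?B]) auto
qed

end

section \<open>Regularity of dense systems\<close>

lemma card_shadow_le_of_ratio_le:
  assumes "shadow_ratio i F \<le> shadow_ratio k H" "real (card F) \<le> c * real (card H)" "card F > 0" "c \<ge> 0"
  shows "real (card (shadow i F)) \<le> c\<^sup>2 * real (card (shadow k H))"
proof -
  have "card H > 0" using assms(2,3) by (intro gr0I) simp
  have "real (card (shadow i F)) \<le> real (card (shadow k H)) / (real (card H))\<^sup>2 * (real (card F))\<^sup>2"
    using assms(1,3) by (simp add: shadow_ratio_def pos_divide_le_eq)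
  also have "\<dots> \<le> real (card (shadow k H)) / (real (card H))\<^sup>2 * (c * real (card H))\<^sup>2"
    using assms(2) by (intro mult_left_mono power_mono) auto
  also have "\<dots> = c\<^sup>2 * real (card (shadow k H))"
    using \<open>card H > 0\<close> by (simp add: power_mult_distrib)
  finally show ?thesis .
qed

lemma card_shadow_small_of_ratio_le:
  assumes "shadow_ratio i F \<le> shadow_ratio k H" "card F \<le> card H" "card F > 0"
    and "real (card (shadow k H)) \<le> m" "c * m \<le> real (card H)" "c \<ge> 0"
  shows "c * real (card (shadow i F)) \<le> real (card F)"
proof -
  define f h where "f = real (card F)" and "h = real (card H)"
  have pos: "0 < f" "f \<le> h" using assms(2,3) by (simp_all add: f_def h_def)
  have "real (card (shadow i F)) / f\<^sup>2 \<le> m / h\<^sup>2"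
    using assms(1,4) divide_right_mono[of "real (card (shadow k H))" m "h\<^sup>2"]
    by (simp add: shadow_ratio_def f_def h_def)
  then have "real (card (shadow i F)) * h\<^sup>2 \<le> m * f\<^sup>2" using pos by (simp add: field_simps)
  then have "c * (real (card (shadow i F)) * h\<^sup>2) \<le> c * (m * f\<^sup>2)"
    using assms(6) by (rule mult_left_mono)
  also have "\<dots> = (c * m) * (f * f)" by (simp add: power2_eq_square)
  also have "\<dots> \<le> h * (f * h)"
    using assms(5) pos unfolding h_def[symmetric] by (intro mult_mono) auto
  finally show ?thesis using pos by (simp add: power2_eq_square f_def)
qed

context covered_system
begin

lemma popular_coordinate:
  assumes F: "F \<subseteq> G" "F \<noteq> {}" and i: "i < r"
    and small: "8 * real s * real (card (shadow i F)) \<le> real (card F)"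
  obtains j F' where "j < r" "j \<noteq> i" "F' \<subseteq> F" "real (card F) \<le> 2 * real r * real (card F')"
    "real (card (pair_shadow i j F')) * (real (card F) / (8 * real (card (shadow i F)))) ^ (s - 1)
      \<le> real r * real T * N ^ s"
proof -
  define d where "d = real (card F) / (2 * real (card (shadow i F)))"
  define heavy where "heavy = {x \<in> F. d \<le> real (card (nbrs F i x))}"
  have F_tuples: "F \<subseteq> tuples" by (rule subset_tuples[OF F(1)])
  have card_F: "card F > 0" and card_shadow: "card (shadow i F) > 0"
    using F(2) finite_system[OF F_tuples] finite_shadow[OF F_tuples]
    by (simp_all add: card_gt_0_iff shadow_def)
  have d: "4 * real s \<le> d" using small card_shadow by (simp add: d_def pos_le_divide_eq)
  then have p_gt_0: "(d / 4) ^ (s - 1) > 0" using real_s_ge by simp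
  have heavy_subset: "heavy \<subseteq> F" by (simp add: heavy_def)
  have card_heavy: "real (card F) \<le> 2 * real (card heavy)"
    using card_heavy_lines_ge[OF F_tuples i, of d] card_shadow by (simp add: heavy_def d_def)
  have many: "(d / 4) ^ (s - 1) \<le> real (card {Y \<in> ext_lists F i x. x i # Y \<in> distinct_lists s V})"
    if x: "x \<in> heavy" for x
  proof -
    have "{Y \<in> ext_lists F i x. x i # Y \<in> distinct_lists s V} = ext_lists F i x"
      using Cons_ext_lists[OF F_tuples i] x heavy_subset by blast
    moreover have "(d / 4) ^ (s - 1) \<le> real (card (ext_lists F i x))"
      using x by (intro card_ext_lists_ge[OF F_tuples i _ d]) (auto simp: heavy_def)
    ultimately show ?thesis by simp
  qed
  have "heavy \<noteq> {}" using card_heavy card_F by auto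
  then obtain j F' where j: "j < r" "j \<noteq> i"
    and F': "F' \<subseteq> heavy" "real (card heavy) \<le> real r * real (card F')"
    and pairs: "real (card (pair_shadow i j F')) * (d / 4) ^ (s - 1)
      \<le> real r * real T * real (card (distinct_lists s V))"
    using small_pair_shadow_exists[OF heavy_subset F(1) i subset_refl p_gt_0 many] by blast
  note pairs
  also have "real r * real T * real (card (distinct_lists s V)) \<le> real r * real T * N ^ s"
    using card_distinct_lists_le[OF finite_V order_refl, of s] by (intro mult_left_mono) auto
  finally show ?thesis
    using j F' heavy_subset card_heavy by (intro that[of j F']) (auto simp: d_def)
qed

lemma minimal_ratio_bound:
  assumes F: "F \<subseteq> G" "F \<noteq> {}" and i: "i < r"
    and minimal: "\<And>H k. H \<subseteq> F \<Longrightarrow> H \<noteq> {} \<Longrightarrow> k < r \<Longrightarrow> shadow_ratio i F \<le> shadow_ratio k H"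
    and small: "8 * real s * real (card (shadow i F)) \<le> real (card F)"
  shows "real (card (shadow i F)) * (real (card F) / real (card (shadow i F))) ^ (s - 1)
    \<le> 4 * real r ^ 3 * real T * 8 ^ (s - 1) * (N ^ s * N ^ (r - 3))"
proof -
  define \<sigma> where "\<sigma> = real (card (shadow i F))"
  define p where "p = (real (card F) / (8 * \<sigma>)) ^ (s - 1)"
  have F_tuples: "F \<subseteq> tuples" by (rule subset_tuples[OF F(1)])
  have card_F: "card F > 0" using F(2) finite_system[OF F_tuples] by (simp add: card_gt_0_iff)
  have p_nonneg: "p \<ge> 0" by (simp add: p_def \<sigma>_def)
  obtain j F' where j: "j < r" "j \<noteq> i"
    and F': "F' \<subseteq> F" "real (card F) \<le> 2 * real r * real (card F')"
    and pairs: "real (card (pair_shadow i j F')) * p \<le> real r * real T * N ^ s"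
    unfolding p_def \<sigma>_def by (rule popular_coordinate[OF F i small])
  obtain k where k: "k < r" "k \<noteq> i" "k \<noteq> j" by (rule third_coordinate)
  have "\<sigma> \<le> (2 * real r)\<^sup>2 * real (card (shadow k F'))"
    unfolding \<sigma>_def
  proof (rule card_shadow_le_of_ratio_le)
    have "F' \<noteq> {}" using F'(2) card_F by auto
    then show "shadow_ratio i F \<le> shadow_ratio k F'" using F'(1) k(1) by (intro minimal)
  qed (use F'(2) card_F in auto)
  also have "\<dots> \<le> (2 * real r)\<^sup>2 * (real (card (pair_shadow i j F')) * N ^ (r - 3))"
    using F'(1) F_tuples i j k by (intro mult_left_mono card_shadow_le_pair_shadow) auto
  finally have "\<sigma> * p \<le> (2 * real r)\<^sup>2 * (real (card (pair_shadow i j F')) * N ^ (r - 3)) * p"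
    using p_nonneg by (rule mult_right_mono)
  also have "\<dots> = (2 * real r)\<^sup>2 * N ^ (r - 3) * (real (card (pair_shadow i j F')) * p)"
    by (simp only: mult_ac)
  also have "\<dots> \<le> (2 * real r)\<^sup>2 * N ^ (r - 3) * (real r * real T * N ^ s)"
    using pairs by (intro mult_left_mono) auto
  also have "\<dots> = 4 * real r ^ 3 * real T * (N ^ s * N ^ (r - 3))"
    by (simp add: power2_eq_square power3_eq_cube mult_ac)
  finally have "\<sigma> * p * 8 ^ (s - 1) \<le> 4 * real r ^ 3 * real T * (N ^ s * N ^ (r - 3)) * 8 ^ (s - 1)"
    by (rule mult_right_mono) simp
  moreover have "(real (card F) / \<sigma>) ^ (s - 1) = p * 8 ^ (s - 1)"
    by (simp add: p_def flip: power_mult_distrib)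
  ultimately show ?thesis unfolding \<sigma>_def[symmetric] by (simp add: mult_ac)
qed

end

text \<open>With \<open>Q = N\<^bsup>\<epsilon>\<^esup>\<close> the first assumption says \<open>D = N\<^bsup>1 - 1/(s-1) - \<epsilon>\<^esup>\<close>. The exponent \<open>500 s\<^sup>2\<close>
  exceeds the total loss, in powers of \<open>Q\<close>, of the whole argument.\<close>

locale scaled_system = covered_system V r s T S G
  for V :: "'a set" and r s T :: nat and S :: "nat \<Rightarrow> 'a list \<Rightarrow> 'a set" and G :: "(nat \<Rightarrow> 'a) set" +
  fixes D Q :: real
  assumes DQ: "(D * Q) ^ (s - 1) = N ^ (s - 2)"
    and Q_large: "(100 * real r * real T) ^ (r + s) \<le> Q"
    and D_large: "Q ^ (500 * s\<^sup>2) < D"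
begin

abbreviation E :: real where "E \<equiv> N ^ (r - 1) * D"

definition base :: real where "base = 100 * real r * real T"

lemma base_ge: "100 \<le> base" "100 * real r \<le> base"
proof -
  have "real r * 1 \<le> real r * real T" using real_T_ge by (intro mult_left_mono) auto
  then show "100 * real r \<le> base" by (simp add: base_def)
  then show "100 \<le> base" using real_r_ge by linarith
qed

lemma prod_le_Q:
  assumes "a \<le> base ^ m" "b \<le> base ^ n" "0 \<le> b" "m + n \<le> r + s"
  shows "a * b \<le> Q"
proof -
  have "a * b \<le> base ^ (m + n)"
    unfolding power_add using assms base_ge by (intro mult_mono) auto
  also have "\<dots> \<le> base ^ (r + s)" using assms(4) base_ge by (intro power_increasing) auto
  finally show ?thesis using Q_large by (simp add: base_def)
qed

lemma Q_ge:
  shows "1000 * real r ^ 2 \<le> Q" and "20 * real r * real T \<le> Q" and "8 * real s \<le> Q"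
    and "32 * real r ^ r \<le> Q"
    and "4 * real r ^ 3 * real T * 8 ^ (s - 1) \<le> Q"
    and "64 * real r ^ 2 * real T * (64 * real r) ^ (s - 1) \<le> Q"
proof -
  have r_bounds: "1 \<le> real r" "real r \<le> base" using base_ge(2) real_r_ge by linarith+
  have rT_le_base: "a * real r * real T \<le> base" if "0 \<le> a" "a \<le> 100" for a
    using that unfolding base_def by (intro mult_right_mono) auto
  have const_le_base: "a \<le> base ^ 1" if "a \<le> 100" for a :: real
    using base_ge(1) that unfolding power_one_right by linarith
  have "10000 * real r ^ 2 \<le> Q"
    using prod_le_Q[of "100 * real r" 1 "100 * real r" 1] base_ge(2) r_bounds r_ge_3
    by (simp add: power2_eq_square)
  then show "1000 * real r ^ 2 \<le> Q" using zero_le_power2[of "real r"] by linarith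
  show "20 * real r * real T \<le> Q"
    using prod_le_Q[of "20 * real r * real T" 1 1 0] rT_le_base[of 20] r_ge_3 by simp
  have "real s \<le> 2 ^ s" by (rule less_imp_le[OF of_nat_less_two_power])
  also have "\<dots> \<le> base ^ s" using base_ge(1) by (intro power_mono) linarith+
  finally show "8 * real s \<le> Q" using r_ge_3 by (intro prod_le_Q[OF const_le_base]) auto
  have "real r ^ r \<le> base ^ r" using r_bounds by (intro power_mono) auto
  then show "32 * real r ^ r \<le> Q" using s_ge_3 by (intro prod_le_Q[OF const_le_base]) auto
  have "real r ^ 2 * 8 ^ (s - 1) \<le> base ^ 2 * base ^ (s - 1)"
    using base_ge r_bounds by (intro mult_mono power_mono) auto
  then show "4 * real r ^ 3 * real T * 8 ^ (s - 1) \<le> Q"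
    using prod_le_Q[of "4 * real r * real T" 1 "real r ^ 2 * 8 ^ (s - 1)" "2 + (s - 1)"] rT_le_base[of 4] r_ge_3
    by (simp add: power_add power2_eq_square power3_eq_cube mult_ac)
  have "real r * (64 * real r) ^ (s - 1) \<le> base * base ^ (s - 1)"
    using base_ge r_bounds by (intro mult_mono power_mono) auto
  then show "64 * real r ^ 2 * real T * (64 * real r) ^ (s - 1) \<le> Q"
    using prod_le_Q[of "64 * real r * real T" 1 "real r * (64 * real r) ^ (s - 1)" "Suc (s - 1)"] rT_le_base[of 64] r_ge_3
    by (simp add: power2_eq_square mult_ac)
qed

lemma Q_ge_9000: "9000 \<le> Q"
  using Q_ge(1) power_mono[OF real_r_ge, of 2] by simp

lemma Q_gt_0: "Q > 0" and Q_ge_1: "Q \<ge> 1"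
  using Q_ge_9000 by simp_all

lemma Q_power_le_D: "m \<le> 500 * s\<^sup>2 \<Longrightarrow> Q ^ m \<le> D"
  using power_increasing[OF _ Q_ge_1, of m "500 * s\<^sup>2"] D_large by linarith

lemma Q_square_le_D: "Q\<^sup>2 \<le> D"
proof (rule Q_power_le_D)
  have "1 \<le> s\<^sup>2" using s_ge_3 by simp
  then show "2 \<le> 500 * s\<^sup>2" by linarith
qed

lemma D_ge_1: "D \<ge> 1"
  using Q_power_le_D[of 0] by simp

lemma N_gt_0: "N > 0"
proof (rule ccontr)
  assume "\<not> N > 0"
  then have "(D * Q) ^ (s - 1) = 0" using DQ s_ge_3 by simp
  then show False using D_ge_1 Q_gt_0 by simp
qed

lemma E_gt_0: "E > 0"
  using N_gt_0 D_ge_1 by simp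

lemma N_powers: "N ^ s = N\<^sup>2 * (D * Q) ^ (s - 1)" "N\<^sup>2 * N ^ (r - 3) = N ^ (r - 1)"
proof -
  have "s = 2 + (s - 2)" "r - 1 = 2 + (r - 3)" using r_ge_3 s_ge_3 by auto
  then show "N ^ s = N\<^sup>2 * (D * Q) ^ (s - 1)" "N\<^sup>2 * N ^ (r - 3) = N ^ (r - 1)"
    unfolding DQ by (metis power_add)+
qed

lemma square_le_of_ratio_bound:
  fixes e \<sigma> C :: real
  assumes "0 < e" "e \<le> E" "0 < \<sigma>" "1 \<le> C" "\<sigma> * (e / \<sigma>) ^ (s - 1) \<le> C * (N ^ s * N ^ (r - 3))"
  shows "e\<^sup>2 \<le> C * Q * (E * D * Q * \<sigma>)"
proof -
  define q where "q = s - 2"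
  have q: "s = Suc (Suc q)" "Suc (q - 1) = q" "q \<ge> 1" using s_ge_3 by (auto simp: q_def)
  have pos: "0 < D" "0 < Q" "0 < E" using D_ge_1 Q_gt_0 E_gt_0 by auto
  have "e ^ (q + 1) = \<sigma> * (e / \<sigma>) ^ (s - 1) * \<sigma> ^ q" using assms(3) by (simp add: q(1) power_divide)
  also have "\<dots> \<le> C * (N ^ s * N ^ (r - 3)) * \<sigma> ^ q" using assms(3,5) by (intro mult_right_mono) auto
  also have "N ^ s * N ^ (r - 3) = E * Q * (D * Q) ^ q"
    using N_powers by (simp add: q(1) mult_ac)
  finally have bound: "e ^ (q + 1) \<le> C * (E * Q * (D * Q) ^ q) * \<sigma> ^ q" .
  have CQ: "1 \<le> C * Q" using assms(4) Q_ge_1 by (simp add: mult_ge1_I)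
  show ?thesis
  proof (rule power_le_imp_le_base)
    have "2 * Suc (q - 1) = (q + 1) + (q - 1)" using q(3) by simp
    then have "(e\<^sup>2) ^ Suc (q - 1) = e ^ (q + 1) * e ^ (q - 1)" by (metis power_add power_mult)
    also have "\<dots> \<le> (C * (E * Q * (D * Q) ^ q) * \<sigma> ^ q) * E ^ (q - 1)"
      using bound assms pos by (intro mult_mono power_mono) auto
    also have "\<dots> = (C * Q) * (E * D * Q * \<sigma>) ^ q"
      using q(3) by (cases q) (auto simp: power_mult_distrib mult_ac)
    also have "\<dots> \<le> (C * Q) ^ q * (E * D * Q * \<sigma>) ^ q"
      using CQ assms(3) pos q(3) by (intro mult_right_mono self_le_power) auto
    also have "\<dots> = (C * Q * (E * D * Q * \<sigma>)) ^ Suc (q - 1)"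
      unfolding q(2) by (simp only: power_mult_distrib)
    finally show "(e\<^sup>2) ^ Suc (q - 1) \<le> (C * Q * (E * D * Q * \<sigma>)) ^ Suc (q - 1)" .
  qed (use assms pos in simp)
qed

end

locale dense_system = scaled_system V r s T S G D Q
  for V :: "'a set" and r s T :: nat and S :: "nat \<Rightarrow> 'a list \<Rightarrow> 'a set" and G :: "(nat \<Rightarrow> 'a) set"
    and D Q :: real +
  assumes card_G_le: "real (card G) \<le> E" and card_G_ge: "E / 2 \<le> real (card G)"
begin

lemma card_subsystem_le: "F \<subseteq> G \<Longrightarrow> real (card F) \<le> E"
  using card_G_le card_mono[OF finite_system[OF G_tuples]] by (meson of_nat_mono order_trans)

text \<open>Take a subset and a coordinate minimising \<open>|shadow i F| / |F|\<^sup>2\<close>. If this shadow is small,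
  the codegrees in coordinate \<open>i\<close> are large, so the cover count makes some pair shadow small;
  projecting along a third coordinate then gives a smaller ratio unless the asserted inequality
  holds.\<close>

lemma shadow_large:
  assumes F: "F \<subseteq> G" and big: "8 * real s * N ^ (r - 1) \<le> real (card F)" and i: "i < r"
  shows "(real (card F))\<^sup>2 \<le> real (card (shadow i F)) * (E * D * Q ^ 3)"
proof -
  have F_tuples: "F \<subseteq> tuples" by (rule subset_tuples[OF F])
  have "0 < 8 * real s * N ^ (r - 1)" using real_s_ge N_gt_0 by simp
  then have card_F: "0 < real (card F)" using big by linarith
  then have "F \<noteq> {}" by auto
  then obtain F' i' where F': "F' \<subseteq> F" "F' \<noteq> {}" "i' < r"
    and minimal: "\<And>H k. H \<subseteq> F \<Longrightarrow> H \<noteq> {} \<Longrightarrow> k < r \<Longrightarrow> shadow_ratio i' F' \<le> shadow_ratio k H"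
    using minimal_shadow_ratio[OF F_tuples _ i] by blast
  define e \<sigma> where "e = real (card F')" and "\<sigma> = real (card (shadow i' F'))"
  have F'_tuples: "F' \<subseteq> tuples" using F'(1) F_tuples by blast
  have pos: "0 < e" "0 < \<sigma>"
    using F'(2) finite_system[OF F'_tuples] finite_shadow[OF F'_tuples]
    by (simp_all add: e_def \<sigma>_def card_gt_0_iff shadow_def)
  have ratio: "shadow_ratio i' F' \<le> shadow_ratio i F" using minimal \<open>F \<noteq> {}\<close> i by blast
  have "8 * real s * \<sigma> \<le> e"
    unfolding e_def \<sigma>_def
    using ratio _ _ card_shadow_le[OF F_tuples i] big
  proof (rule card_shadow_small_of_ratio_le)
    show "card F' \<le> card F" using F'(1) finite_system[OF F_tuples] by (rule card_mono[rotated])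
  qed (use pos in \<open>auto simp: e_def\<close>)
  then have "\<sigma> * (e / \<sigma>) ^ (s - 1) \<le> 4 * real r ^ 3 * real T * 8 ^ (s - 1) * (N ^ s * N ^ (r - 3))"
    unfolding e_def \<sigma>_def using F F' minimal by (intro minimal_ratio_bound) auto
  then have "e\<^sup>2 \<le> 4 * real r ^ 3 * real T * 8 ^ (s - 1) * Q * (E * D * Q * \<sigma>)"
  proof (rule square_le_of_ratio_bound[OF pos(1) _ pos(2), rotated 2])
    show "e \<le> E" unfolding e_def using F F'(1) by (intro card_subsystem_le) auto
    show "1 \<le> 4 * real r ^ 3 * real T * 8 ^ (s - 1)"
      using real_r_ge real_T_ge by (auto intro!: mult_ge1_I)
  qed
  also have "\<dots> \<le> Q * Q * (E * D * Q * \<sigma>)"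
    using Q_ge(5) Q_gt_0 E_gt_0 D_ge_1 pos by (intro mult_right_mono) auto
  also have "\<dots> = \<sigma> * (E * D * Q ^ 3)" by (simp add: power3_eq_cube mult_ac)
  finally have "1 \<le> shadow_ratio i' F' * (E * D * Q ^ 3)"
    using pos by (simp add: shadow_ratio_def e_def \<sigma>_def pos_le_divide_eq)
  also have "\<dots> \<le> shadow_ratio i F * (E * D * Q ^ 3)"
    using ratio E_gt_0 D_ge_1 Q_gt_0 by (intro mult_right_mono) auto
  finally show ?thesis using card_F by (simp add: shadow_ratio_def pos_le_divide_eq)
qed

lemma card_le_of_small_shadow:
  assumes F: "F \<subseteq> G" and i: "i < r" and small: "real (card (shadow i F)) * Q ^ 5 \<le> N ^ (r - 1)"
  shows "real (card F) \<le> E / Q"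
proof (cases "8 * real s * N ^ (r - 1) \<le> real (card F)")
  case True
  have "(real (card F))\<^sup>2 * Q\<^sup>2 \<le> real (card (shadow i F)) * (E * D * Q ^ 3) * Q\<^sup>2"
    using shadow_large[OF F True i] by (rule mult_right_mono) simp
  also have "\<dots> = (real (card (shadow i F)) * Q ^ 5) * (E * D)"
    by (simp add: eval_nat_numeral mult_ac)
  also have "\<dots> \<le> N ^ (r - 1) * (E * D)"
    using small E_gt_0 D_ge_1 by (intro mult_right_mono) auto
  also have "\<dots> = E\<^sup>2" by (simp add: power2_eq_square)
  finally have "(real (card F) * Q)\<^sup>2 \<le> E\<^sup>2" by (simp add: power_mult_distrib)
  then have "real (card F) * Q \<le> E" using E_gt_0 by (elim power2_le_imp_le) simp
  then show ?thesis using Q_gt_0 by (simp add: pos_le_divide_eq)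
next
  case False
  then have "real (card F) * Q \<le> 8 * real s * N ^ (r - 1) * Q"
    using Q_gt_0 by (intro mult_right_mono) auto
  also have "\<dots> \<le> Q * N ^ (r - 1) * Q" using Q_ge(3) Q_gt_0 by (intro mult_right_mono) auto
  also have "\<dots> \<le> E"
    using mult_left_mono[OF Q_square_le_D, of "N ^ (r - 1)"] by (simp add: power2_eq_square mult_ac)
  finally show ?thesis using Q_gt_0 by (simp add: pos_le_divide_eq)
qed

lemma card_heavy_codegree_le:
  assumes i: "i < r"
  shows "real (card {x \<in> G. D * Q ^ 5 < real (card (nbrs G i x))}) \<le> E / Q" (is "real (card ?H) \<le> _")
proof (rule card_le_of_small_shadow[OF _ i])
  have "real (card (shadow i ?H)) * (D * Q ^ 5) \<le> real (card G)"
    by (rule card_ge_shadow[OF G_tuples]) auto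
  also note card_G_le
  finally have "real (card (shadow i ?H)) * Q ^ 5 * D \<le> N ^ (r - 1) * D" by (simp add: mult_ac)
  then show "real (card (shadow i ?H)) * Q ^ 5 \<le> N ^ (r - 1)" using D_ge_1 by simp
qed auto

lemma card_heavy_pair_degree_le:
  assumes coords: "i < r" "j < r" "i \<noteq> j"
  shows "real (card {x \<in> G. N ^ (r - 3) * D * Q ^ 5 < real (card (pair_fibre G i j (x i) (x j)))}) \<le> E / Q"
    (is "real (card ?P) \<le> _")
proof -
  obtain k where k: "k < r" "k \<noteq> i" "k \<noteq> j" by (rule third_coordinate)
  show ?thesis
  proof (rule card_le_of_small_shadow[OF _ k(1)])
    have "real (card (shadow k ?P)) \<le> real (card (pair_shadow i j ?P)) * N ^ (r - 3)"
      using G_tuples coords k by (intro card_shadow_le_pair_shadow) auto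
    then have "real (card (shadow k ?P)) * (D * Q ^ 5)
        \<le> real (card (pair_shadow i j ?P)) * N ^ (r - 3) * (D * Q ^ 5)"
      using D_ge_1 Q_gt_0 by (intro mult_right_mono) auto
    also have "\<dots> = real (card (pair_shadow i j ?P)) * (N ^ (r - 3) * D * Q ^ 5)"
      by (simp only: mult_ac)
    also have "\<dots> \<le> real (card G)" by (rule card_ge_pair_shadow[OF G_tuples]) auto
    also note card_G_le
    finally have "real (card (shadow k ?P)) * Q ^ 5 * D \<le> N ^ (r - 1) * D" by (simp add: mult_ac)
    then show "real (card (shadow k ?P)) * Q ^ 5 \<le> N ^ (r - 1)" using D_ge_1 by simp
  qed auto
qed

definition irregular :: "(nat \<Rightarrow> 'a) set" where
  "irregular =
     (\<Union>i<r. {x \<in> G. D * Q ^ 5 < real (card (nbrs G i x))}) \<union>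
     (\<Union>(i, j)\<in>{(i, j) \<in> {..<r} \<times> {..<r}. i \<noteq> j}.
       {x \<in> G. N ^ (r - 3) * D * Q ^ 5 < real (card (pair_fibre G i j (x i) (x j)))})"

lemma card_irregular_le: "real (card irregular) \<le> E / 16"
proof -
  let ?J = "{(i, j) \<in> {..<r} \<times> {..<r}. i \<noteq> j}"
  let ?H = "\<Union>i<r. {x \<in> G. D * Q ^ 5 < real (card (nbrs G i x))}"
  let ?P = "\<Union>(i, j)\<in>?J. {x \<in> G. N ^ (r - 3) * D * Q ^ 5 < real (card (pair_fibre G i j (x i) (x j)))}"
  have finite_J: "finite ?J" by (rule finite_subset[of _ "{..<r} \<times> {..<r}"]) auto
  have "card ?J \<le> card ({..<r} \<times> {..<r})" by (intro card_mono) auto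
  then have card_J: "real (card ?J) \<le> (real r)\<^sup>2"
    by (simp add: card_cartesian_product power2_eq_square flip: of_nat_mult)
  have "real (card ?H) \<le> real (card {..<r}) * (E / Q)"
    using card_heavy_codegree_le by (intro card_UN_le_mult) auto
  also have "\<dots> \<le> (real r)\<^sup>2 * (E / Q)"
    using real_r_ge E_gt_0 Q_gt_0 by (intro mult_right_mono) (auto simp: self_le_power)
  finally have "real (card ?H) \<le> (real r)\<^sup>2 * (E / Q)" .
  moreover have "real (card ?P) \<le> real (card ?J) * (E / Q)"
    using card_heavy_pair_degree_le by (intro card_UN_le_mult[OF finite_J]) auto
  then have "real (card ?P) \<le> (real r)\<^sup>2 * (E / Q)"
    using mult_right_mono[OF card_J, of "E / Q"] E_gt_0 Q_gt_0 by simp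
  ultimately have "real (card (?H \<union> ?P)) \<le> 2 * (real r)\<^sup>2 * (E / Q)"
    using card_Un_le[of ?H ?P] by simp
  also have "\<dots> \<le> (Q / 16) * (E / Q)" using Q_ge(1) E_gt_0 Q_gt_0 by (intro mult_right_mono) auto
  also have "\<dots> = E / 16" using Q_gt_0 by simp
  finally show ?thesis by (simp only: irregular_def)
qed

lemma card_regular_ge: "E / 8 \<le> real (card (G - irregular))"
proof -
  have "irregular \<subseteq> G" by (auto simp: irregular_def)
  then have "card G - card irregular \<le> card (G - irregular)"
    using finite_system[OF G_tuples] by (intro diff_card_le_card_Diff) (rule finite_subset)
  then show ?thesis using card_G_ge card_irregular_le E_gt_0 by linarith
qed

lemma codegree_regular_le:
  assumes i: "i < r"
  shows "real (card (nbrs (G - irregular) i x)) \<le> D * Q ^ 5"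
proof (cases "nbrs (G - irregular) i x = {}")
  case False
  then obtain y where "x(i := y) \<in> G - irregular" by (auto simp: nbrs_def)
  then have "\<not> D * Q ^ 5 < real (card (nbrs G i (x(i := y))))" using i
    unfolding irregular_def by blast
  then have "real (card (nbrs G i x)) \<le> D * Q ^ 5" by simp
  moreover have "card (nbrs (G - irregular) i x) \<le> card (nbrs G i x)"
    using finite_nbrs[OF G_tuples i] by (intro card_mono nbrs_mono) auto
  ultimately show ?thesis by linarith
qed (use D_ge_1 Q_gt_0 in simp)

lemma pair_degree_regular_le:
  assumes coords: "i < r" "j < r" "i \<noteq> j"
  shows "real (card (pair_fibre (G - irregular) i j a b)) \<le> N ^ (r - 3) * D * Q ^ 5"
proof (cases "pair_fibre (G - irregular) i j a b = {}")
  case False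
  then obtain x where "x \<in> G - irregular" "x i = a" "x j = b" by (auto simp: pair_fibre_def)
  then have "\<not> N ^ (r - 3) * D * Q ^ 5 < real (card (pair_fibre G i j a b))"
    using coords unfolding irregular_def by blast
  moreover have "card (pair_fibre (G - irregular) i j a b) \<le> card (pair_fibre G i j a b)"
    using finite_system[OF G_tuples] by (intro card_mono) (auto simp: pair_fibre_def)
  ultimately show ?thesis by linarith
qed (use D_ge_1 Q_gt_0 in simp)

end

section \<open>Consecutive clusters\<close>

locale cluster_chain = covered_system V r s T S H
  for V :: "'a set" and r s T :: nat and S :: "nat \<Rightarrow> 'a list \<Rightarrow> 'a set" and H :: "(nat \<Rightarrow> 'a) set" +
  fixes D \<kappa> :: real and i j k :: nat
    and \<phi>\<^sub>1 \<phi>\<^sub>2 :: "'a \<Rightarrow> 'a \<Rightarrow> 'a option" and \<psi>\<^sub>1 \<psi>\<^sub>2 :: "(nat \<Rightarrow> 'a) \<Rightarrow> 'a"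
  assumes V_nonempty: "V \<noteq> {}"
    and coords: "i < r" "j < r" "i \<noteq> j" "i \<noteq> k" "j \<noteq> k"
    and \<kappa>_ge: "8 * real s \<le> \<kappa>" "20 * real r * real T \<le> \<kappa>"
    and \<kappa>_le_D: "\<kappa> ^ 3 \<le> D"
    and card_H: "N ^ (r - 1) * D / (4 * \<kappa>) \<le> real (card H)"
    and codeg_ge: "x \<in> H \<Longrightarrow> D / \<kappa>\<^sup>2 \<le> real (card (nbrs H i x))"
    and codeg_le: "real (card (nbrs H i x)) \<le> D * \<kappa>"
    and pair_degree_le: "m < r \<Longrightarrow> m \<noteq> i \<Longrightarrow> real (card (pair_fibre H i m a b)) \<le> N ^ (r - 3) * (D * \<kappa>)"
    and clusters_i: "clustered i j (D * \<kappa>) H \<phi>\<^sub>1 \<psi>\<^sub>1"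
    and clusters_j: "clustered j k (D * \<kappa>) H \<phi>\<^sub>2 \<psi>\<^sub>2"
    and card_label_class_le: "x \<in> H \<Longrightarrow> real (card (label_class i \<psi>\<^sub>2 (x(j := undefined)))) \<le> D * \<kappa> ^ 4"
begin

definition \<Lambda> :: real where "\<Lambda> = \<kappa> ^ s"

text \<open>The exponent \<open>10 = 4 + 3 + 3\<close> pays for the size of the label classes and for the loss in
  \<open>card_ext_lists_ge_\<Lambda>\<close>, and leaves a factor \<open>\<Lambda>\<^sup>3\<close> to spare in \<open>card_mostly_poor_le\<close>.\<close>

definition L :: real where "L = N ^ (r - 3) * D / \<Lambda> ^ 10"

definition \<theta> :: real where "\<theta> = D / \<Lambda> ^ 10"

abbreviation E :: real where "E \<equiv> N ^ (r - 1) * D"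

lemma r_le_\<kappa>: "20 * real r \<le> \<kappa>" and \<kappa>_ge_60: "60 \<le> \<kappa>"
proof -
  have "real r * 1 \<le> real r * real T" using real_T_ge by (intro mult_left_mono) auto
  then show "20 * real r \<le> \<kappa>" using \<kappa>_ge(2) by simp
  then show "60 \<le> \<kappa>" using real_r_ge by linarith
qed

lemma \<kappa>_gt_0: "\<kappa> > 0"
  using \<kappa>_ge_60 by simp

lemma \<kappa>_le_\<Lambda>: "\<kappa> \<le> \<Lambda>"
  unfolding \<Lambda>_def using \<kappa>_ge_60 s_ge_3 by (intro self_le_power) auto

lemma \<Lambda>_ge_60: "60 \<le> \<Lambda>"
  using \<kappa>_ge_60 \<kappa>_le_\<Lambda> by linarith

lemma \<Lambda>_gt_0: "\<Lambda> > 0"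
  using \<Lambda>_ge_60 by simp

lemma D_gt_0: "D > 0"
  using \<kappa>_le_D zero_less_power[OF \<kappa>_gt_0, of 3] by linarith

lemma N_gt_0: "N > 0"
  using V_nonempty finite_V by (simp add: card_gt_0_iff)

lemma N_power_split: "N\<^sup>2 * N ^ (r - 3) = N ^ (r - 1)"
proof -
  have "2 + (r - 3) = r - 1" using r_ge_3 by simp
  then show ?thesis by (metis power_add)
qed

lemma L_gt_0: "L > 0" and \<theta>_gt_0: "\<theta> > 0"
  using N_gt_0 D_gt_0 \<Lambda>_gt_0 by (simp_all add: L_def \<theta>_def)

lemma L_\<Lambda>: "L * \<Lambda> ^ 10 = N ^ (r - 3) * D" and \<theta>_\<Lambda>: "\<theta> * \<Lambda> ^ 10 = D"
  using \<Lambda>_gt_0 by (simp_all add: L_def \<theta>_def)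

lemma \<kappa>_power_le_\<Lambda>_power: "(\<kappa> ^ m) ^ (s - 1) \<le> \<Lambda> ^ m"
proof -
  have "(\<kappa> ^ m) ^ (s - 1) = (\<kappa> ^ (s - 1)) ^ m" by (simp only: power_mult[symmetric] mult.commute)
  also have "\<dots> \<le> \<Lambda> ^ m"
    unfolding \<Lambda>_def using \<kappa>_ge_60 by (intro power_mono power_increasing) auto
  finally show ?thesis .
qed

lemma lists_times_\<Lambda>_le:
  assumes "m \<le> 4"
  shows "(D * \<kappa> ^ m) ^ (s - 1) * \<Lambda> ^ 6 \<le> D ^ (s - 1) * \<Lambda> ^ 10"
proof -
  have "(D * \<kappa> ^ m) ^ (s - 1) * \<Lambda> ^ 6 \<le> D ^ (s - 1) * \<Lambda> ^ m * \<Lambda> ^ 6"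
    unfolding power_mult_distrib
    using \<kappa>_power_le_\<Lambda>_power D_gt_0 \<Lambda>_gt_0 by (intro mult_right_mono mult_left_mono) auto
  also have "\<dots> = D ^ (s - 1) * \<Lambda> ^ (m + 6)" by (simp add: power_add)
  also have "\<dots> \<le> D ^ (s - 1) * \<Lambda> ^ 10"
    using assms D_gt_0 \<Lambda>_ge_60 by (intro mult_left_mono power_increasing) auto
  finally show ?thesis .
qed

abbreviation pairs :: "((nat \<Rightarrow> 'a) \<times> 'a list) set" where
  "pairs \<equiv> SIGMA x:H. ext_lists H i x"

lemma finite_pairs: "finite pairs"
  using finite_system[OF G_tuples] finite_ext_lists[OF G_tuples coords(1)] by auto

lemma upd_in_H: "(x, Y) \<in> pairs \<Longrightarrow> y \<in> set (x i # Y) \<Longrightarrow> x(i := y) \<in> H"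
  using Cons_ext_lists_nbrs[of x H Y i] by (auto simp: distinct_lists_def nbrs_def)

definition rich_lists :: "'a list set" where
  "rich_lists = {Y \<in> distinct_lists s V. \<theta> * L \<le> real (card (common_link H i Y))}"

definition poor_pairs :: "((nat \<Rightarrow> 'a) \<times> 'a list) set" where
  "poor_pairs = {(x, Y) \<in> pairs. x i # Y \<notin> rich_lists}"

definition heavy_values :: "'a list \<Rightarrow> 'a set" where
  "heavy_values Y = {b \<in> V. L \<le> real (card (link_at H i Y j b))}"

definition thin_pairs :: "((nat \<Rightarrow> 'a) \<times> 'a list) set" where
  "thin_pairs = {(x, Y) \<in> pairs. real (card (link_at H i (x i # Y) j (x j))) < L}"

definition narrow_pairs :: "((nat \<Rightarrow> 'a) \<times> 'a list) set" where
  "narrow_pairs = {(x, Y) \<in> pairs.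
     x j \<in> heavy_values (x i # Y) \<and> real (card (heavy_values (x i # Y))) < \<theta>}"

lemma rich_if_not_thin_or_narrow:
  assumes xY: "(x, Y) \<in> pairs" "(x, Y) \<notin> thin_pairs \<union> narrow_pairs"
  shows "x i # Y \<in> rich_lists"
proof -
  have "x j \<in> V" using xY(1) tuple_entry_in_V[OF G_tuples _ coords(2)] by blast
  then have "\<theta> \<le> real (card (heavy_values (x i # Y)))"
    using xY by (auto simp: thin_pairs_def narrow_pairs_def heavy_values_def)
  then have "\<theta> * L \<le> real (card (heavy_values (x i # Y))) * L"
    using L_gt_0 by (intro mult_right_mono) auto
  also have "\<dots> \<le> real (card (common_link H i (x i # Y)))"
    using finite_common_link[OF G_tuples] finite_V
    by (intro card_ge_fibres[where f = "\<lambda>w. w j"]) (auto simp: heavy_values_def link_at_def)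
  finally show ?thesis
    using Cons_ext_lists[OF G_tuples coords(1)] xY(1) by (auto simp: rich_lists_def)
qed

definition same_cluster :: "'a \<Rightarrow> 'a \<Rightarrow> 'a set" where
  "same_cluster c a = {b \<in> V. \<phi>\<^sub>1 c b = \<phi>\<^sub>1 c a \<and> \<phi>\<^sub>1 c a \<noteq> None}"

lemma card_same_cluster_le: "real (card (same_cluster c a)) \<le> D * \<kappa>"
  using card_cluster_le[OF clusters_i] D_gt_0 \<kappa>_gt_0
  by (cases "\<phi>\<^sub>1 c a") (auto simp: same_cluster_def)

lemma extension_in_same_cluster:
  assumes xY: "(x, Y) \<in> pairs"
  shows "Y \<in> distinct_lists (s - 1) (same_cluster (x j) (x i))"
proof -
  have "\<phi>\<^sub>1 (x j) y = Some (\<psi>\<^sub>1 (x(i := undefined)))" if "y \<in> set (x i # Y)" for y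
    using clusteredD[OF clusters_i upd_in_H[OF xY that]] coords by simp
  moreover have "x i # Y \<in> distinct_lists s V"
    using xY Cons_ext_lists[OF G_tuples coords(1)] by blast
  ultimately show ?thesis by (auto simp: distinct_lists_def same_cluster_def)
qed

lemma extension_in_label_class:
  assumes xY: "(x, Y) \<in> pairs"
  shows "Y \<in> distinct_lists (s - 1) (label_class i \<psi>\<^sub>2 (x(j := undefined)))"
proof -
  have label: "\<phi>\<^sub>2 (x k) (x j) = Some (\<psi>\<^sub>2 (x(i := y, j := undefined)))" if "y \<in> set (x i # Y)" for y
    using clusteredD[OF clusters_j upd_in_H[OF xY that]] coords by simp
  have Y: "x i # Y \<in> distinct_lists s V"
    using xY Cons_ext_lists[OF G_tuples coords(1)] by blast
  have "y \<in> label_class i \<psi>\<^sub>2 (x(j := undefined))" if y: "y \<in> set Y" for y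
    using label[of y] label[of "x i"] y Y coords
    by (simp add: label_class_def distinct_lists_def fun_upd_twist subset_iff)
  then show ?thesis using Y by (auto simp: distinct_lists_def)
qed

text \<open>Given \<open>x i\<close> and \<open>x j\<close>, the list \<open>Y\<close> lies in one cluster, and the rest of \<open>x\<close> in a link
  smaller than \<open>L\<close>.\<close>

lemma card_thin_pairs_le: "real (card thin_pairs) \<le> N\<^sup>2 * (D * \<kappa>) ^ (s - 1) * L"
proof -
  let ?lists = "SIGMA (a, c):V \<times> V. distinct_lists (s - 1) (same_cluster c a)"
  let ?link = "\<lambda>((a, c), Y). link_at H i (a # Y) j c"
  let ?B = "SIGMA q:{q \<in> ?lists. real (card (?link q)) < L}. ?link q"
  let ?f = "\<lambda>(x, Y). (((x i, x j), Y), x(i := undefined))"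
  have finite_lists: "finite ?lists"
    using finite_V by (auto simp: same_cluster_def intro!: finite_distinct_lists)
  have "?f ` thin_pairs \<subseteq> ?B"
  proof (rule image_subsetI)
    fix q assume "q \<in> thin_pairs"
    then obtain x Y where q: "q = (x, Y)" and xY: "(x, Y) \<in> pairs"
      and thin: "real (card (link_at H i (x i # Y) j (x j))) < L"
      by (auto simp: thin_pairs_def)
    have "x i \<in> V" "x j \<in> V" using xY tuple_entry_in_V[OF G_tuples] coords by blast+
    moreover have "x(i := undefined) \<in> link_at H i (x i # Y) j (x j)"
      using xY in_link_at[of x H Y i j] coords by auto
    ultimately show "?f q \<in> ?B" using thin extension_in_same_cluster[OF xY] by (simp add: q)
  qed
  moreover have "inj_on ?f thin_pairs" by (auto simp: inj_on_def intro: tuple_eqI)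
  moreover have "finite ?B"
    using finite_lists finite_link_at[OF G_tuples] by (intro finite_SigmaI) auto
  ultimately have "real (card thin_pairs) \<le> real (card ?B)" by (intro of_nat_mono card_inj_on_le)
  also have "\<dots> \<le> real (card {q \<in> ?lists. real (card (?link q)) < L}) * L"
    using finite_lists by (intro card_Sigma_le) auto
  also have "\<dots> \<le> real (card ?lists) * L"
    using finite_lists L_gt_0 by (intro mult_right_mono of_nat_mono card_mono) auto
  also have "\<dots> \<le> (real (card (V \<times> V)) * (D * \<kappa>) ^ (s - 1)) * L"
    using finite_V card_same_cluster_le L_gt_0
    by (intro mult_right_mono card_Sigma_le)
      (auto simp: same_cluster_def intro!: card_distinct_lists_le)
  finally show ?thesis by (simp add: card_cartesian_product power2_eq_square)
qed

text \<open>Given the line of \<open>x\<close> in direction \<open>j\<close>, the list \<open>Y\<close> lies in one label class, and \<open>x j\<close> is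
  one of fewer than \<open>\<theta>\<close> values.\<close>

lemma card_narrow_pairs_le: "real (card narrow_pairs) \<le> N ^ (r - 1) * (D * \<kappa> ^ 4) ^ (s - 1) * \<theta>"
proof -
  let ?lists = "SIGMA w:shadow j H. distinct_lists (s - 1) (label_class i \<psi>\<^sub>2 w)"
  let ?values = "\<lambda>(w, Y). heavy_values (w i # Y)"
  let ?B = "SIGMA q:{q \<in> ?lists. real (card (?values q)) < \<theta>}. ?values q"
  let ?f = "\<lambda>(x, Y). ((x(j := undefined), Y), x j)"
  have finite_lists: "finite ?lists"
    using finite_shadow[OF G_tuples] finite_label_class
    by (intro finite_SigmaI finite_distinct_lists)
  have "?f q \<in> ?B" if "q \<in> narrow_pairs" for q
    using that coords extension_in_label_class by (auto simp: narrow_pairs_def shadow_def)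
  then have "?f ` narrow_pairs \<subseteq> ?B" by blast
  moreover have "inj_on ?f narrow_pairs" by (auto simp: inj_on_def intro: tuple_eqI)
  moreover have "finite ?B"
    using finite_lists finite_V by (intro finite_SigmaI) (auto simp: heavy_values_def)
  ultimately have "real (card narrow_pairs) \<le> real (card ?B)" by (intro of_nat_mono card_inj_on_le)
  also have "\<dots> \<le> real (card {q \<in> ?lists. real (card (?values q)) < \<theta>}) * \<theta>"
    using finite_lists by (intro card_Sigma_le) auto
  also have "\<dots> \<le> real (card ?lists) * \<theta>"
    using finite_lists \<theta>_gt_0 by (intro mult_right_mono of_nat_mono card_mono) auto
  also have "\<dots> \<le> (real (card (shadow j H)) * (D * \<kappa> ^ 4) ^ (s - 1)) * \<theta>"
    using finite_shadow[OF G_tuples] finite_label_class card_label_class_le \<theta>_gt_0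
    by (intro mult_right_mono card_Sigma_le card_distinct_lists_le) (auto simp: shadow_def)
  also have "\<dots> \<le> (N ^ (r - 1) * (D * \<kappa> ^ 4) ^ (s - 1)) * \<theta>"
    using card_shadow_le[OF G_tuples coords(2)] D_gt_0 \<kappa>_gt_0 \<theta>_gt_0
    by (intro mult_right_mono) auto
  finally show ?thesis .
qed

lemma card_poor_pairs_le: "real (card poor_pairs) * \<Lambda> ^ 6 \<le> 2 * (E * D ^ (s - 1))"
proof -
  have "real (card thin_pairs) * \<Lambda> ^ 6 \<le> N\<^sup>2 * (D * \<kappa>) ^ (s - 1) * L * \<Lambda> ^ 6"
    using card_thin_pairs_le \<Lambda>_gt_0 by (intro mult_right_mono) auto
  also have "\<dots> = N\<^sup>2 * L * ((D * \<kappa> ^ 1) ^ (s - 1) * \<Lambda> ^ 6)" by (simp only: mult_ac power_one_right)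
  also have "\<dots> \<le> N\<^sup>2 * L * (D ^ (s - 1) * \<Lambda> ^ 10)"
    using lists_times_\<Lambda>_le[of 1] L_gt_0 by (intro mult_left_mono) auto
  also have "\<dots> = N\<^sup>2 * D ^ (s - 1) * (L * \<Lambda> ^ 10)" by (simp only: mult_ac)
  also have "\<dots> = E * D ^ (s - 1)" unfolding L_\<Lambda> N_power_split[symmetric] by (simp only: mult_ac)
  finally have thin: "real (card thin_pairs) * \<Lambda> ^ 6 \<le> E * D ^ (s - 1)" .
  have "real (card narrow_pairs) * \<Lambda> ^ 6 \<le> N ^ (r - 1) * (D * \<kappa> ^ 4) ^ (s - 1) * \<theta> * \<Lambda> ^ 6"
    using card_narrow_pairs_le \<Lambda>_gt_0 by (intro mult_right_mono) auto
  also have "\<dots> = N ^ (r - 1) * \<theta> * ((D * \<kappa> ^ 4) ^ (s - 1) * \<Lambda> ^ 6)" by (simp only: mult_ac)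
  also have "\<dots> \<le> N ^ (r - 1) * \<theta> * (D ^ (s - 1) * \<Lambda> ^ 10)"
    using lists_times_\<Lambda>_le[of 4] \<theta>_gt_0 by (intro mult_left_mono) auto
  also have "\<dots> = N ^ (r - 1) * D ^ (s - 1) * (\<theta> * \<Lambda> ^ 10)" by (simp only: mult_ac)
  also have "\<dots> = E * D ^ (s - 1)" unfolding \<theta>_\<Lambda> by (simp only: mult_ac)
  finally have narrow: "real (card narrow_pairs) * \<Lambda> ^ 6 \<le> E * D ^ (s - 1)" .
  have "thin_pairs \<union> narrow_pairs \<subseteq> pairs" by (auto simp: thin_pairs_def narrow_pairs_def)
  then have "card poor_pairs \<le> card (thin_pairs \<union> narrow_pairs)"
    using rich_if_not_thin_or_narrow finite_pairs
    by (intro card_mono) (auto simp: poor_pairs_def intro: finite_subset)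
  then have "real (card poor_pairs) \<le> real (card thin_pairs) + real (card narrow_pairs)"
    using card_Un_le[of thin_pairs narrow_pairs] by linarith
  from mult_right_mono[OF this, of "\<Lambda> ^ 6"] show ?thesis
    using thin narrow \<Lambda>_gt_0 by (simp add: distrib_right)
qed

lemma card_ext_lists_ge_\<Lambda>:
  assumes "x \<in> H"
  shows "D ^ (s - 1) / \<Lambda> ^ 3 \<le> real (card (ext_lists H i x))"
proof -
  have "4 * real s * \<kappa>\<^sup>2 \<le> \<kappa> * \<kappa>\<^sup>2" using \<kappa>_ge(1) by (intro mult_right_mono) auto
  also have "\<dots> \<le> D" using \<kappa>_le_D by (simp add: power2_eq_square power3_eq_cube)
  finally have "4 * real s \<le> D / \<kappa>\<^sup>2" using \<kappa>_gt_0 by (simp add: pos_le_divide_eq)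
  then have "(D / \<kappa>\<^sup>2 / 4) ^ (s - 1) \<le> real (card (ext_lists H i x))"
    using codeg_ge[OF assms] by (intro card_ext_lists_ge[OF G_tuples coords(1) assms])
  moreover have "D ^ (s - 1) / \<Lambda> ^ 3 \<le> (D / \<kappa>\<^sup>2 / 4) ^ (s - 1)"
  proof -
    have "D ^ (s - 1) / \<Lambda> ^ 3 \<le> D ^ (s - 1) / (\<kappa> ^ 3) ^ (s - 1)"
      using \<kappa>_power_le_\<Lambda>_power[of 3] D_gt_0 \<kappa>_gt_0 \<Lambda>_gt_0 by (intro divide_left_mono) auto
    also have "\<dots> = (D / \<kappa> ^ 3) ^ (s - 1)" by (simp only: power_divide)
    also have "\<dots> \<le> (D / (\<kappa>\<^sup>2 * 4)) ^ (s - 1)"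
    proof (intro power_mono divide_left_mono)
      have "\<kappa>\<^sup>2 * 4 \<le> \<kappa>\<^sup>2 * \<kappa>" using \<kappa>_ge_60 by (intro mult_left_mono) auto
      then show "\<kappa>\<^sup>2 * 4 \<le> \<kappa> ^ 3" by (simp add: power2_eq_square power3_eq_cube)
    qed (use D_gt_0 \<kappa>_gt_0 in auto)
    finally show ?thesis by simp
  qed
  ultimately show ?thesis by linarith
qed

definition mostly_poor :: "(nat \<Rightarrow> 'a) set" where
  "mostly_poor = {x \<in> H. card (ext_lists H i x) < 2 * card {Y \<in> ext_lists H i x. (x, Y) \<in> poor_pairs}}"

lemma card_mostly_poor_le: "real (card mostly_poor) \<le> E / (8 * \<kappa>)"
proof -
  have "finite poor_pairs"
    using finite_pairs by (rule rev_finite_subset) (auto simp: poor_pairs_def)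
  then have "real (card mostly_poor) * (D ^ (s - 1) / \<Lambda> ^ 3) \<le> 2 * real (card poor_pairs)"
    unfolding mostly_poor_def
    using finite_system[OF G_tuples] finite_ext_lists[OF G_tuples coords(1)] card_ext_lists_ge_\<Lambda>
    by (intro card_majority_le)
  then have "real (card mostly_poor) * (D ^ (s - 1) / \<Lambda> ^ 3) * \<Lambda> ^ 6 \<le> 2 * real (card poor_pairs) * \<Lambda> ^ 6"
    using \<Lambda>_gt_0 by (intro mult_right_mono) auto
  also have "\<dots> \<le> 4 * E * D ^ (s - 1)" using card_poor_pairs_le by (simp add: mult_ac)
  also have "real (card mostly_poor) * (D ^ (s - 1) / \<Lambda> ^ 3) * \<Lambda> ^ 6
      = real (card mostly_poor) * \<Lambda> ^ 3 * D ^ (s - 1)"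
    using \<Lambda>_gt_0 by (simp add: field_simps flip: power_add)
  finally have "real (card mostly_poor) * \<Lambda> ^ 3 \<le> 4 * E"
    by (rule mult_right_le_imp_le) (use D_gt_0 in simp)
  moreover have "32 * \<kappa> \<le> \<Lambda> ^ 3"
  proof -
    have "32 * \<kappa> \<le> \<Lambda> * \<Lambda>" using \<Lambda>_ge_60 \<kappa>_le_\<Lambda> \<kappa>_gt_0 by (intro mult_mono) auto
    also have "\<dots> \<le> \<Lambda> ^ 3"
      unfolding power2_eq_square[symmetric] using \<Lambda>_ge_60 by (intro power_increasing) auto
    finally show ?thesis .
  qed
  then have "real (card mostly_poor) * (32 * \<kappa>) \<le> real (card mostly_poor) * \<Lambda> ^ 3"
    by (intro mult_left_mono) auto
  ultimately show ?thesis using \<kappa>_gt_0 by (simp add: pos_le_divide_eq)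
qed

lemma card_not_mostly_poor_ge: "E / (8 * \<kappa>) \<le> real (card (H - mostly_poor))"
proof -
  have "card H - card mostly_poor \<le> card (H - mostly_poor)"
    using finite_system[OF G_tuples] by (intro diff_card_le_card_Diff) (simp add: mostly_poor_def)
  moreover have "E / (4 * \<kappa>) = E / (8 * \<kappa>) + E / (8 * \<kappa>)" by simp
  ultimately show ?thesis using card_H card_mostly_poor_le by linarith
qed

lemma many_rich_extensions:
  assumes x: "x \<in> H - mostly_poor"
  shows "D ^ (s - 1) / \<Lambda> ^ 3 / 2 \<le> real (card {Y \<in> ext_lists H i x. x i # Y \<in> rich_lists})"
proof -
  let ?poor = "{Y \<in> ext_lists H i x. (x, Y) \<in> poor_pairs}"
  have rich: "{Y \<in> ext_lists H i x. x i # Y \<in> rich_lists} = ext_lists H i x - ?poor"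
    using x by (auto simp: poor_pairs_def)
  have "card (ext_lists H i x) - card ?poor \<le> card {Y \<in> ext_lists H i x. x i # Y \<in> rich_lists}"
    unfolding rich
    using finite_ext_lists[OF G_tuples coords(1)] by (intro diff_card_le_card_Diff) simp
  moreover have "2 * card ?poor \<le> card (ext_lists H i x)"
    using x by (simp add: mostly_poor_def not_less)
  ultimately have "real (card (ext_lists H i x))
      \<le> 2 * real (card {Y \<in> ext_lists H i x. x i # Y \<in> rich_lists})"
    by linarith
  then show ?thesis using card_ext_lists_ge_\<Lambda>[of x] x by simp
qed

lemma card_rich_lists_le_\<Lambda>: "real (card rich_lists) \<le> N\<^sup>2 * D ^ (s - 1) * \<Lambda> ^ 21 / D"
proof -
  have "real (card rich_lists) * (\<theta> * L) \<le> real (card (shadow i H)) * (D * \<kappa>) ^ s"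
    unfolding rich_lists_def by (rule card_rich_lists_le[OF G_tuples coords(1) codeg_le])
  also have "\<dots> \<le> N ^ (r - 1) * (D * \<kappa>) ^ s"
    using card_shadow_le[OF G_tuples coords(1)] D_gt_0 \<kappa>_gt_0 by (intro mult_right_mono) auto
  also have "\<dots> = N\<^sup>2 * D ^ (s - 1) * \<Lambda> * (N ^ (r - 3) * D)"
  proof -
    have "D ^ s = D ^ (s - 1) * D" using s_ge_3 by (cases s) auto
    then show ?thesis
      unfolding power_mult_distrib N_power_split[symmetric] \<Lambda>_def by (simp only: mult_ac)
  qed
  also have "\<dots> = N\<^sup>2 * D ^ (s - 1) * \<Lambda> ^ 11 * L"
    unfolding L_\<Lambda>[symmetric] by (simp add: power_Suc[symmetric] mult_ac del: power_Suc)
  finally have "real (card rich_lists) * \<theta> \<le> N\<^sup>2 * D ^ (s - 1) * \<Lambda> ^ 11"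
    using L_gt_0 by (simp flip: mult.assoc)
  then have "real (card rich_lists) * \<theta> * \<Lambda> ^ 10 \<le> N\<^sup>2 * D ^ (s - 1) * \<Lambda> ^ 11 * \<Lambda> ^ 10"
    using \<Lambda>_gt_0 by (intro mult_right_mono) auto
  then have "real (card rich_lists) * (\<theta> * \<Lambda> ^ 10) \<le> N\<^sup>2 * D ^ (s - 1) * (\<Lambda> ^ 11 * \<Lambda> ^ 10)"
    by (simp only: mult.assoc)
  then have "real (card rich_lists) * D \<le> N\<^sup>2 * D ^ (s - 1) * \<Lambda> ^ 21"
    unfolding \<theta>_\<Lambda> by (simp flip: power_add)
  then show ?thesis using D_gt_0 by (simp add: pos_le_divide_eq)
qed

lemma card_pair_shadow_ge:
  assumes m: "m < r" "m \<noteq> i" and F: "F \<subseteq> H" "E / (8 * \<kappa>) \<le> real r * real (card F)"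
  shows "N\<^sup>2 \<le> 8 * real r * \<kappa>\<^sup>2 * real (card (pair_shadow i m F))"
proof -
  let ?z = "real (card (pair_shadow i m F))"
  have "real (card F) \<le> ?z * (N ^ (r - 3) * (D * \<kappa>))"
  proof (rule card_le_pair_shadow)
    show "F \<subseteq> tuples" using F(1) G_tuples by blast
    fix a b
    have "card (pair_fibre F i m a b) \<le> card (pair_fibre H i m a b)"
      using finite_system[OF G_tuples] F(1) by (intro card_mono) (auto simp: pair_fibre_def)
    then show "real (card (pair_fibre F i m a b)) \<le> N ^ (r - 3) * (D * \<kappa>)"
      using pair_degree_le[OF m, of a b] by linarith
  qed
  then have "E / (8 * \<kappa>) \<le> real r * (?z * (N ^ (r - 3) * (D * \<kappa>)))"
    using F(2) by (meson mult_left_mono of_nat_0_le_iff order_trans)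
  then have "N\<^sup>2 * (N ^ (r - 3) * D) \<le> 8 * real r * \<kappa>\<^sup>2 * ?z * (N ^ (r - 3) * D)"
    using \<kappa>_gt_0 unfolding N_power_split[symmetric]
    by (simp add: pos_divide_le_eq power2_eq_square mult_ac)
  then show ?thesis using N_gt_0 D_gt_0 by simp
qed

lemma D_le_\<kappa>_power: "D \<le> (\<kappa> ^ s) ^ 28"
proof -
  let ?F = "H - mostly_poor"
  have "0 < E / (8 * \<kappa>)" using N_gt_0 D_gt_0 \<kappa>_gt_0 by simp
  then have "0 < card ?F" using card_not_mostly_poor_ge by linarith
  then have "?F \<noteq> {}" by (metis card.empty less_irrefl)
  moreover have "rich_lists \<subseteq> distinct_lists s V" by (auto simp: rich_lists_def)
  moreover have "0 < D ^ (s - 1) / \<Lambda> ^ 3 / 2" using D_gt_0 \<Lambda>_gt_0 by simp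
  ultimately obtain m F where m: "m < r" "m \<noteq> i"
    and F: "F \<subseteq> ?F" "real (card ?F) \<le> real r * real (card F)"
    and few_pairs: "real (card (pair_shadow i m F)) * (D ^ (s - 1) / \<Lambda> ^ 3 / 2)
      \<le> real r * real T * real (card rich_lists)"
    using small_pair_shadow_exists[OF Diff_subset subset_refl coords(1) _ _ many_rich_extensions]
    by metis
  define z where "z = real (card (pair_shadow i m F))"
  have many: "N\<^sup>2 \<le> 8 * real r * \<kappa>\<^sup>2 * z"
    unfolding z_def using F card_not_mostly_poor_ge by (intro card_pair_shadow_ge m) auto
  have "z * (D ^ (s - 1) / \<Lambda> ^ 3 / 2) \<le> real r * real T * (N\<^sup>2 * D ^ (s - 1) * \<Lambda> ^ 21 / D)"
    unfolding z_def
    using card_rich_lists_le_\<Lambda> by (intro order_trans[OF few_pairs] mult_left_mono) auto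
  then have "z * D * D ^ (s - 1) \<le> 2 * real r * real T * N\<^sup>2 * (\<Lambda> ^ 21 * \<Lambda> ^ 3) * D ^ (s - 1)"
    using D_gt_0 \<Lambda>_gt_0 by (simp add: field_simps)
  then have "z * D \<le> 2 * real r * real T * N\<^sup>2 * (\<Lambda> ^ 21 * \<Lambda> ^ 3)"
    by (rule mult_right_le_imp_le) (use D_gt_0 in simp)
  also have "\<Lambda> ^ 21 * \<Lambda> ^ 3 = \<Lambda> ^ 24" by (simp flip: power_add)
  finally have few: "z * D \<le> 2 * real r * real T * N\<^sup>2 * \<Lambda> ^ 24" .
  have "N\<^sup>2 * D \<le> 8 * real r * \<kappa>\<^sup>2 * (z * D)"
    using mult_right_mono[OF many, of D] D_gt_0 by (simp add: mult_ac)
  also have "\<dots> \<le> 8 * real r * \<kappa>\<^sup>2 * (2 * real r * real T * N\<^sup>2 * \<Lambda> ^ 24)"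
    using few by (intro mult_left_mono) auto
  also have "\<dots> = N\<^sup>2 * (16 * real r * (real r * real T) * \<kappa>\<^sup>2 * \<Lambda> ^ 24)" by simp
  finally have "D \<le> 16 * real r * (real r * real T) * \<kappa>\<^sup>2 * \<Lambda> ^ 24" using N_gt_0 by simp
  also have "\<dots> \<le> \<kappa> * \<kappa> * \<kappa>\<^sup>2 * \<Lambda> ^ 24"
    using r_le_\<kappa> \<kappa>_ge(2) \<kappa>_gt_0 \<Lambda>_gt_0 by (intro mult_right_mono mult_mono) auto
  also have "\<dots> = \<kappa> ^ 4 * \<Lambda> ^ 24" by (simp add: eval_nat_numeral)
  also have "\<dots> \<le> \<Lambda> ^ 4 * \<Lambda> ^ 24" using \<kappa>_le_\<Lambda> \<kappa>_gt_0 by (intro mult_right_mono power_mono) auto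
  also have "\<dots> = \<Lambda> ^ 28" by (simp flip: power_add)
  finally show ?thesis by (simp add: \<Lambda>_def)
qed

end

context covered_system
begin

lemma clustered_core:
  assumes coords: "i < r" "j < r" "i \<noteq> j" "i \<noteq> k" "j \<noteq> k" and \<kappa>: "20 * real r \<le> \<kappa>" and D: "D > 0"
    and card_G: "N ^ (r - 1) * D / \<kappa> \<le> real (card G)"
    and codeg: "\<And>x. real (card (nbrs G i x)) \<le> D * \<kappa>"
    and clusters: "clustered j k (D * \<kappa>) G \<phi> \<psi>"
  obtains H where "H \<subseteq> G" "N ^ (r - 1) * D / (4 * \<kappa>) \<le> real (card H)"
    "\<And>x. x \<in> H \<Longrightarrow> D / \<kappa>\<^sup>2 \<le> real (card (nbrs H i x))"
    "\<And>x. x \<in> H \<Longrightarrow> real (card (label_class i \<psi> (x(j := undefined)))) \<le> D * \<kappa> ^ 4"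
proof -
  let ?E = "N ^ (r - 1) * D"
  have \<kappa>_bounds: "\<kappa> > 0" "60 \<le> \<kappa>" using \<kappa> real_r_ge by linarith+
  define B where "B = {x \<in> G. D * \<kappa> ^ 4 < real (card (label_class i \<psi> (x(j := undefined))))}"
  have finite_B: "finite B" using finite_system[OF G_tuples] by (simp add: B_def)
  have "real (card B) * (D * \<kappa> ^ 4) \<le> real (card (SIGMA x:B. label_class i \<psi> (x(j := undefined))))"
    using finite_B finite_label_class by (intro card_Sigma_ge) (auto simp: B_def)
  also have "\<dots> \<le> real (card (SIGMA x:G. label_class i \<psi> (x(j := undefined))))"
    using finite_system[OF G_tuples] finite_label_class
    by (intro of_nat_mono card_mono finite_SigmaI) (auto simp: B_def)
  also have "\<dots> \<le> N ^ (r - 1) * (D * \<kappa> * (D * \<kappa>))"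
    using card_label_class_pairs_le[OF G_tuples coords clusters codeg] D \<kappa>_bounds by simp
  also have "\<dots> = ?E / \<kappa>\<^sup>2 * (D * \<kappa> ^ 4)" using \<kappa>_bounds by (simp add: eval_nat_numeral)
  finally have card_B: "real (card B) \<le> ?E / \<kappa>\<^sup>2"
    by (rule mult_right_le_imp_le) (use D \<kappa>_bounds in simp)
  have remainder_tuples: "G - B \<subseteq> tuples" and \<tau>: "0 \<le> D / \<kappa>\<^sup>2" using G_tuples D by auto
  obtain H where H: "H \<subseteq> G - B" "\<And>x l. x \<in> H \<Longrightarrow> l < r \<Longrightarrow> D / \<kappa>\<^sup>2 \<le> real (card (nbrs H l x))"
    "real (card (G - B)) - D / \<kappa>\<^sup>2 * real r * N ^ (r - 1) \<le> real (card H)"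
    using min_codegree_subset[OF remainder_tuples \<tau>] by blast
  define lost where "lost = D / \<kappa>\<^sup>2 * real r * N ^ (r - 1)"
  define quarter where "quarter = ?E / (4 * \<kappa>)"
  have "?E / \<kappa>\<^sup>2 + lost \<le> 2 * quarter"
  proof -
    have "1 + real r \<le> \<kappa> / 2" using \<kappa> \<kappa>_bounds by linarith
    then have "?E / \<kappa>\<^sup>2 * (1 + real r) \<le> ?E / \<kappa>\<^sup>2 * (\<kappa> / 2)" using D by (intro mult_left_mono) auto
    then show ?thesis
      using \<kappa>_bounds
      by (simp add: lost_def quarter_def power2_eq_square algebra_simps add_divide_distrib)
  qed
  moreover have "4 * quarter \<le> real (card G)" using card_G by (simp add: quarter_def)
  moreover have "card G - card B \<le> card (G - B)" using finite_B by (rule diff_card_le_card_Diff)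
  moreover have "0 \<le> quarter" using D \<kappa>_bounds by (simp add: quarter_def)
  ultimately have "quarter \<le> real (card H)"
    using card_B H(3) unfolding lost_def[symmetric] by linarith
  then show ?thesis using H(1,2) coords(1)
    unfolding quarter_def by (intro that[of H]) (auto simp: B_def not_less)
qed

lemma consecutive_clusters_bound:
  assumes coords: "i < r" "j < r" "i \<noteq> j" "i \<noteq> k" "j \<noteq> k" and V: "V \<noteq> {}"
    and \<kappa>: "8 * real s \<le> \<kappa>" "20 * real r * real T \<le> \<kappa>" and D: "\<kappa> ^ 3 \<le> D"
    and card_G: "N ^ (r - 1) * D / \<kappa> \<le> real (card G)"
    and codeg: "\<And>x. real (card (nbrs G i x)) \<le> D * \<kappa>"
    and pair_degree: "\<And>m a b. m < r \<Longrightarrow> m \<noteq> i \<Longrightarrow> real (card (pair_fibre G i m a b)) \<le> N ^ (r - 3) * (D * \<kappa>)"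
    and clusters: "clustered i j (D * \<kappa>) G \<phi>\<^sub>1 \<psi>\<^sub>1" "clustered j k (D * \<kappa>) G \<phi>\<^sub>2 \<psi>\<^sub>2"
  shows "D \<le> (\<kappa> ^ s) ^ 28"
proof -
  have "real r * 1 \<le> real r * real T" using real_T_ge by (intro mult_left_mono) auto
  then have r_le: "20 * real r \<le> \<kappa>" using \<kappa>(2) by simp
  have "0 < \<kappa> ^ 3" using r_le real_r_ge by (intro zero_less_power) linarith
  then have D_gt_0: "D > 0" using D by linarith
  obtain H where H: "H \<subseteq> G" "N ^ (r - 1) * D / (4 * \<kappa>) \<le> real (card H)"
    "\<And>x. x \<in> H \<Longrightarrow> D / \<kappa>\<^sup>2 \<le> real (card (nbrs H i x))"
    "\<And>x. x \<in> H \<Longrightarrow> real (card (label_class i \<psi>\<^sub>2 (x(j := undefined)))) \<le> D * \<kappa> ^ 4"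
    using clustered_core[OF coords r_le D_gt_0 card_G codeg clusters(2)] by blast
  interpret H: covered_system V r s T S H by (rule covered_subsystem[OF H(1)])
  interpret cluster_chain V r s T S H D \<kappa> i j k \<phi>\<^sub>1 \<phi>\<^sub>2 \<psi>\<^sub>1 \<psi>\<^sub>2
  proof unfold_locales
    show "real (card (nbrs H i x)) \<le> D * \<kappa>" for x
      using codeg[of x] card_mono[OF finite_nbrs[OF G_tuples coords(1)] nbrs_mono[OF H(1)], of x]
      by linarith
    show "real (card (pair_fibre H i m a b)) \<le> N ^ (r - 3) * (D * \<kappa>)" if "m < r" "m \<noteq> i" for m a b
    proof -
      have "card (pair_fibre H i m a b) \<le> card (pair_fibre G i m a b)"
        using finite_system[OF G_tuples] H(1) by (intro card_mono) (auto simp: pair_fibre_def)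
      then show ?thesis using pair_degree[OF that, of a b] by linarith
    qed
    show "clustered i j (D * \<kappa>) H \<phi>\<^sub>1 \<psi>\<^sub>1" "clustered j k (D * \<kappa>) H \<phi>\<^sub>2 \<psi>\<^sub>2"
      using clusters H(1) by (auto elim: clustered_mono)
  qed (use V coords \<kappa> D H in auto)
  show ?thesis by (rule D_le_\<kappa>_power)
qed

end

section \<open>Odd uniformities\<close>

locale regular_system = scaled_system V r s T S G D Q
  for V :: "'a set" and r s T :: nat and S :: "nat \<Rightarrow> 'a list \<Rightarrow> 'a set" and G :: "(nat \<Rightarrow> 'a) set"
    and D Q :: real +
  assumes card_G_ge: "E / 8 \<le> real (card G)"
    and codeg_le: "i < r \<Longrightarrow> real (card (nbrs G i x)) \<le> D * Q ^ 5"
    and pair_degree_le: "i < r \<Longrightarrow> j < r \<Longrightarrow> i \<noteq> j \<Longrightarrow>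
      real (card (pair_fibre G i j a b)) \<le> N ^ (r - 3) * D * Q ^ 5"
begin

definition R :: real where "R = Q ^ (s + 2)"

definition L :: real where "L = N ^ (r - 3) * D / R"

abbreviation close_nbrs :: "nat \<Rightarrow> nat \<Rightarrow> (nat \<Rightarrow> 'a) \<Rightarrow> 'a set" where
  "close_nbrs i j x \<equiv> nbrs G i x \<inter> close_values G L i j (x j) (x i)"

lemma Q_power_le_R: "m \<le> s + 2 \<Longrightarrow> Q ^ m \<le> R"
  unfolding R_def using Q_ge_1 by (rule power_increasing[rotated])

lemma Q_le_R: "Q \<le> R"
  using Q_power_le_R[of 1] by simp

lemma R_ge_1: "R \<ge> 1" and R_gt_0: "R > 0"
  using Q_le_R Q_ge_1 by linarith+

lemma L_gt_0: "L > 0"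
  using N_gt_0 D_ge_1 R_gt_0 by (simp add: L_def)

lemma card_exceptional_le:
  fixes b :: real
  assumes "b * (D / (16 * real r) / 4) ^ (s - 1) \<le> 2 * (N ^ s * (real r * real T * L))"
  shows "b \<le> E / (32 * real r)"
proof -
  define C where "C = (64 * real r) ^ (s - 1)"
  have C_gt_0: "C > 0" using real_r_ge by (simp add: C_def)
  have R_split: "R = Q ^ (s - 1) * Q ^ 3"
  proof -
    have "s + 2 = (s - 1) + 3" using s_ge_3 by simp
    then show ?thesis unfolding R_def by (metis power_add)
  qed
  have "(D / (16 * real r) / 4) ^ (s - 1) = D ^ (s - 1) / C" by (simp add: C_def power_divide)
  then have "b * D ^ (s - 1) = b * (D / (16 * real r) / 4) ^ (s - 1) * C" using C_gt_0 by simp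
  also have "\<dots> \<le> 2 * (N ^ s * (real r * real T * L)) * C"
    using assms C_gt_0 by (intro mult_right_mono) auto
  also have "\<dots> = 2 * C * real r * real T * (N\<^sup>2 * L * Q ^ (s - 1)) * D ^ (s - 1)"
    by (simp add: N_powers(1) power_mult_distrib)
  also have "N\<^sup>2 * L * Q ^ (s - 1) = E / Q ^ 3"
    unfolding N_powers(2)[symmetric] L_def R_split using Q_gt_0 by simp
  finally have "b \<le> 2 * C * real r * real T * (E / Q ^ 3)"
    by (rule mult_right_le_imp_le) (use D_ge_1 in simp)
  then have "32 * real r * b \<le> 32 * real r * (2 * C * real r * real T * (E / Q ^ 3))"
    by (rule mult_left_mono) simp
  also have "\<dots> = (64 * real r ^ 2 * real T * C) * (E / Q ^ 3)" by (simp add: power2_eq_square)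
  also have "\<dots> \<le> Q ^ 3 * (E / Q ^ 3)"
  proof (rule mult_right_mono)
    have "Q \<le> Q ^ 3" using Q_ge_1 by (simp add: self_le_power)
    then show "64 * real r ^ 2 * real T * C \<le> Q ^ 3" using Q_ge(6) unfolding C_def by linarith
  qed (use E_gt_0 Q_gt_0 in simp)
  also have "\<dots> = E" using Q_gt_0 by simp
  finally show ?thesis using real_r_ge by (simp add: pos_le_divide_eq mult.commute)
qed

lemma exceptional_set_exists:
  assumes H: "H \<subseteq> G" "\<And>x. x \<in> H \<Longrightarrow> D / (16 * real r) \<le> real (card (nbrs H i x))" and i: "i < r"
  obtains B where "B \<subseteq> H" "real (card B) \<le> E / (32 * real r)"
    "\<And>x. x \<in> H - B \<Longrightarrow> \<exists>j<r. j \<noteq> i \<and> D / Q \<le> real (card (close_nbrs i j x))"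
proof -
  let ?\<tau> = "D / (16 * real r)"
  let ?close = "\<lambda>x j. nbrs H i x \<inter> close_values H L i j (x j) (x i)"
  have "real r \<le> real r ^ 2" using real_r_ge by (simp add: self_le_power)
  then have "8 * real r \<le> Q" using Q_ge(1) by linarith
  then have "(8 * real s) * (8 * real r) \<le> Q * Q" using Q_ge(3) Q_gt_0 by (intro mult_mono) auto
  also have "\<dots> \<le> D" using Q_square_le_D by (simp add: power2_eq_square)
  finally have "4 * real s \<le> ?\<tau>" using real_r_ge by (simp add: pos_le_divide_eq)
  then obtain B where B: "B \<subseteq> H" "real (card B) * (?\<tau> / 4) ^ (s - 1) \<le> 2 * (N ^ s * (real r * real T * L))"
    "\<And>x. x \<in> H - B \<Longrightarrow> \<exists>j<r. j \<noteq> i \<and> ?\<tau> / (8 * real r) \<le> real (card (?close x j))"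
    using concentrated_links[OF H(1) i less_imp_le[OF L_gt_0] _ H(2)] by blast
  have "128 * (real r)\<^sup>2 \<le> Q" using Q_ge(1) zero_le_power2[of "real r"] by linarith
  then have "D / Q \<le> D / (128 * (real r)\<^sup>2)"
    using D_ge_1 Q_gt_0 real_r_ge by (intro divide_left_mono) auto
  then have threshold: "D / Q \<le> ?\<tau> / (8 * real r)" by (simp add: power2_eq_square)
  have "real (card (?close x j)) \<le> real (card (close_nbrs i j x))" for x j
    using finite_nbrs[OF G_tuples i] nbrs_mono[OF H(1)] close_values_mono[OF H(1) G_tuples]
    by (intro of_nat_mono card_mono Int_mono) auto
  then have "\<exists>j<r. j \<noteq> i \<and> D / Q \<le> real (card (close_nbrs i j x))" if "x \<in> H - B" for x
    using B(3)[OF that] threshold by (meson order_trans)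
  then show ?thesis using B(1) card_exceptional_le[OF B(2)] that by blast
qed

lemma concentrated_subset:
  obtains F where "F \<subseteq> G" "E / 32 \<le> real (card F)"
    "\<And>x i. x \<in> F \<Longrightarrow> i < r \<Longrightarrow> \<exists>j<r. j \<noteq> i \<and> D / Q \<le> real (card (close_nbrs i j x))"
proof -
  have "0 \<le> D / (16 * real r)" using D_ge_1 by simp
  then obtain H where H: "H \<subseteq> G"
    "\<And>x i. x \<in> H \<Longrightarrow> i < r \<Longrightarrow> D / (16 * real r) \<le> real (card (nbrs H i x))"
    "real (card G) - D / (16 * real r) * real r * N ^ (r - 1) \<le> real (card H)"
    using min_codegree_subset[OF G_tuples] by blast
  have "D / (16 * real r) * real r * N ^ (r - 1) = E / 16" using real_r_ge by simp
  then have card_H: "E / 16 \<le> real (card H)" using H(3) card_G_ge by linarith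
  have "\<exists>B\<subseteq>H. real (card B) \<le> E / (32 * real r) \<and>
    (\<forall>x\<in>H - B. \<exists>j<r. j \<noteq> i \<and> D / Q \<le> real (card (close_nbrs i j x)))"
    if i: "i < r" for i
    using exceptional_set_exists[OF H(1) H(2)[OF _ i] i] by metis
  then obtain B where B: "\<And>i. i < r \<Longrightarrow> B i \<subseteq> H" "\<And>i. i < r \<Longrightarrow> real (card (B i)) \<le> E / (32 * real r)"
    "\<And>i x. i < r \<Longrightarrow> x \<in> H - B i \<Longrightarrow> \<exists>j<r. j \<noteq> i \<and> D / Q \<le> real (card (close_nbrs i j x))"
    by metis
  let ?B = "\<Union>i<r. B i"
  have "real (card ?B) \<le> real (card {..<r}) * (E / (32 * real r))"
    using B(2) by (intro card_UN_le_mult) auto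
  also have "\<dots> = E / 32" using real_r_ge by simp
  finally have "real (card ?B) \<le> E / 32" .
  moreover have "card H - card ?B \<le> card (H - ?B)"
    using B(1) finite_system[OF subset_tuples[OF H(1)]]
    by (intro diff_card_le_card_Diff) (auto intro: finite_subset)
  ultimately have "E / 32 \<le> real (card (H - ?B))" using card_H by linarith
  then show ?thesis using H(1) B(3) by (intro that[of "H - ?B"]) auto
qed

lemma concentration_map_exists:
  obtains F \<pi> where "F \<subseteq> G" "E / Q \<le> real (card F)" "\<And>i. i < r \<Longrightarrow> \<pi> i < r" "\<And>i. i < r \<Longrightarrow> \<pi> i \<noteq> i"
    "\<And>x i. x \<in> F \<Longrightarrow> i < r \<Longrightarrow> D / Q \<le> real (card (close_nbrs i (\<pi> i) x))"
proof -
  obtain H where H: "H \<subseteq> G" "E / 32 \<le> real (card H)"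
    "\<And>x i. x \<in> H \<Longrightarrow> i < r \<Longrightarrow> \<exists>j<r. j \<noteq> i \<and> D / Q \<le> real (card (close_nbrs i j x))"
    using concentrated_subset by blast
  let ?maps = "PiE {..<r} (\<lambda>i. {..<r} - {i})"
  let ?concentrated = "\<lambda>x \<pi>. \<forall>i<r. D / Q \<le> real (card (close_nbrs i (\<pi> i) x))"
  have maps: "finite ?maps" by (intro finite_PiE) auto
  have "\<exists>\<pi>\<in>?maps. ?concentrated x \<pi>" if x: "x \<in> H" for x
  proof -
    obtain \<pi> where "\<And>i. i < r \<Longrightarrow> \<pi> i < r \<and> \<pi> i \<noteq> i \<and> D / Q \<le> real (card (close_nbrs i (\<pi> i) x))"
      using H(3)[OF x] by metis
    then show ?thesis by (intro bexI[of _ "restrict \<pi> {..<r}"]) auto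
  qed
  moreover have "?maps \<noteq> {}"
  proof -
    have "\<exists>j. j \<in> {..<r} - {i}" for i
    proof -
      obtain j where "j < r" "j \<noteq> i" "j \<noteq> i" by (rule third_coordinate)
      then show ?thesis by auto
    qed
    then show ?thesis by (auto simp: PiE_eq_empty_iff)
  qed
  ultimately obtain \<pi> where \<pi>: "\<pi> \<in> ?maps"
    "real (card H) \<le> real (card ?maps) * real (card {x \<in> H. ?concentrated x \<pi>})"
    using pigeonhole_cover[OF maps, of H ?concentrated] by blast
  have "real (card ?maps) \<le> real r ^ r"
  proof -
    have "card ?maps \<le> card (PiE {..<r} (\<lambda>_. {..<r}))"
      by (intro card_mono finite_PiE PiE_mono) auto
    also have "\<dots> = r ^ r" by (simp add: card_PiE)
    finally show ?thesis by (simp flip: of_nat_power)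
  qed
  then have "E / 32 \<le> real r ^ r * real (card {x \<in> H. ?concentrated x \<pi>})"
    using H(2) \<pi>(2) by (meson mult_right_mono of_nat_0_le_iff order_trans)
  also have "\<dots> \<le> Q / 32 * real (card {x \<in> H. ?concentrated x \<pi>})"
    using Q_ge(4) by (intro mult_right_mono) auto
  finally have "E / Q \<le> real (card {x \<in> H. ?concentrated x \<pi>})"
    using Q_gt_0 by (simp add: pos_divide_le_eq mult.commute)
  then show ?thesis using H(1) \<pi>(1) by (intro that[of "{x \<in> H. ?concentrated x \<pi>}" \<pi>]) auto
qed

lemma card_close_values_le_R:
  assumes coords: "i < r" "j < r" "i \<noteq> j"
  shows "real (card (close_values G L i j c a)) \<le> D * R ^ 3"
proof -
  define n where "n = N ^ (r - 3) * D"
  have n_gt_0: "n > 0" using N_gt_0 D_ge_1 by (simp add: n_def)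
  have "real (card (close_values G L i j c a)) * L \<le> n * Q ^ 5 * (D * Q ^ 5)"
    unfolding n_def
    by (rule card_close_values_le[OF G_tuples coords(1,3) _ codeg_le[OF coords(1)] pair_degree_le[OF coords]])
      (use D_ge_1 Q_gt_0 in simp)
  also have "\<dots> \<le> n * R * (D * R)"
    using Q_power_le_R[of 5] s_ge_3 n_gt_0 D_ge_1 Q_gt_0 R_gt_0
    by (intro mult_mono mult_left_mono) auto
  also have "\<dots> = D * R ^ 3 * L" using R_gt_0 by (simp add: L_def n_def power3_eq_cube)
  finally show ?thesis using L_gt_0 by (rule mult_right_le_imp_le)
qed

lemma clustered_restriction:
  assumes F: "F \<subseteq> G" and coords: "i < r" "j < r" "i \<noteq> j"
    and close: "\<And>x. x \<in> F \<Longrightarrow> D / Q \<le> real (card (close_nbrs i j x))"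
  obtains F' \<phi> \<psi> where "F' \<subseteq> F" "clustered i j (D * R ^ 3) F' \<phi> \<psi>" "real (card F) / R ^ 4 \<le> real (card F')"
proof -
  have m: "1 \<le> D * R ^ 3" using D_ge_1 R_ge_1 by (simp add: mult_ge1_I)
  have codeg: "real (card (nbrs G i x)) \<le> D * R ^ 3" for x
  proof -
    have "Q ^ 5 \<le> R" using s_ge_3 by (intro Q_power_le_R) simp
    also have "\<dots> \<le> R ^ 3" using R_ge_1 by (simp add: self_le_power)
    finally show ?thesis
      using codeg_le[OF coords(1), of x] D_ge_1 mult_left_mono[of "Q ^ 5" "R ^ 3" D] by linarith
  qed
  have "0 \<le> D / Q" using D_ge_1 Q_gt_0 by simp
  then obtain F' \<phi> \<psi> where F': "F' \<subseteq> F" "clustered i j (D * R ^ 3) F' \<phi> \<psi>"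
    "D / Q / (10 * (D * R ^ 3)) * real (card F) \<le> real (card F')"
    using clustered_subset[OF F G_tuples coords(1) m _ card_close_values_le_R[OF coords] codeg close] by blast
  have "10 * Q * R ^ 3 \<le> R * R ^ 3"
  proof (rule mult_right_mono)
    have "10 * Q \<le> Q * Q" using Q_ge_9000 by (intro mult_right_mono) auto
    also have "\<dots> \<le> R" using Q_power_le_R[of 2] by (simp add: power2_eq_square)
    finally show "10 * Q \<le> R" .
  qed (use R_gt_0 in simp)
  also have "\<dots> = R ^ 4" by (simp add: eval_nat_numeral)
  finally have "real (card F) / R ^ 4 \<le> real (card F) / (10 * Q * R ^ 3)"
    using Q_gt_0 R_gt_0 by (intro divide_left_mono) auto
  also have "\<dots> = D / Q / (10 * (D * R ^ 3)) * real (card F)" using D_ge_1 by simp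
  also note F'(3)
  finally show ?thesis by (rule that[OF F'(1,2)])
qed

lemma R_powers: "(R ^ 9) ^ 3 \<le> D" "((R ^ 9) ^ s) ^ 28 < D"
proof -
  have s: "3 * s \<le> s * s" using s_ge_3 by simp
  have "(R ^ 9) ^ 3 = Q ^ ((s + 2) * 9 * 3)" by (simp only: R_def power_mult)
  also have "\<dots> \<le> D"
  proof (rule Q_power_le_D)
    have "(s + 2) * 9 * 3 = 27 * s + 54" by simp
    also have "\<dots> \<le> 500 * (s * s)" using s s_ge_3 by linarith
    finally show "(s + 2) * 9 * 3 \<le> 500 * s\<^sup>2" by (simp only: power2_eq_square)
  qed
  finally show "(R ^ 9) ^ 3 \<le> D" .
  have "((R ^ 9) ^ s) ^ 28 = Q ^ ((s + 2) * 9 * s * 28)" by (simp only: R_def power_mult)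
  also have "\<dots> \<le> Q ^ (500 * s\<^sup>2)"
  proof (rule power_increasing[OF _ Q_ge_1])
    have "(s + 2) * 9 * s * 28 = 252 * (s * s) + 504 * s" by (simp add: algebra_simps)
    also have "\<dots> \<le> 500 * (s * s)" using s by linarith
    finally show "(s + 2) * 9 * s * 28 \<le> 500 * s\<^sup>2" by (simp only: power2_eq_square)
  qed
  finally show "((R ^ 9) ^ s) ^ 28 < D" using D_large by linarith
qed

lemma no_consecutive_clusters:
  assumes F: "F \<subseteq> G" "E / R ^ 9 \<le> real (card F)" and coords: "i < r" "j < r" "i \<noteq> j" "i \<noteq> k" "j \<noteq> k"
    and clusters: "clustered i j (D * R ^ 3) F \<phi>\<^sub>1 \<psi>\<^sub>1"
  shows "\<not> clustered j k (D * R ^ 3) F \<phi>\<^sub>2 \<psi>\<^sub>2"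
proof
  assume clusters': "clustered j k (D * R ^ 3) F \<phi>\<^sub>2 \<psi>\<^sub>2"
  interpret F: covered_system V r s T S F by (rule covered_subsystem[OF F(1)])
  have Q5: "Q ^ 5 \<le> R ^ 9" and "Q \<le> R ^ 9"
  proof -
    have "Q ^ 5 \<le> R" using s_ge_3 by (intro Q_power_le_R) simp
    moreover have "R \<le> R ^ 9" using R_ge_1 by (simp add: self_le_power)
    ultimately show "Q ^ 5 \<le> R ^ 9" "Q \<le> R ^ 9" using Q_le_R by linarith+
  qed
  have class_size: "D * R ^ 3 \<le> D * R ^ 9"
    using R_ge_1 D_ge_1 by (intro mult_left_mono power_increasing) auto
  have "D \<le> ((R ^ 9) ^ s) ^ 28"
  proof (rule F.consecutive_clusters_bound[OF coords])
    show "V \<noteq> {}" using N_gt_0 by auto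
    show "8 * real s \<le> R ^ 9" "20 * real r * real T \<le> R ^ 9"
      using Q_ge(2,3) \<open>Q \<le> R ^ 9\<close> by linarith+
    show "clustered i j (D * R ^ 9) F \<phi>\<^sub>1 \<psi>\<^sub>1" "clustered j k (D * R ^ 9) F \<phi>\<^sub>2 \<psi>\<^sub>2"
      using clusters clusters' class_size by (auto elim: clustered_mono)
    show "real (card (nbrs F i x)) \<le> D * R ^ 9" for x
    proof -
      have "card (nbrs F i x) \<le> card (nbrs G i x)"
        using finite_nbrs[OF G_tuples coords(1)] F(1) by (intro card_mono nbrs_mono) auto
      moreover have "D * Q ^ 5 \<le> D * R ^ 9" using Q5 D_ge_1 by (intro mult_left_mono) auto
      ultimately show ?thesis using codeg_le[OF coords(1), of x] by linarith
    qed
    show "real (card (pair_fibre F i m a b)) \<le> N ^ (r - 3) * (D * R ^ 9)"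
      if "m < r" "m \<noteq> i" for m a b
    proof -
      have "card (pair_fibre F i m a b) \<le> card (pair_fibre G i m a b)"
        using finite_system[OF G_tuples] F(1) by (intro card_mono) (auto simp: pair_fibre_def)
      moreover have "N ^ (r - 3) * D * Q ^ 5 \<le> N ^ (r - 3) * D * R ^ 9"
        using Q5 D_ge_1 by (intro mult_left_mono) auto
      ultimately show ?thesis
        using pair_degree_le[OF coords(1) that(1) that(2)[symmetric], of a b]
        by (simp only: mult.assoc)
    qed
  qed (use R_powers(1) F(2) in auto)
  then show False using R_powers(2) by linarith
qed

lemma concentration_map_involution:
  assumes F: "F \<subseteq> G" "E / Q \<le> real (card F)" and \<pi>: "\<And>i. i < r \<Longrightarrow> \<pi> i < r" "\<And>i. i < r \<Longrightarrow> \<pi> i \<noteq> i"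
    and close: "\<And>x i. x \<in> F \<Longrightarrow> i < r \<Longrightarrow> D / Q \<le> real (card (close_nbrs i (\<pi> i) x))" and i: "i < r"
  shows "\<pi> (\<pi> i) = i"
proof (rule ccontr)
  assume neq: "\<pi> (\<pi> i) \<noteq> i"
  define j k where "j = \<pi> i" and "k = \<pi> j"
  have coords: "i < r" "j < r" "i \<noteq> j" "i \<noteq> k" "j \<noteq> k" and k: "k < r"
    using i \<pi>[of i] \<pi>[of j] neq unfolding j_def k_def by metis+
  obtain F' \<phi>\<^sub>1 \<psi>\<^sub>1 where F': "F' \<subseteq> F" "clustered i j (D * R ^ 3) F' \<phi>\<^sub>1 \<psi>\<^sub>1"
    "real (card F) / R ^ 4 \<le> real (card F')"
    using clustered_restriction[OF F(1) coords(1-3)] close[OF _ coords(1)] unfolding j_def by blast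
  have "F' \<subseteq> G" using F'(1) F(1) by blast
  then obtain F'' \<phi>\<^sub>2 \<psi>\<^sub>2 where F'': "F'' \<subseteq> F'" "clustered j k (D * R ^ 3) F'' \<phi>\<^sub>2 \<psi>\<^sub>2"
    "real (card F') / R ^ 4 \<le> real (card F'')"
    using clustered_restriction[OF _ coords(2) k coords(5)] close[OF subsetD[OF F'(1)] coords(2)]
    unfolding k_def by blast
  have "E / R ^ 9 = E / R / R ^ 4 / R ^ 4" by (simp flip: power_add power_Suc)
  also have "\<dots> \<le> real (card F) / R ^ 4 / R ^ 4"
  proof (intro divide_right_mono)
    have "E / R \<le> E / Q" using Q_le_R Q_gt_0 E_gt_0 R_gt_0 by (intro divide_left_mono) auto
    then show "E / R \<le> real (card F)" using F(2) by linarith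
  qed (use R_gt_0 in auto)
  also have "\<dots> \<le> real (card F') / R ^ 4" using F'(3) R_gt_0 by (intro divide_right_mono) auto
  also note F''(3)
  finally have "E / R ^ 9 \<le> real (card F'')" .
  moreover have "clustered i j (D * R ^ 3) F'' \<phi>\<^sub>1 \<psi>\<^sub>1"
    using F'(2) F''(1) by (rule clustered_mono) simp
  ultimately show False
    using no_consecutive_clusters[OF _ _ coords] F''(1,2) \<open>F' \<subseteq> G\<close> by blast
qed

lemma even_uniformity: "even r"
proof -
  obtain F \<pi> where F: "F \<subseteq> G" "E / Q \<le> real (card F)"
    and \<pi>: "\<And>i. i < r \<Longrightarrow> \<pi> i < r" "\<And>i. i < r \<Longrightarrow> \<pi> i \<noteq> i"
    and close: "\<And>x i. x \<in> F \<Longrightarrow> i < r \<Longrightarrow> D / Q \<le> real (card (close_nbrs i (\<pi> i) x))"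
    using concentration_map_exists by blast
  have "even (card {..<r})"
    using \<pi> concentration_map_involution[OF F \<pi> close]
    by (intro even_card_fixpoint_free_involution[of _ \<pi>]) auto
  then show ?thesis by simp
qed

end

lemma (in dense_system) even_uniformity: "even r"
proof -
  interpret regular: covered_system V r s T S "G - irregular" by (rule covered_subsystem) blast
  interpret regular: regular_system V r s T S "G - irregular" D Q
    using DQ Q_large D_large card_regular_ge codegree_regular_le pair_degree_regular_le
    by unfold_locales auto
  show ?thesis by (rule regular.even_uniformity)
qed

section \<open>Hypergraphs\<close>

lemma bounded_hitting_set_exists:
  assumes members: "\<And>X. X \<in> \<F> \<Longrightarrow> finite X \<and> X \<noteq> {} \<and> card X \<le> k"
    and no_disjoint: "\<And>\<X>. \<X> \<subseteq> \<F> \<Longrightarrow> finite \<X> \<Longrightarrow> disjoint \<X> \<Longrightarrow> card \<X> \<noteq> t"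
  shows "\<exists>C. finite C \<and> card C \<le> t * k \<and> (\<forall>X\<in>\<F>. X \<inter> C \<noteq> {})"
proof -
  let ?disjoint = "\<lambda>\<X>. \<X> \<subseteq> \<F> \<and> finite \<X> \<and> disjoint \<X>"
  have small: "card \<X> < t" if "?disjoint \<X>" for \<X>
  proof (rule ccontr)
    assume "\<not> ?thesis"
    then obtain \<X>' where "\<X>' \<subseteq> \<X>" "card \<X>' = t" "finite \<X>'"
      by (meson not_less obtain_subset_with_card_n)
    then show False using no_disjoint[of \<X>'] that pairwise_subset by blast
  qed
  obtain \<X> where \<X>: "?disjoint \<X>" and max: "\<And>\<Y>. ?disjoint \<Y> \<Longrightarrow> card \<Y> \<le> card \<X>"
    using ex_has_greatest_nat[of ?disjoint "{}" card t] small by auto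
  have "card (\<Union>\<X>) \<le> (\<Sum>X\<in>\<X>. card X)" by (rule card_Union_le_sum_card)
  also have "\<dots> \<le> card \<X> * k" using \<X> members sum_bounded_above[of \<X> card k] by auto
  also have "\<dots> \<le> t * k" using small[OF \<X>] by simp
  finally have "card (\<Union>\<X>) \<le> t * k" .
  moreover have "finite (\<Union>\<X>)" using \<X> members by auto
  moreover have "X \<inter> \<Union>\<X> \<noteq> {}" if X: "X \<in> \<F>" for X
  proof
    assume disj: "X \<inter> \<Union>\<X> = {}"
    then have "X \<notin> \<X>" using members[OF X] by auto
    moreover have "?disjoint (insert X \<X>)"
      using \<X> X disj by (auto simp: pairwise_insert disjnt_def)
    then have "card (insert X \<X>) \<le> card \<X>" by (rule max)
    ultimately show False using \<X> by simp
  qed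
  ultimately show ?thesis by blast
qed

lemma disjoint_family_enumeration:
  assumes \<X>: "finite \<X>" "card \<X> = t" "disjoint \<X>"
    and members: "\<And>X. X \<in> \<X> \<Longrightarrow> finite X" "\<And>X. X \<in> \<X> \<Longrightarrow> card X = m"
  obtains g where "inj_on g ({..<t} \<times> {..<m})" "\<And>l. l < t \<Longrightarrow> (\<lambda>q. g (l, q)) ` {..<m} \<in> \<X>"
proof -
  obtain e where e: "bij_betw e {..<t} \<X>"
    using finite_same_card_bij[of "{..<t}" \<X>] \<X> by auto
  then have e_mem: "e l \<in> \<X>" if "l < t" for l using that by (auto simp: bij_betw_def)
  have "\<exists>h. bij_betw h {..<m} X" if "X \<in> \<X>" for X
    using finite_same_card_bij[of "{..<m}" X] members[OF that] by auto
  then obtain h where h: "\<And>X. X \<in> \<X> \<Longrightarrow> bij_betw (h X) {..<m} X" by metis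
  define g where "g = (\<lambda>(l, q). h (e l) q)"
  have image: "(\<lambda>q. g (l, q)) ` {..<m} = e l" if "l < t" for l
    using h[OF e_mem[OF that]] by (simp add: g_def bij_betw_def)
  have "l = l' \<and> q = q'"
    if l: "l < t" "l' < t" and q: "q < m" "q' < m" and eq: "g (l, q) = g (l', q')" for l l' q q'
  proof -
    have "g (l, q) \<in> e l" "g (l', q') \<in> e l'" using image[OF l(1)] image[OF l(2)] q by blast+
    then have "e l = e l'" using eq \<X>(3) e_mem[OF l(1)] e_mem[OF l(2)] by (auto simp: disjoint_def)
    then have "l = l'" using e l by (auto simp: bij_betw_def inj_on_def)
    then show ?thesis using h[OF e_mem[OF l(1)]] eq q by (auto simp: g_def bij_betw_def inj_on_def)
  qed
  then have "inj_on g ({..<t} \<times> {..<m})" by (auto simp: inj_on_def)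
  then show ?thesis using image e_mem by (intro that[of g]) auto
qed

lemma contains_copy_K_hypI:
  fixes G :: "'a hypergraph"
  assumes \<X>: "finite \<X>" "card \<X> = t" "disjoint \<X>"
    and X: "\<And>X. X \<in> \<X> \<Longrightarrow> X \<subseteq> verts G - Y" "\<And>X. X \<in> \<X> \<Longrightarrow> finite X" "\<And>X. X \<in> \<X> \<Longrightarrow> card X = r - 1"
    and Y: "Y \<subseteq> verts G" "finite Y" "card Y = s"
    and edges: "\<And>X y. X \<in> \<X> \<Longrightarrow> y \<in> Y \<Longrightarrow> X \<union> {y} \<in> edges G"
  shows "contains_copy G (K_hyp r s t)"
proof -
  obtain g where g: "inj_on g ({..<t} \<times> {..<r - 1})" "\<And>l. l < t \<Longrightarrow> (\<lambda>q. g (l, q)) ` {..<r - 1} \<in> \<X>"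
    using disjoint_family_enumeration[OF \<X> X(2,3)] by blast
  obtain u where u: "bij_betw u {..<s} Y"
    using finite_same_card_bij[of "{..<s}" Y] Y by auto
  let ?f = "case_sum g u"
  have part: "?f ` K_part r l = (\<lambda>q. g (l, q)) ` {..<r - 1}" for l by (force simp: K_part_def)
  have f_Y: "?f ` Inr ` {..<s} = Y" using u by (simp add: image_image bij_betw_def)
  have "?f ` K_part r l \<subseteq> verts G - Y" if "l < t" for l
    unfolding part using X(1)[OF g(2)[OF that]] .
  then have f_parts: "?f ` (\<Union>l<t. K_part r l) \<subseteq> verts G - Y" by blast
  have "inj_on ?f (\<Union>l<t. K_part r l)" using g(1) by (fastforce simp: inj_on_def K_part_def)
  moreover have "inj_on ?f (Inr ` {..<s})" using u by (auto simp: bij_betw_def inj_on_def)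
  moreover have "?f ` (\<Union>l<t. K_part r l) \<inter> ?f ` Inr ` {..<s} = {}"
    unfolding f_Y using f_parts by blast
  ultimately have "inj_on ?f (verts (K_hyp r s t))" by (auto simp: K_hyp_def inj_on_Un)
  moreover have "?f ` verts (K_hyp r s t) \<subseteq> verts G"
    unfolding K_hyp_def fst_conv image_Un f_Y using f_parts Y(1) by blast
  moreover have "?f ` e \<in> edges G" if "e \<in> edges (K_hyp r s t)" for e
  proof -
    obtain l y where ly: "l < t" "y < s" "e = K_part r l \<union> {Inr y}"
      using \<open>e \<in> _\<close> by (auto simp: K_hyp_def)
    have "?f (Inr y) \<in> Y" using f_Y ly(2) by blast
    then show ?thesis unfolding ly(3) image_Un part using edges[OF g(2)[OF ly(1)]] by simp
  qed
  ultimately show ?thesis unfolding contains_copy_def by blast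
qed

definition edge_tuples :: "nat \<Rightarrow> 'a hypergraph \<Rightarrow> (nat \<Rightarrow> 'a) set" where
  "edge_tuples r G = {x \<in> PiE {..<r} (\<lambda>_. verts G). inj_on x {..<r} \<and> x ` {..<r} \<in> edges G}"

lemma card_edges_le_card_edge_tuples:
  assumes uni: "uniform_hypergraph r G"
  shows "card (edges G) \<le> card (edge_tuples r G)"
proof (rule surj_card_le[where f = "\<lambda>x. x ` {..<r}"])
  have "finite (verts G)" using uni by (simp add: uniform_hypergraph_def)
  then show "finite (edge_tuples r G)"
    unfolding edge_tuples_def by (intro finite_subset[OF Collect_subset] finite_PiE) auto
  show "edges G \<subseteq> (\<lambda>x. x ` {..<r}) ` edge_tuples r G"
  proof
    fix e assume e: "e \<in> edges G"
    then have sub: "e \<subseteq> verts G" "card e = r" using uni by (auto simp: uniform_hypergraph_def)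
    then have "finite e" using \<open>finite (verts G)\<close> finite_subset by blast
    then obtain h where h: "bij_betw h {..<r} e"
      using finite_same_card_bij[of "{..<r}" e] sub(2) by auto
    then have "restrict h {..<r} \<in> edge_tuples r G" "restrict h {..<r} ` {..<r} = e"
      using sub(1) e by (auto simp: edge_tuples_def bij_betw_def inj_on_def)
    then show "e \<in> (\<lambda>x. x ` {..<r}) ` edge_tuples r G" by blast
  qed
qed

lemma common_link_edge_tuples:
  assumes w: "w \<in> common_link (edge_tuples r G) i Y" and y: "y \<in> set Y" and i: "i < r"
  shows "card (w ` ({..<r} - {i})) = r - 1" and "w ` ({..<r} - {i}) \<subseteq> verts G - {y}"
    and "w ` ({..<r} - {i}) \<union> {y} \<in> edges G"
proof -
  have x: "w(i := y) \<in> PiE {..<r} (\<lambda>_. verts G)" "inj_on (w(i := y)) {..<r}" "(w(i := y)) ` {..<r} \<in> edges G"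
    using w y by (simp_all add: common_link_def edge_tuples_def del: fun_upd_image)
  have "inj_on w ({..<r} - {i})" using x(2) by (auto simp: inj_on_def)
  then show "card (w ` ({..<r} - {i})) = r - 1" using i by (simp add: card_image)
  have "y \<notin> w ` ({..<r} - {i})" using x(2) i by (auto simp: inj_on_def)
  moreover have "w j \<in> verts G" if "j < r" "j \<noteq> i" for j
    using PiE_mem[OF x(1), of j] that by simp
  ultimately show "w ` ({..<r} - {i}) \<subseteq> verts G - {y}" by auto
  have "(w(i := y)) ` {..<r} = w ` ({..<r} - {i}) \<union> {y}" using i by auto
  then show "w ` ({..<r} - {i}) \<union> {y} \<in> edges G" using x(3) by simp
qed

lemma common_link_cover_exists:
  fixes G :: "'a hypergraph"
  assumes free: "\<not> contains_copy G (K_hyp r s t)" and i: "i < r" and "r \<ge> 2" "s \<ge> 1"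
    and Y: "Y \<in> distinct_lists s (verts G)"
  shows "\<exists>C. finite C \<and> card C \<le> t * (r - 1) \<and>
    (\<forall>w\<in>common_link (edge_tuples r G) i Y. \<exists>j<r. j \<noteq> i \<and> w j \<in> C)"
proof -
  let ?rest = "\<lambda>w. w ` ({..<r} - {i})"
  let ?\<F> = "?rest ` common_link (edge_tuples r G) i Y"
  have Y_set: "set Y \<subseteq> verts G" "card (set Y) = s" "hd Y \<in> set Y"
    using Y \<open>s \<ge> 1\<close> by (auto simp: distinct_lists_def distinct_card intro: hd_in_set)
  note rest = common_link_edge_tuples[OF _ _ i]
  have "\<exists>C. finite C \<and> card C \<le> t * (r - 1) \<and> (\<forall>X\<in>?\<F>. X \<inter> C \<noteq> {})"
  proof (rule bounded_hitting_set_exists)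
    fix X assume "X \<in> ?\<F>"
    then have "card X = r - 1" using rest(1)[OF _ Y_set(3)] by blast
    then show "finite X \<and> X \<noteq> {} \<and> card X \<le> r - 1"
      using \<open>r \<ge> 2\<close> card_gt_0_iff[of X] by simp
  next
    fix \<X> assume \<X>: "\<X> \<subseteq> ?\<F>" "finite \<X>" "disjoint \<X>"
    have "contains_copy G (K_hyp r s t)" if "card \<X> = t"
    proof (rule contains_copy_K_hypI[OF \<X>(2) that \<X>(3), of G "set Y"])
      fix X assume "X \<in> \<X>"
      then obtain w where w: "w \<in> common_link (edge_tuples r G) i Y" "X = ?rest w"
        using \<X>(1) by blast
      have "X \<subseteq> verts G - {y}" if "y \<in> set Y" for y using rest(2)[OF w(1) that] w(2) by simp
      then show "X \<subseteq> verts G - set Y" using Y_set(3) by blast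
      show "finite X" "card X = r - 1" using rest(1)[OF w(1) Y_set(3)] w(2) by simp_all
      show "X \<union> {y} \<in> edges G" if "y \<in> set Y" for y using rest(3)[OF w(1) that] w(2) by simp
    qed (use Y_set in auto)
    then show "card \<X> \<noteq> t" using free by blast
  qed
  then obtain C where C: "finite C" "card C \<le> t * (r - 1)"
    "\<And>w. w \<in> common_link (edge_tuples r G) i Y \<Longrightarrow> ?rest w \<inter> C \<noteq> {}"
    by auto
  then show ?thesis by (intro exI[of _ C]) blast
qed

lemma card_edges_le_of_odd_uniformity:
  fixes G :: "'a hypergraph" and D Q :: real
  assumes uni: "uniform_hypergraph r G" and free: "\<not> contains_copy G (K_hyp r s t)"
    and r: "odd r" "r \<ge> 3" and s: "s \<ge> 3" and t: "t \<ge> 1" and n: "card (verts G) = n"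
    and DQ: "(D * Q) ^ (s - 1) = real n ^ (s - 2)"
    and Q_large: "(100 * real r * real (t * (r - 1))) ^ (r + s) \<le> Q"
    and D_large: "Q ^ (500 * s\<^sup>2) < D"
    and E_ge_2: "2 \<le> real n ^ (r - 1) * D"
  shows "real (card (edges G)) \<le> real n ^ (r - 1) * D"
proof (rule ccontr)
  assume "\<not> ?thesis"
  then have many: "real n ^ (r - 1) * D < real (card (edge_tuples r G))"
    using card_edges_le_card_edge_tuples[OF uni] by linarith
  define E where "E = real n ^ (r - 1) * D"
  define m where "m = nat \<lfloor>E\<rfloor>"
  have m: "real m \<le> E" "E / 2 \<le> real m"
    using E_ge_2 unfolding m_def E_def[symmetric] by linarith+
  then have "m \<le> card (edge_tuples r G)" using many unfolding E_def[symmetric] by linarith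
  then obtain F where F: "F \<subseteq> edge_tuples r G" "card F = m" by (meson obtain_subset_with_card_n)
  have "\<forall>i Y. \<exists>C. i < r \<longrightarrow> Y \<in> distinct_lists s (verts G) \<longrightarrow> finite C \<and> card C \<le> t * (r - 1) \<and>
      (\<forall>w\<in>common_link (edge_tuples r G) i Y. \<exists>j<r. j \<noteq> i \<and> w j \<in> C)"
    using common_link_cover_exists[OF free] r s by simp
  then obtain S where S: "\<And>i Y. i < r \<Longrightarrow> Y \<in> distinct_lists s (verts G) \<Longrightarrow>
      finite (S i Y) \<and> card (S i Y) \<le> t * (r - 1) \<and>
      (\<forall>w\<in>common_link (edge_tuples r G) i Y. \<exists>j<r. j \<noteq> i \<and> w j \<in> S i Y)"
    by metis
  interpret dense_system "verts G" r s "t * (r - 1)" S F D Q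
  proof unfold_locales
    show "\<exists>j<r. j \<noteq> i \<and> w j \<in> S i Y"
      if "i < r" "Y \<in> distinct_lists s (verts G)" "w \<in> common_link F i Y" for i Y w
    proof -
      have "w \<in> common_link (edge_tuples r G) i Y"
        using that(3) F(1) by (auto simp: common_link_def shadow_def)
      then show ?thesis using S[OF that(1,2)] by blast
    qed
    show "real (card F) \<le> real (card (verts G)) ^ (r - 1) * D"
      "real (card (verts G)) ^ (r - 1) * D / 2 \<le> real (card F)"
      using m F(2) n by (auto simp: E_def)
  qed (use uni r s t S F DQ Q_large D_large n in \<open>auto simp: uniform_hypergraph_def edge_tuples_def\<close>)
  show False using even_uniformity r(1) by simp
qed

section \<open>The extremal number\<close>

lemma extremal_number_0:
  assumes "edges H \<noteq> {}" "r \<ge> 1"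
  shows "extremal_number r 0 H = 0"
proof -
  obtain G :: "nat hypergraph" where G: "uniform_hypergraph r G" "card (verts G) = 0"
    "card (edges G) = extremal_number r 0 H"
    using extremal_number_attained[OF assms(1)] by metis
  then have "verts G = {}" by (simp add: uniform_hypergraph_def)
  then have "edges G = {}" using G(1) assms(2) unfolding uniform_hypergraph_def by fastforce
  then show ?thesis using G(3) by simp
qed

lemma extremal_number_le_two_power:
  assumes "edges H \<noteq> {}"
  shows "extremal_number r n H \<le> 2 ^ n"
  using extremal_number_attained[OF assms] card_edges_le_two_power by metis

lemma extremal_number_le_const_powr:
  assumes H: "edges H \<noteq> {}" and "r \<ge> 1" "\<alpha> \<ge> 0"
    and "\<forall>\<^sub>F n in sequentially. real (extremal_number r n H) \<le> real n powr \<alpha>"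
  shows "\<exists>C. \<forall>n. real (extremal_number r n H) \<le> C * real n powr \<alpha>"
proof -
  obtain threshold where threshold: "\<And>n. n \<ge> threshold \<Longrightarrow> real (extremal_number r n H) \<le> real n powr \<alpha>"
    using assms(4) by (auto simp: eventually_sequentially)
  have "real (extremal_number r n H) \<le> 2 ^ threshold * real n powr \<alpha>" for n
  proof -
    consider "n = 0" | "1 \<le> n" "n < threshold" | "n \<ge> threshold" by linarith
    then show ?thesis
    proof cases
      case 1
      then show ?thesis using extremal_number_0[OF H \<open>r \<ge> 1\<close>] by simp
    next
      case 2
      have "real (extremal_number r n H) \<le> real (2 ^ n)"
        by (intro of_nat_mono extremal_number_le_two_power H)
      also have "\<dots> = 2 ^ n" by simp
      also have "\<dots> \<le> 2 ^ threshold * 1" using 2 by simp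
      also have "\<dots> \<le> 2 ^ threshold * real n powr \<alpha>"
        using 2 \<open>\<alpha> \<ge> 0\<close> by (intro mult_left_mono ge_one_powr_ge_zero) auto
      finally show ?thesis .
    next
      case 3
      have "1 * real n powr \<alpha> \<le> 2 ^ threshold * real n powr \<alpha>" by (intro mult_right_mono) auto
      then show ?thesis using threshold[OF 3] by linarith
    qed
  qed
  then show ?thesis by blast
qed

text \<open>Chosen such that \<open>Q ^ (500 s\<^sup>2)\<close> is \<open>n powr (1/4)\<close> for \<open>Q = n powr saving s\<close>.\<close>

definition saving :: "nat \<Rightarrow> real" where
  "saving s = 1 / (2000 * (real s)\<^sup>2)"

lemma saving_gt_0: "s \<ge> 3 \<Longrightarrow> 0 < saving s"
  by (simp add: saving_def)

lemma saving_less: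
  assumes "s \<ge> 3"
  shows "1 / (real s - 1) + saving s < 3 / 4"
proof -
  have "1 / (real s - 1) \<le> 1 / 2" using assms by (intro divide_left_mono) auto
  moreover have "saving s \<le> 1 / (2000 * 3\<^sup>2)"
    unfolding saving_def using assms by (intro divide_left_mono mult_left_mono power_mono) auto
  ultimately show ?thesis by simp
qed

lemma powr_scales:
  fixes n s r :: nat
  assumes n: "n \<ge> 2" and s: "s \<ge> 3" and "r \<ge> 1"
  defines "Q \<equiv> real n powr saving s" and "D \<equiv> real n powr (1 - 1 / (real s - 1) - saving s)"
  shows "(D * Q) ^ (s - 1) = real n ^ (s - 2)" and "Q ^ (500 * s\<^sup>2) < D"
    and "real n ^ (r - 1) * D = real n powr (real r - 1 / (real s - 1) - saving s)"
proof -
  have "(D * Q) ^ (s - 1) = real n powr ((1 - 1 / (real s - 1)) * real (s - 1))"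
    using n by (simp add: D_def Q_def powr_powr flip: powr_realpow powr_add)
  also have "(1 - 1 / (real s - 1)) * real (s - 1) = real (s - 2)"
    using s by (simp add: of_nat_diff field_simps)
  finally show "(D * Q) ^ (s - 1) = real n ^ (s - 2)" using n by (simp add: powr_realpow)
  have "Q ^ (500 * s\<^sup>2) = real n powr (saving s * real (500 * s\<^sup>2))"
    unfolding Q_def using n by (simp add: powr_powr flip: powr_realpow)
  also have "saving s * real (500 * s\<^sup>2) = 1 / 4" using s by (simp add: saving_def)
  also have "real n powr (1 / 4) < D"
    unfolding D_def
    using saving_less[OF s] n by (intro powr_less_mono) auto
  finally show "Q ^ (500 * s\<^sup>2) < D" .
  have "real n ^ (r - 1) = real n powr real (r - 1)" using n by (simp add: powr_realpow)
  then have "real n ^ (r - 1) * D = real n powr (real (r - 1) + (1 - 1 / (real s - 1) - saving s))"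
    by (simp add: D_def flip: powr_add)
  also have "real (r - 1) + (1 - 1 / (real s - 1) - saving s) = real r - 1 / (real s - 1) - saving s"
    using \<open>r \<ge> 1\<close> by (simp add: of_nat_diff)
  finally show "real n ^ (r - 1) * D = real n powr (real r - 1 / (real s - 1) - saving s)" .
qed

lemma edges_K_hyp_nonempty:
  assumes "s \<ge> 1" "t \<ge> 1"
  shows "edges (K_hyp r s t) \<noteq> {}"
proof -
  have "K_part r 0 \<union> {Inr 0} \<in> edges (K_hyp r s t)"
    unfolding K_hyp_def snd_conv using assms by (intro CollectI exI[of _ 0]) simp
  then show ?thesis by blast
qed

lemma eventually_extremal_number_le:
  assumes r: "odd r" "r \<ge> 3" and s: "s \<ge> 3" and t: "t \<ge> 1"
  shows "\<forall>\<^sub>F n in sequentially. real (extremal_number r n (K_hyp r s t))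
    \<le> real n powr (real r - 1 / (real s - 1) - saving s)"
proof -
  let ?K = "(100 * real r * real (t * (r - 1))) ^ (r + s)"
  have "?K \<le> real n powr saving s" if "n \<ge> nat \<lceil>?K powr (1 / saving s)\<rceil>" for n
  proof -
    have "?K = (?K powr (1 / saving s)) powr saving s"
      using saving_gt_0[OF s] by (simp add: powr_powr)
    also have "\<dots> \<le> real n powr saving s"
    proof (rule powr_mono2)
      show "?K powr (1 / saving s) \<le> real n" using that by linarith
    qed (use saving_gt_0[OF s] in auto)
    finally show ?thesis .
  qed
  then have "\<forall>\<^sub>F n in sequentially. ?K \<le> real n powr saving s"
    unfolding eventually_sequentially by blast
  then show ?thesis
    using eventually_ge_at_top[of 2]
  proof eventually_elim
    case (elim n)
    obtain G :: "nat hypergraph" where G: "uniform_hypergraph r G" "card (verts G) = n"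
      "\<not> contains_copy G (K_hyp r s t)" "card (edges G) = extremal_number r n (K_hyp r s t)"
      using extremal_number_attained[OF edges_K_hyp_nonempty] s t by (metis le_trans one_le_numeral)
    have "real n powr 1 \<le> real n powr (real r - 1 / (real s - 1) - saving s)"
      using saving_less[OF s] r(2) elim(2) by (intro powr_mono) auto
    then have E_ge_2: "2 \<le> real n powr (real r - 1 / (real s - 1) - saving s)" using elim(2) by simp
    note scales = powr_scales[OF elim(2) s, of r]
    show ?case
      using card_edges_le_of_odd_uniformity[OF G(1,3) r s t G(2) scales(1) elim(1) scales(2)]
        scales(3) E_ge_2 r(2) G(4) by simp
  qed
qed

theorem theorem1p1:
  fixes s :: nat
  assumes "s \<ge> 3"
  shows "\<exists>\<epsilon>::real. \<epsilon> > 0 \<and>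
           (\<forall>r::nat. odd r \<and> r \<ge> 3 \<longrightarrow>
             (\<forall>t::nat. t \<ge> 1 \<longrightarrow>
               (\<exists>C::real. \<forall>n::nat.
                  real (extremal_number r n (K_hyp r s t))
                    \<le> C * real n powr (real r - 1 / (real s - 1) - \<epsilon>))))"
proof (rule exI[of _ "saving s"], intro conjI allI impI)
  show "0 < saving s" by (rule saving_gt_0[OF assms])
  fix r t :: nat
  assume r: "odd r \<and> r \<ge> 3" and t: "t \<ge> 1"
  show "\<exists>C. \<forall>n. real (extremal_number r n (K_hyp r s t))
      \<le> C * real n powr (real r - 1 / (real s - 1) - saving s)"
  proof (rule extremal_number_le_const_powr)
    show "edges (K_hyp r s t) \<noteq> {}" using assms t by (intro edges_K_hyp_nonempty) auto
    show "0 \<le> real r - 1 / (real s - 1) - saving s" using saving_less[OF assms] r by linarith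
    show "\<forall>\<^sub>F n in sequentially. real (extremal_number r n (K_hyp r s t))
        \<le> real n powr (real r - 1 / (real s - 1) - saving s)"
      using r assms t by (intro eventually_extremal_number_le) auto
  qed (use r in simp)
qed

end
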